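(* Let $\beta\in(0,1]$, $\eta>0$, and let $Y_f^{\beta,\eta}(t)=\sum_{i=1}^{N_f(t)}X_i$, $t\ge0$, where the iid jumps $X_i$ have the Mittag-Leffler distribution with parameters $\beta,\eta$. Then the probability density function $P^{\beta,\eta}_f(x,t)$, $x>0$, of $Y_f^{\beta,\eta}(t)$ satisfies the fractional differential equation $$\eta\,\mathcal{D}^f_t P^{\beta,\eta}_f(x,t)=-\left[\lambda+\mathcal{D}^f_t\right]\mathcal{D}^\beta_x P^{\beta,\eta}_f(x,t),$$ where $\mathcal{D}^\beta_x$ is the Caputo–Djrbashian fractional derivative of order $\beta$ in $x$, with the conditions $$P^{\beta,\eta}_f(x,0)=0,\qquad \mathbb{P}[Y_f^{\beta,\eta}(t)>0]=1-\mathbb{E}[e^{-\lambda E_f(t)}].$$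
   Context: Let $f(s)=bs+\int_0^\infty(1-e^{-sx})\,\nu(dx)$, $s>0$, with $b\ge 0$ and $\nu$ a non-negative L\'evy measure on $(0,\infty)$ with $\int_0^\infty (x\wedge 1)\,\nu(dx)<\infty$ and $\nu((0,\infty))=\infty$. Let $\{D_f(t)\}_{t\ge0}$ be the L\'evy subordinator with $\mathbb{E}[e^{-sD_f(t)}]=e^{-tf(s)}$ and $E_f(t)=\inf\{r\ge0: D_f(r)>t\}$ its inverse. Let $\{N(t)\}_{t\ge0}$ be a Poisson process with rate $\lambda>0$ independent of $\{E_f(t)\}$, and $N_f(t)=N(E_f(t))$. The iid jumps $X_i$ are independent of $N$ and $E_f$, and an empty sum is $0$. Thus $Y_f^{\beta,\eta}(t)$ has an atom at $0$, and $P_f^{\beta,\eta}(x,t)$ denotes the density of its law on $(0,\infty)$. The Mittag-Leffler distribution with parameters $\beta\in(0,1]$, $\eta>0$ has density $\eta x^{\beta-1}E_{\beta,\beta}(-\eta x^\beta)$, $x>0$, where $E_{\beta,\beta}(z)=\sum_{n\ge0}z^n/\Gamma(\beta n+\beta)$; its Laplace transform is $\eta/(s^\beta+\eta)$. The generalized Caputo–Djrbashian derivative with respect to $f$ is, for absolutely continuous $u$, $$\mathcal{D}^f_t u(t)=b\frac{d}{dt}u(t)+\int_0^t\frac{\partial}{\partial t}u(t-s)\,\bar\nu(s)\,ds,\qquad \bar\nu(s)=\nu((s,\infty)).$$ The Caputo–Djrbashian derivative $\mathcal{D}^\beta$ is the special case $f(s)=s^\beta$, i.e. $b=0$ and $\bar\nu(s)=s^{-\beta}/\Gamma(1-\beta)$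 for $\beta\in(0,1)$, and the ordinary derivative for $\beta=1$.
   Formalization: The derivatives are taken in regularised form, b u'(t) + d/dt of the integral of (u(t-s)-u(0)) times the tail, with P(0,t)=0, since for β<1 the density behaves like x^(β-1) at 0 and the stated integral diverges; P is the continuous version of the density. *)

theory Defs
  imports "HOL-Probability.Probability"
begin

subsection \<open>Bernstein function, subordinator, inverse subordinator, Poisson process\<close>

definition subordinator_levy_measure :: "real measure \<Rightarrow> bool" where
  "subordinator_levy_measure \<nu> \<longleftrightarrow>
     sets \<nu> = sets borel \<and> emeasure \<nu> {..0} = 0 \<and> (\<integral>\<^sup>+x. ennreal (min x 1) \<partial>\<nu>) < \<infinity>"

definition bernstein_fun :: "real \<Rightarrow> real measure \<Rightarrow> real \<Rightarrow> real" where
  "bernstein_fun b \<nu> s = b * s + (LINT x:{0<..}|\<nu>. 1 - exp (- s * x))"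

definition levy_tail :: "real measure \<Rightarrow> real \<Rightarrow> real" where
  "levy_tail \<nu> s = measure \<nu> {s<..}"

definition indep_increments :: "'a measure \<Rightarrow> (real \<Rightarrow> 'a \<Rightarrow> real) \<Rightarrow> bool" where
  "indep_increments M Z \<longleftrightarrow>
     (\<forall>\<tau> :: nat \<Rightarrow> real. 0 \<le> \<tau> 0 \<longrightarrow> mono \<tau> \<longrightarrow>
        prob_space.indep_vars M (\<lambda>_. borel) (\<lambda>i \<omega>. Z (\<tau> (Suc i)) \<omega> - Z (\<tau> i) \<omega>) UNIV)"

definition nondecreasing_rcont_paths :: "'a measure \<Rightarrow> (real \<Rightarrow> 'a \<Rightarrow> real) \<Rightarrow> bool" where
  "nondecreasing_rcont_paths M Z \<longleftrightarrow>
     (AE \<omega> in M. mono_on {0..} (\<lambda>t. Z t \<omega>) \<and>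
        (\<forall>t\<ge>0. continuous (at_right t) (\<lambda>s. Z s \<omega>)))"

definition levy_subordinator ::
    "'a measure \<Rightarrow> (real \<Rightarrow> real) \<Rightarrow> (real \<Rightarrow> 'a \<Rightarrow> real) \<Rightarrow> bool" where
  "levy_subordinator M f D \<longleftrightarrow>
     (\<forall>t\<ge>0. D t \<in> borel_measurable M) \<and>
     (AE \<omega> in M. D 0 \<omega> = 0) \<and>
     indep_increments M D \<and>
     (\<forall>s\<ge>0. \<forall>t\<ge>0. distr M borel (\<lambda>\<omega>. D (s + t) \<omega> - D s \<omega>) = distr M borel (D t)) \<and>
     nondecreasing_rcont_paths M D \<and>
     (\<forall>t\<ge>0. \<forall>s>0. prob_space.expectation M (\<lambda>\<omega>. exp (- s * D t \<omega>)) = exp (- t * f s))"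

definition inverse_process :: "(real \<Rightarrow> 'a \<Rightarrow> real) \<Rightarrow> real \<Rightarrow> 'a \<Rightarrow> real" where
  "inverse_process D t \<omega> = Inf {r. 0 \<le> r \<and> D r \<omega> > t}"

definition poisson_process :: "'a measure \<Rightarrow> real \<Rightarrow> (real \<Rightarrow> 'a \<Rightarrow> nat) \<Rightarrow> bool" where
  "poisson_process M lam N \<longleftrightarrow>
     (\<forall>t\<ge>0. N t \<in> measurable M (count_space UNIV)) \<and>
     (AE \<omega> in M. N 0 \<omega> = 0) \<and>
     indep_increments M (\<lambda>t \<omega>. real (N t \<omega>)) \<and>
     (\<forall>s\<ge>0. \<forall>t>0. distr M borel (\<lambda>\<omega>. real (N (s + t) \<omega>) - real (N s \<omega>)) =
                    distr (measure_pmf (poisson_pmf (lam * t))) borel real) \<and>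
     nondecreasing_rcont_paths M (\<lambda>t \<omega>. real (N t \<omega>))"

text \<open>
  \<open>prob_space.indep_var\<close> forces both random variables to have the same value type; here the
  value types differ.
\<close>

definition indep_rv ::
    "'a measure \<Rightarrow> 'b measure \<Rightarrow> ('a \<Rightarrow> 'b) \<Rightarrow> 'c measure \<Rightarrow> ('a \<Rightarrow> 'c) \<Rightarrow> bool" where
  "indep_rv M S U T V \<longleftrightarrow>
     U \<in> measurable M S \<and> V \<in> measurable M T \<and>
     prob_space.indep_set M (sets (vimage_algebra (space M) U S)) (sets (vimage_algebra (space M) V T))"

text \<open>A process indexed by time in \<open>[0,\<infinity>)\<close> as one random variable in the product space of paths.\<close>

definition path_of :: "(real \<Rightarrow> 'a \<Rightarrow> 'b) \<Rightarrow> 'a \<Rightarrow> real \<Rightarrow> 'b" where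
  "path_of Z \<omega> = restrict (\<lambda>t. Z t \<omega>) {0..}"

definition path_space :: "'b measure \<Rightarrow> (real \<Rightarrow> 'b) measure" where
  "path_space S = PiM {0..} (\<lambda>_. S)"

subsection \<open>Mittag-Leffler distribution and compound process\<close>

definition mittag_leffler :: "real \<Rightarrow> real \<Rightarrow> real \<Rightarrow> real" where
  "mittag_leffler \<alpha> \<gamma> z = (\<Sum>n. z ^ n / Gamma (\<alpha> * real n + \<gamma>))"

definition mittag_leffler_density :: "real \<Rightarrow> real \<Rightarrow> real \<Rightarrow> real" where
  "mittag_leffler_density \<beta> \<eta> x =
     (if 0 < x then \<eta> * x powr (\<beta> - 1) * mittag_leffler \<beta> \<beta> (- \<eta> * x powr \<beta>) else 0)"

definition compound_process ::
    "(real \<Rightarrow> 'a \<Rightarrow> nat) \<Rightarrow> (nat \<Rightarrow> 'a \<Rightarrow> real) \<Rightarrow> real \<Rightarrow> 'a \<Rightarrow> real" where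
  "compound_process N X t \<omega> = (\<Sum>i\<in>{1..N t \<omega>}. X i \<omega>)"

text \<open>
  \<open>P x t\<close> is the density in \<open>x\<close> of the law of \<open>Y t\<close> on \<open>(0,\<infinity>)\<close>, extended by \<open>0\<close> to
  \<open>x \<le> 0\<close>; the atom at \<open>0\<close> is not part of it. Continuity on \<open>(0,\<infinity>)\<close> selects
  a unique function out of the class of almost everywhere equal densities, so that
  pointwise equations for \<open>P\<close> make sense.
\<close>

definition density_on_pos ::
    "'a measure \<Rightarrow> (real \<Rightarrow> 'a \<Rightarrow> real) \<Rightarrow> (real \<Rightarrow> real \<Rightarrow> real) \<Rightarrow> bool" where
  "density_on_pos M Y P \<longleftrightarrow>
     (\<forall>t\<ge>0. (\<forall>x. 0 \<le> P x t) \<and> (\<forall>x\<le>0. P x t = 0) \<and> continuous_on {0<..} (\<lambda>x. P x t) \<and>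
        density (distr M borel (Y t)) (indicator {0<..}) = density lborel (\<lambda>x. ennreal (P x t)))"

subsection \<open>Generalized Caputo--Djrbashian derivative\<close>

text \<open>
  For absolutely continuous \<open>u\<close> with derivative \<open>v\<close> the derivative with drift \<open>b\<close> and tail \<open>k\<close>
  is \<open>b v(t) + \<integral>\<^sub>0\<^sup>t v(t - s) k(s) ds\<close>. The functions it is applied to below
  need not be absolutely continuous: for \<open>\<beta> < 1\<close> the density behaves like \<open>x powr (\<beta> - 1)\<close>
  at \<open>0\<close>, which makes \<open>\<integral>\<^sub>0\<^sup>x u'(x - s) s powr (- \<beta>) ds\<close> divergent for all \<open>x > 0\<close>, and
  in \<open>t\<close> absolute continuity can fail when \<open>\<nu>\<close> has atoms. Hence the differentiation is taken
  outside the memory integral, where it acts on \<open>u - u 0\<close>. The lemmas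
  \<open>memory_integral_abs_cont\<close> and \<open>caputo_deriv_C1\<close> state the agreement
  with the formula above. The value \<open>u 0\<close> is that of the function itself, not
  a limit: it is \<open>0\<close> for a density extended by \<open>0\<close>.
\<close>

definition memory_integral :: "(real \<Rightarrow> real) \<Rightarrow> (real \<Rightarrow> real) \<Rightarrow> real \<Rightarrow> real" where
  "memory_integral k u t = (LBINT s:{0..t}. (u (t - s) - u 0) * k s)"

definition caputo_deriv :: "real \<Rightarrow> (real \<Rightarrow> real) \<Rightarrow> (real \<Rightarrow> real) \<Rightarrow> real \<Rightarrow> real" where
  "caputo_deriv b k u t = b * deriv u t + deriv (memory_integral k u) t"

text \<open>All integrals and derivatives in \<open>caputo_deriv b k u t\<close> exist.\<close>

definition caputo_differentiable ::
    "real \<Rightarrow> (real \<Rightarrow> real) \<Rightarrow> (real \<Rightarrow> real) \<Rightarrow> real \<Rightarrow> bool" where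
  "caputo_differentiable b k u t \<longleftrightarrow>
     (\<forall>r>0. set_integrable lborel {0..r} (\<lambda>s. (u (r - s) - u 0) * k s)) \<and>
     (b \<noteq> 0 \<longrightarrow> u differentiable at t) \<and>
     memory_integral k u differentiable at t"

definition power_drift :: "real \<Rightarrow> real" where
  "power_drift \<beta> = (if \<beta> = 1 then 1 else 0)"

definition power_tail :: "real \<Rightarrow> real \<Rightarrow> real" where
  "power_tail \<beta> s = (if \<beta> = 1 then 0 else s powr (- \<beta>) / Gamma (1 - \<beta>))"

lemma memory_integral_abs_cont:
  fixes u v k :: "real \<Rightarrow> real"
  assumes t: "0 \<le> t"
    and v: "set_integrable lborel {0..t} v"
    and u: "\<And>r. r \<in> {0..t} \<Longrightarrow> u r = u 0 + (LBINT q:{0..r}. v q)"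
    and k: "set_integrable lborel {0..t} k"
  shows "memory_integral k u t = (LBINT r:{0..t}. (LBINT s:{0..r}. v (r - s) * k s))"
proof -
  define v0 where "v0 = (\<lambda>q. indicator {0..t} q * v q)"
  define k0 where "k0 = (\<lambda>s. indicator {0..t} s * k s)"
  have v0i: "integrable lborel v0" and k0i: "integrable lborel k0"
    using v k by (auto simp: v0_def k0_def set_integrable_def)
  have [measurable]: "v0 \<in> borel_measurable borel" "k0 \<in> borel_measurable borel"
    using borel_measurable_integrable[OF v0i] borel_measurable_integrable[OF k0i] by auto
  define H where "H = (\<lambda>(s, r). k0 s * (v0 (r - s) * indicator {..t} r))"
  have [measurable]: "H \<in> borel_measurable (lborel \<Otimes>\<^sub>M lborel)"
    unfolding H_def by measurable
  have shift: "integrable lborel (\<lambda>r. v0 (r - s))" for s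
    using lborel_integrable_real_affine[OF v0i, of 1 "- s"] by simp
  have int1: "integrable lborel (\<lambda>r. v0 (r - s) * indicator {..t} r)" for s
    by (rule Bochner_Integration.integrable_bound[OF shift[of s]])
       (auto simp: indicator_def)
  have shift_int: "(\<integral>r. f (r - s) \<partial>lborel) = (\<integral>q. f q \<partial>lborel)" for f :: "real \<Rightarrow> real" and s
    using lborel_integral_real_affine[of 1 f "- s"] by simp
  have inner_bound: "(\<integral>r. norm (v0 (r - s) * indicator {..t} r) \<partial>lborel) \<le> (\<integral>q. norm (v0 q) \<partial>lborel)" for s
  proof -
    have "(\<integral>r. norm (v0 (r - s) * indicator {..t} r) \<partial>lborel) \<le> (\<integral>r. norm (v0 (r - s)) \<partial>lborel)"
      using int1[of s] shift[of s]
      by (intro integral_mono integrable_norm) (auto simp: indicator_def)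
    also have "\<dots> = (\<integral>q. norm (v0 q) \<partial>lborel)"
      by (rule shift_int[where f="\<lambda>q. norm (v0 q)"])
    finally show ?thesis .
  qed
  have Hi: "integrable (lborel \<Otimes>\<^sub>M lborel) H"
  proof (rule lborel_pair.Fubini_integrable)
    show "integrable lborel (\<lambda>x. \<integral>y. norm (H (x, y)) \<partial>lborel)"
    proof (rule Bochner_Integration.integrable_bound)
      show "integrable lborel (\<lambda>x. (\<integral>q. norm (v0 q) \<partial>lborel) * k0 x)"
        using k0i by simp
      show "(\<lambda>x. \<integral>y. norm (H (x, y)) \<partial>lborel) \<in> borel_measurable lborel"
        by measurable
      show "AE x in lborel. norm (\<integral>y. norm (H (x, y)) \<partial>lborel)
              \<le> norm ((\<integral>q. norm (v0 q) \<partial>lborel) * k0 x)"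
      proof (rule AE_I2)
        fix x
        have "(\<integral>y. norm (H (x, y)) \<partial>lborel) = norm (k0 x) * (\<integral>y. norm (v0 (y - x) * indicator {..t} y) \<partial>lborel)"
          by (simp only: H_def prod.case norm_mult[of "k0 x"] Bochner_Integration.integral_mult_right_zero)
        also have "\<dots> \<le> norm (k0 x) * (\<integral>q. norm (v0 q) \<partial>lborel)"
          by (intro mult_left_mono inner_bound) auto
        finally show "norm (\<integral>y. norm (H (x, y)) \<partial>lborel)
              \<le> norm ((\<integral>q. norm (v0 q) \<partial>lborel) * k0 x)"
          by (simp add: abs_mult mult.commute abs_of_nonneg integral_nonneg_AE)
      qed
    qed
    show "AE x in lborel. integrable lborel (\<lambda>y. H (x, y))"
      using int1 by (auto simp: H_def)
  qed simp
  have Hs: "(\<integral>r. H (s, r) \<partial>lborel) = indicator {0..t} s * ((u (t - s) - u 0) * k s)" for s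
  proof (cases "s \<in> {0..t}")
    case True
    have "(\<integral>r. v0 (r - s) * indicator {..t} r \<partial>lborel) = (\<integral>r. (\<lambda>q. v0 q * indicator {..t - s} q) (r - s) \<partial>lborel)"
      by (rule Bochner_Integration.integral_cong) (auto simp: indicator_def)
    also have "\<dots> = (\<integral>q. v0 q * indicator {..t - s} q \<partial>lborel)"
      by (rule shift_int)
    also have "\<dots> = (LBINT q:{0..t - s}. v q)"
      unfolding set_lebesgue_integral_def v0_def
      by (rule Bochner_Integration.integral_cong) (use True in \<open>auto simp: indicator_def\<close>)
    also have "\<dots> = u (t - s) - u 0"
      using u[of "t - s"] True by simp
    finally have "(\<integral>r. v0 (r - s) * indicator {..t} r \<partial>lborel) = u (t - s) - u 0" .
    then show ?thesis
      using True by (simp add: H_def k0_def)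
  qed (simp add: H_def k0_def)
  have Hr: "(\<integral>s. H (s, r) \<partial>lborel) = indicator {0..t} r * (LBINT s:{0..r}. v (r - s) * k s)" for r
  proof -
    have "(\<integral>s. H (s, r) \<partial>lborel) = (\<integral>s. indicator {0..t} r * (indicator {0..r} s * (v (r - s) * k s)) \<partial>lborel)"
      by (rule Bochner_Integration.integral_cong) (auto simp: H_def v0_def k0_def indicator_def)
    then show ?thesis
      by (simp add: set_lebesgue_integral_def)
  qed
  have "memory_integral k u t = (\<integral>s. (\<integral>r. H (s, r) \<partial>lborel) \<partial>lborel)"
    by (simp add: memory_integral_def set_lebesgue_integral_def Hs)
  also have "\<dots> = (\<integral>r. (\<integral>s. H (s, r) \<partial>lborel) \<partial>lborel)"
    using lborel_pair.Fubini_integral[of "\<lambda>s r. H (s, r)"] Hi by simp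
  also have "\<dots> = (LBINT r:{0..t}. (LBINT s:{0..r}. v (r - s) * k s))"
    by (simp add: set_lebesgue_integral_def Hr)
  finally show ?thesis .
qed

lemma caputo_deriv_C1:
  fixes u v k :: "real \<Rightarrow> real"
  assumes t: "0 < t"
    and u: "\<And>r. 0 \<le> r \<Longrightarrow> (u has_real_derivative v r) (at r within {0..})"
    and v: "continuous_on {0..} v"
    and k: "\<And>r. 0 \<le> r \<Longrightarrow> set_integrable lborel {0..r} k"
  shows "caputo_deriv b k u t = b * v t + (LBINT s:{0..t}. v (t - s) * k s)"
proof -
  define c where "c = (\<lambda>r. LBINT s:{0..r}. v (r - s) * k s)"
  define T where "T = t + 1"
  have mem: "memory_integral k u r = (LBINT q:{0..r}. c q)" if "0 \<le> r" for r
    unfolding c_def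
  proof (rule memory_integral_abs_cont[OF that])
    show "set_integrable lborel {0..r} v"
      by (intro borel_integrable_atLeastAtMost' continuous_on_subset[OF v]) auto
    show "set_integrable lborel {0..r} k" by (rule k[OF that])
    fix q assume q: "q \<in> {0..r}"
    have "(LBINT s:{0..q}. v s) = u q - u 0"
      unfolding set_lebesgue_integral_def
    proof (rule integral_FTC_atLeastAtMost)
      show "0 \<le> q" using q by simp
      show "continuous_on {0..q} v" by (rule continuous_on_subset[OF v]) auto
      fix x assume "0 \<le> x" "x \<le> q"
      then show "(u has_vector_derivative v x) (at x within {0..q})"
        using DERIV_subset[OF u, of x "{0..q}"]
        by (auto simp: has_real_derivative_iff_has_vector_derivative)
    qed
    then show "u q = u 0 + (LBINT s:{0..q}. v s)" by simp
  qed
  have cont: "continuous_on {0..T} c"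
  proof (rule continuous_on_sequentiallyI)
    fix \<rho> :: "nat \<Rightarrow> real" and r assume \<rho>: "\<forall>n. \<rho> n \<in> {0..T}" and r: "r \<in> {0..T}"
      and lim: "\<rho> \<longlonglongrightarrow> r"
    obtain B where B: "\<And>x. x \<in> {0..T} \<Longrightarrow> \<bar>v x\<bar> \<le> B"
    proof -
      have "compact (v ` {0..T})"
        by (intro compact_continuous_image continuous_on_subset[OF v]) auto
      then have "bounded (v ` {0..T})" by (rule compact_imp_bounded)
      then obtain B where "\<forall>y\<in>v ` {0..T}. norm y \<le> B" unfolding bounded_iff by blast
      then show ?thesis by (intro that[of B]) simp
    qed
    have B0: "0 \<le> B" using B[of r] r by (meson abs_ge_zero order_trans)
    define w where "w = (\<lambda>x. v (max 0 x))"
    have wc: "continuous_on UNIV w" unfolding w_def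
      by (intro continuous_on_compose2[OF v] continuous_intros) auto
    have [measurable]: "w \<in> borel_measurable borel"
      by (rule borel_measurable_continuous_onI[OF wc])
    define k0 where "k0 = (\<lambda>s. indicator {0..T} s * k s)"
    have k0i: "integrable lborel k0"
      using k[of T] t by (simp add: k0_def set_integrable_def T_def)
    have [measurable]: "k0 \<in> borel_measurable borel"
      using borel_measurable_integrable[OF k0i] by auto
    have meas: "(\<lambda>s. indicator {..x} s * (w (x - s) * k0 s)) \<in> borel_measurable lborel" for x
    proof -
      have [measurable]: "(\<lambda>s. w (x - s)) \<in> borel_measurable lborel"
        by (rule measurable_compose[of "\<lambda>s. x - s" lborel borel w]) simp_all
      show ?thesis by simp
    qed
    have ceq: "c x = (\<integral>s. indicator {..x} s * (w (x - s) * k0 s) \<partial>lborel)" if "x \<in> {0..T}" for x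
      unfolding c_def set_lebesgue_integral_def
      by (rule Bochner_Integration.integral_cong)
         (use that in \<open>auto simp: indicator_def w_def k0_def max_def\<close>)
    have "(\<lambda>n. \<integral>s. indicator {..\<rho> n} s * (w (\<rho> n - s) * k0 s) \<partial>lborel)
             \<longlonglongrightarrow> (\<integral>s. indicator {..r} s * (w (r - s) * k0 s) \<partial>lborel)"
    proof (rule integral_dominated_convergence[where w="\<lambda>s. B * \<bar>k0 s\<bar>"])
      show "integrable lborel (\<lambda>s. B * \<bar>k0 s\<bar>)" using k0i by simp
      show "AE s in lborel. (\<lambda>n. indicator {..\<rho> n} s * (w (\<rho> n - s) * k0 s))
              \<longlonglongrightarrow> indicator {..r} s * (w (r - s) * k0 s)"
      proof -
        have "AE s in lborel. s \<noteq> r" by (rule AE_lborel_singleton)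
        then show ?thesis
        proof eventually_elim
          case (elim s)
          have wl: "(\<lambda>n. w (\<rho> n - s)) \<longlonglongrightarrow> w (r - s)"
            by (rule continuous_on_tendsto_compose[OF wc tendsto_diff[OF lim tendsto_const]]) auto
          have "eventually (\<lambda>n. indicator {..\<rho> n} s = (indicator {..r} s :: real)) sequentially"
          proof (cases "s < r")
            case True
            show ?thesis using order_tendstoD(1)[OF lim True]
              by eventually_elim (use True in \<open>auto simp: indicator_def\<close>)
          next
            case False
            then have "r < s" using elim by simp
            show ?thesis using order_tendstoD(2)[OF lim \<open>r < s\<close>]
              by eventually_elim (use \<open>r < s\<close> in \<open>auto simp: indicator_def\<close>)
          qed
          then have "(\<lambda>n. indicator {..\<rho> n} s :: real) \<longlonglongrightarrow> indicator {..r} s"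
            by (rule tendsto_eventually)
          then show ?case by (intro tendsto_mult wl tendsto_const)
        qed
      qed
      fix n
      show "AE s in lborel. norm (indicator {..\<rho> n} s * (w (\<rho> n - s) * k0 s)) \<le> B * \<bar>k0 s\<bar>"
      proof (rule AE_I2)
        fix s
        show "norm (indicator {..\<rho> n} s * (w (\<rho> n - s) * k0 s)) \<le> B * \<bar>k0 s\<bar>"
        proof (cases "s \<in> {0..\<rho> n}")
          case True
          then have "\<bar>w (\<rho> n - s)\<bar> \<le> B"
            unfolding w_def using \<rho>[rule_format, of n] by (intro B) auto
          then show ?thesis using True by (simp add: abs_mult mult_right_mono)
        qed (use B0 in \<open>auto simp: indicator_def k0_def\<close>)
      qed
    qed (rule meas)+
    then show "(\<lambda>n. c (\<rho> n)) \<longlonglongrightarrow> c r"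
      using \<rho> r by (simp add: ceq)
  qed
  have "((\<lambda>r. integral {0..r} c) has_real_derivative c t) (at t within {0..T})"
    using integral_has_real_derivative[OF cont, of t] t by (simp add: T_def)
  then have D: "((\<lambda>r. integral {0..r} c) has_real_derivative c t) (at t)"
    using t by (simp add: at_within_Icc_at T_def)
  have "(memory_integral k u has_real_derivative c t) (at t)"
  proof (rule has_field_derivative_transform_within_open[OF D, where S="{0<..<T}"])
    fix r assume r: "r \<in> {0<..<T}"
    have "set_integrable lborel {0..r} c"
      by (intro borel_integrable_atLeastAtMost' continuous_on_subset[OF cont]) (use r in auto)
    then show "integral {0..r} c = memory_integral k u r"
      using mem[of r] r by (simp add: set_borel_integral_eq_integral)
  qed (use t in \<open>auto simp: T_def\<close>)
  moreover have "(u has_real_derivative v t) (at t)"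
    using u[of t] t at_within_interior[of t "{0..}"] by (simp add: interior_real_atLeast)
  ultimately show ?thesis
    by (simp add: caputo_deriv_def c_def DERIV_imp_deriv)
qed

end

theory Submission
  imports Defs "HOL-Computational_Algebra.Formal_Power_Series" "HOL-Real_Asymp.Real_Asymp"
begin

text \<open>
  Write \<open>E\<close> for the inverse subordinator and \<open>p n t = \<P>(N (E t) = n)\<close>. The density is
  \<open>P x t = (\<Sum>n. p n t * g n x)\<close>, where \<open>g n\<close> is the \<open>n\<close>-fold convolution of the
  Mittag-Leffler density, for \<open>n = 0\<close> read as \<open>0\<close>. In \<open>x\<close>, all \<open>g n\<close> are power series in the kernels
  \<open>x powr (\<beta> m - 1) / \<Gamma>(\<beta> m)\<close>, on which the Caputo derivative acts as an index shift, and
  it sends \<open>g (n + 1)\<close> to \<open>\<eta> (g n - g (n + 1))\<close>. In \<open>t\<close>, comparison of Laplace transforms shows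
  that the generalized derivative sends \<open>t \<mapsto> \<E>[\<phi> (E t)]\<close> to \<open>t \<mapsto> \<E>[\<phi>' (E t)]\<close>; here
  \<open>E\<close> at an independent exponential time of rate \<open>s\<close> is exponential of rate \<open>f s\<close>. Applied to
  \<open>\<phi> r = exp (- \<lambda> r) * (\<Sum>n. \<gamma> n * (\<lambda> r) ^ n / n!)\<close> this replaces the
  sequence \<open>\<gamma> n\<close> by \<open>\<lambda> (\<gamma> (n + 1) - \<gamma> n)\<close>, so the equation becomes an identity between
  finite differences. For positive drift the differentiability of \<open>t \<mapsto> \<E>[\<phi> (E t)]\<close> at
  every point comes from a Volterra equation that its derivative solves.
\<close>

unbundle no vec_syntax and fps_syntax

subsection \<open>Riemann--Liouville kernels\<close>

text \<open>The equation is demanded at every point, although for \<open>\<beta> < 1\<close> the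
  density may be singular at 0 and \<open>caputo_deriv\<close> differentiates a convolution. In
  space the kernels settle this: memory integral and derivative only move the kernel index, and what
  remains to differentiate is a power series in \<open>x powr \<beta>\<close>. In time, equal
  Laplace transforms yield only an integrated identity: with u = q - q 0, the sum of b u and the
  convolution of u with the tail is an antiderivative. Without drift it can be differentiated as it
  stands. With drift both terms must be differentiable separately, which their sum does not show;
  this is why the derivative of u is constructed from an equation of its own. On sequences,
  \<lambda> plus the time derivative is \<lambda> times the shift. The final identity is therefore
  the formula for the space derivative of g (n + 1) itself, with g 0 = 0 because the atom at 0 is
  left out. The jumps have \<open>ennreal\<close> of the Mittag-Leffler function as density, which
  would cut off negative values. Its positivity is proved, so that the convolution powers may be
  computed from the series.\<close>

definition rl_kernel :: "real \<Rightarrow> real \<Rightarrow> real" where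
  "rl_kernel \<rho> x = (if 0 < x then x powr (\<rho> - 1) / Gamma \<rho> else 0)"

lemma rl_kernel_measurable [measurable]: "rl_kernel \<rho> \<in> borel_measurable borel"
  unfolding rl_kernel_def by measurable

lemma rl_kernel_nonneg: "0 \<le> \<rho> \<Longrightarrow> 0 \<le> rl_kernel \<rho> x"
  by (cases "\<rho> = 0") (auto simp: rl_kernel_def intro!: divide_nonneg_pos)

text \<open>As the index tends to 0 the kernels approach the Dirac measure at 0. Here
  \<open>Gamma 0 = 0\<close> and division by zero produce the zero function instead, which is why
  index 0 is excluded wherever kernels are convolved.\<close>

lemma rl_kernel_0 [simp]: "rl_kernel 0 x = 0"
  by (simp add: rl_kernel_def)

text \<open>The substitution \<open>y = x * t\<close> turns the convolution into a Beta integral;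
  this is the semigroup law of fractional integration. In \<open>ennreal\<close> form it yields
  integrability along with the value.\<close>

lemma nn_integral_rl_kernel_convolution:
  assumes \<rho>: "0 < \<rho>" and \<sigma>: "0 < \<sigma>"
  shows "(\<integral>\<^sup>+y. ennreal (rl_kernel \<rho> (x - y) * rl_kernel \<sigma> y) \<partial>lborel) = ennreal (rl_kernel (\<rho> + \<sigma>) x)"
proof (cases "0 < x")
  case False
  then have "rl_kernel \<rho> (x - y) * rl_kernel \<sigma> y = 0" for y
    by (auto simp: rl_kernel_def)
  then show ?thesis using False by (simp only:) (simp add: rl_kernel_def)
next
  case True
  have G: "0 < Gamma \<rho>" "0 < Gamma \<sigma>" using \<rho> \<sigma> by auto
  have B: "(\<integral>\<^sup>+t. ennreal (indicator {0..1} t * (t powr (\<sigma> - 1) * (1 - t) powr (\<rho> - 1))) \<partial>lborel)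
      = ennreal (Beta \<sigma> \<rho>)"
    using nn_integral_has_integral_lebesgue[OF _ has_integral_Beta_real[OF \<sigma> \<rho>]] by simp
  have eq: "rl_kernel \<rho> (x - x * t) * rl_kernel \<sigma> (x * t)
      = x powr (\<rho> + \<sigma> - 2) / (Gamma \<rho> * Gamma \<sigma>)
        * (indicator {0..1} t * (t powr (\<sigma> - 1) * (1 - t) powr (\<rho> - 1)))" for t
  proof -
    consider "t \<le> 0" | "1 \<le> t" | "0 < t" "t < 1" by linarith
    then show ?thesis
    proof cases
      case 3
      have a: "x - x * t = x * (1 - t)" by (simp add: algebra_simps)
      have "x powr (\<rho> + \<sigma> - 2) = x powr (\<rho> - 1) * x powr (\<sigma> - 1)"
        by (simp add: powr_add[symmetric])
      then show ?thesis using True 3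
        unfolding a by (simp add: rl_kernel_def powr_mult)
    qed (use True in \<open>auto simp: rl_kernel_def indicator_def mult_le_0_iff zero_less_mult_iff\<close>)
  qed
  have "(\<integral>\<^sup>+y. ennreal (rl_kernel \<rho> (x - y) * rl_kernel \<sigma> y) \<partial>lborel)
      = ennreal x * (\<integral>\<^sup>+t. ennreal (rl_kernel \<rho> (x - x * t) * rl_kernel \<sigma> (x * t)) \<partial>lborel)"
    using True by (subst nn_integral_real_affine[of _ x 0]) auto
  also have "\<dots> = ennreal x * (ennreal (x powr (\<rho> + \<sigma> - 2) / (Gamma \<rho> * Gamma \<sigma>)) * ennreal (Beta \<sigma> \<rho>))"
    unfolding eq B[symmetric] using G
    by (subst nn_integral_cmult[symmetric]) (simp_all add: ennreal_mult'[of "_ / _", symmetric])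
  also have "\<dots> = ennreal (x * (x powr (\<rho> + \<sigma> - 2) / (Gamma \<rho> * Gamma \<sigma>) * Beta \<sigma> \<rho>))"
    using G True by (subst ennreal_mult', simp, subst ennreal_mult') auto
  also have "x * (x powr (\<rho> + \<sigma> - 2) / (Gamma \<rho> * Gamma \<sigma>) * Beta \<sigma> \<rho>) = rl_kernel (\<rho> + \<sigma>) x"
  proof -
    have "x * x powr (\<rho> + \<sigma> - 2) = x powr (\<rho> + \<sigma> - 1)"
      using True by (simp add: powr_mult_base)
    then show ?thesis using True G by (simp add: rl_kernel_def Beta_def add.commute field_simps)
  qed
  finally show ?thesis .
qed

lemma rl_kernel_convolution:
  assumes "0 < \<rho>" "0 < \<sigma>"
  shows "integrable lborel (\<lambda>y. rl_kernel \<rho> (x - y) * rl_kernel \<sigma> y)"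
    and "(\<integral>y. rl_kernel \<rho> (x - y) * rl_kernel \<sigma> y \<partial>lborel) = rl_kernel (\<rho> + \<sigma>) x"
proof -
  have "has_bochner_integral lborel (\<lambda>y. rl_kernel \<rho> (x - y) * rl_kernel \<sigma> y) (rl_kernel (\<rho> + \<sigma>) x)"
    using assms nn_integral_rl_kernel_convolution[OF assms]
    by (intro has_bochner_integral_nn_integral) (auto simp: rl_kernel_nonneg)
  then show "integrable lborel (\<lambda>y. rl_kernel \<rho> (x - y) * rl_kernel \<sigma> y)"
    and "(\<integral>y. rl_kernel \<rho> (x - y) * rl_kernel \<sigma> y \<partial>lborel) = rl_kernel (\<rho> + \<sigma>) x"
    by (auto simp: has_bochner_integral_iff)
qed

text \<open>Euler's integral restricted to \<open>{R..R+1}\<close>, where the integrand is bounded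
  below. Since \<open>R\<close> is free, \<open>Gamma\<close> outgrows every geometric
  sequence.\<close>

lemma Gamma_ge_powr:
  fixes R s :: real
  assumes R: "0 < R" and s: "1 \<le> s"
  shows "R powr (s - 1) * exp (- R - 1) \<le> Gamma s"
proof -
  have "ennreal (R powr (s - 1) * exp (- R - 1))
      = (\<integral>\<^sup>+t. ennreal (R powr (s - 1) * exp (- R - 1)) * indicator {R..R+1} t \<partial>lborel)"
    by (subst nn_integral_cmult_indicator) auto
  also have "\<dots> \<le> (\<integral>\<^sup>+t. ennreal (indicator {0..} t * t powr (s - 1) / exp t) \<partial>lborel)"
  proof (rule nn_integral_mono)
    fix t
    have "R powr (s - 1) * exp (- R - 1) \<le> t powr (s - 1) / exp t" if "R \<le> t" "t \<le> R + 1"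
      unfolding divide_inverse exp_minus[symmetric]
      using that R s by (intro mult_mono powr_mono2) auto
    then show "ennreal (R powr (s - 1) * exp (- R - 1)) * indicator {R..R+1} t
        \<le> ennreal (indicator {0..} t * t powr (s - 1) / exp t)"
      using R by (auto simp: indicator_def intro!: ennreal_leI)
  qed
  also have "\<dots> = ennreal (Gamma s)"
    using Gamma_conv_nn_integral_real[of s] s by simp
  finally show ?thesis using s by (subst (asm) ennreal_le_iff) auto
qed

lemma rl_kernel_summable:
  assumes \<beta>: "0 < \<beta>" and K: "0 < K"
  shows "summable (\<lambda>m. K ^ m * rl_kernel (\<beta> * real m + \<delta>) x)"
proof (cases "0 < x")
  case False then show ?thesis by (simp add: rl_kernel_def)
next
  case True
  \<comment> \<open>\<open>R\<close> solves \<open>K * (x / R) powr \<beta> = 1 / 2\<close>, so that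
    after the Gamma bound the terms decay like \<open>(1 / 2) ^ m\<close>.\<close>
  define R where "R = x * (2 * K) powr (1 / \<beta>)"
  have R: "0 < R" using True K by (simp add: R_def)
  have xR: "(x / R) powr \<beta> = 1 / (2 * K)"
    using True K \<beta> by (simp add: R_def powr_divide powr_powr)
  \<comment> \<open>From \<open>m0\<close> on the kernel index is at least 1, as
    \<open>Gamma_ge_powr\<close> requires.\<close>
  obtain m0 :: nat where m0: "(1 - \<delta>) / \<beta> < m0" using reals_Archimedean2 by blast
  show ?thesis
  proof (rule summable_comparison_test)
    show "summable (\<lambda>m. exp (R + 1) * (x / R) powr (\<delta> - 1) * (1 / 2) ^ m)"
      by (intro summable_mult summable_geometric) auto
    show "\<exists>N. \<forall>m\<ge>N. norm (K ^ m * rl_kernel (\<beta> * real m + \<delta>) x)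
        \<le> exp (R + 1) * (x / R) powr (\<delta> - 1) * (1 / 2) ^ m"
    proof (intro exI[of _ m0] allI impI)
      fix m assume m: "m0 \<le> m"
      define s where "s = \<beta> * real m + \<delta>"
      have "(1 - \<delta>) / \<beta> < real m" using m m0 by linarith
      then have s: "1 \<le> s" using \<beta> by (simp add: s_def field_simps)
      then have "0 < Gamma s" by (intro Gamma_real_pos) simp
      have "K ^ m * rl_kernel s x = K ^ m * x powr (s - 1) / Gamma s"
        using True by (simp add: rl_kernel_def)
      also have "\<dots> \<le> K ^ m * x powr (s - 1) / (R powr (s - 1) * exp (- R - 1))"
        using Gamma_ge_powr[OF R s] K R True \<open>0 < Gamma s\<close> by (intro divide_left_mono) auto
      also have "\<dots> = exp (R + 1) * (K ^ m * (x / R) powr (s - 1))"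
        using R True by (simp add: powr_divide exp_minus exp_diff exp_add field_simps)
      also have "(x / R) powr (s - 1) = (x / R) powr (\<delta> - 1) * ((x / R) powr \<beta>) ^ m"
        using R True by (simp add: s_def powr_add[symmetric] powr_powr algebra_simps flip: powr_realpow)
      also have "K ^ m * ((x / R) powr (\<delta> - 1) * ((x / R) powr \<beta>) ^ m) = (x / R) powr (\<delta> - 1) * (1 / 2) ^ m"
        unfolding xR using K by (simp add: power_divide power_mult_distrib)
      finally have "K ^ m * rl_kernel s x \<le> exp (R + 1) * (x / R) powr (\<delta> - 1) * (1 / 2) ^ m"
        by (simp add: mult_ac)
      moreover have "0 \<le> K ^ m * rl_kernel s x" using K s by (simp add: rl_kernel_nonneg)
      ultimately show "norm (K ^ m * rl_kernel (\<beta> * real m + \<delta>) x)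
        \<le> exp (R + 1) * (x / R) powr (\<delta> - 1) * (1 / 2) ^ m"
        by (simp add: s_def)
    qed
  qed
qed

subsection \<open>Fractional power series\<close>

text \<open>These are the formal power series with positive radius of convergence. The Gamma factors
  make the corresponding kernel series converge everywhere, and the class is closed under
  multiplication, so convolutions can be treated as products in \<open>real fps\<close>.\<close>

definition geom_bdd :: "real fps \<Rightarrow> bool" where
  "geom_bdd A \<longleftrightarrow> (\<exists>C K. 0 \<le> C \<and> 0 < K \<and> (\<forall>m. \<bar>A $ m\<bar> \<le> C * K ^ m))"

lemma geom_bddE:
  assumes "geom_bdd A"
  obtains C K where "0 \<le> C" "1 \<le> K" "\<And>m. \<bar>A $ m\<bar> \<le> C * K ^ m"
proof -
  obtain C K where *: "0 \<le> C" "0 < K" "\<And>m. \<bar>A $ m\<bar> \<le> C * K ^ m"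
    using assms unfolding geom_bdd_def by auto
  have "\<bar>A $ m\<bar> \<le> C * (max 1 K) ^ m" for m
    using *(3)[of m] by (rule order_trans) (use * in \<open>intro mult_left_mono power_mono; simp\<close>)
  with *(1) show thesis by (intro that[of C "max 1 K"]) auto
qed

lemma geom_bddI:
  assumes "0 \<le> C" "0 < K" "\<And>m. \<bar>A $ m\<bar> \<le> C * K ^ m"
  shows "geom_bdd A"
  using assms unfolding geom_bdd_def by blast

lemma Suc_le_power2: "real m + 1 \<le> 2 ^ m"
  by (induction m) auto

lemma geom_bdd_abs: "geom_bdd (Abs_fps (\<lambda>m. \<bar>A $ m\<bar>)) \<longleftrightarrow> geom_bdd A"
  by (simp add: geom_bdd_def)

lemma geom_bdd_mult:
  assumes "geom_bdd A" "geom_bdd B"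
  shows "geom_bdd (A * B)"
proof -
  obtain C K where A: "0 \<le> C" "1 \<le> K" "\<And>m. \<bar>A $ m\<bar> \<le> C * K ^ m" using geom_bddE[OF assms(1)] by blast
  obtain C' K' where B: "0 \<le> C'" "1 \<le> K'" "\<And>m. \<bar>B $ m\<bar> \<le> C' * K' ^ m" using geom_bddE[OF assms(2)] by blast
  show ?thesis
  proof (rule geom_bddI[of "C * C'" "2 * (K * K')"])
    fix m
    have "\<bar>(A * B) $ m\<bar> \<le> (\<Sum>i=0..m. \<bar>A $ i * B $ (m - i)\<bar>)"
      unfolding fps_mult_nth by (rule sum_abs)
    also have "\<dots> \<le> (\<Sum>i=0..m. (C * K ^ m) * (C' * K' ^ m))"
    proof (rule sum_mono)
      fix i assume i: "i \<in> {0..m}"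
      have "\<bar>A $ i\<bar> \<le> C * K ^ m"
        using A(3)[of i] by (rule order_trans) (use A i in \<open>auto intro!: mult_left_mono power_increasing\<close>)
      moreover have "\<bar>B $ (m - i)\<bar> \<le> C' * K' ^ m"
        using B(3)[of "m - i"] by (rule order_trans) (use B in \<open>auto intro!: mult_left_mono power_increasing\<close>)
      ultimately show "\<bar>A $ i * B $ (m - i)\<bar> \<le> (C * K ^ m) * (C' * K' ^ m)"
        using A by (auto simp: abs_mult intro!: mult_mono)
    qed
    also have "\<dots> = (real m + 1) * (C * C' * (K * K') ^ m)"
      by (simp add: power_mult_distrib mult_ac)
    \<comment> \<open>The number \<open>m + 1\<close> of terms in the Cauchy product is absorbed by
      doubling the growth rate.\<close>
    also have "\<dots> \<le> 2 ^ m * (C * C' * (K * K') ^ m)"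
      using A B by (intro mult_right_mono Suc_le_power2) auto
    finally show "\<bar>(A * B) $ m\<bar> \<le> C * C' * (2 * (K * K')) ^ m"
      by (simp add: power_mult_distrib mult_ac)
  qed (use A B in auto)
qed

lemma geom_bdd_power: "geom_bdd A \<Longrightarrow> geom_bdd (A ^ n)"
proof (induction n)
  case 0
  show ?case by (rule geom_bddI[of 1 1]) auto
qed (auto intro: geom_bdd_mult)

lemma geom_bdd_shift:
  assumes "geom_bdd A"
  shows "geom_bdd (fps_shift n A)"
proof -
  obtain C K where A: "0 \<le> C" "1 \<le> K" "\<And>m. \<bar>A $ m\<bar> \<le> C * K ^ m" using geom_bddE[OF assms] by blast
  show ?thesis
    by (rule geom_bddI[of "C * K ^ n" K]) (use A in \<open>auto simp: power_add mult_ac intro: A(3)[THEN order_trans]\<close>)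
qed

text \<open>Since \<^term>\<open>rl_kernel 0 = (\<lambda>x. 0)\<close>, the coefficient of index 0, which stands for a multiple of
  the Dirac measure at 0, does not contribute for \<open>\<delta> = 0\<close>.\<close>

definition frac_series :: "real \<Rightarrow> real \<Rightarrow> real fps \<Rightarrow> real \<Rightarrow> real" where
  "frac_series \<beta> \<delta> A x = (\<Sum>m. A $ m * rl_kernel (\<beta> * real m + \<delta>) x)"

lemma frac_series_nonpos [simp]: "x \<le> 0 \<Longrightarrow> frac_series \<beta> \<delta> A x = 0"
  by (simp add: frac_series_def rl_kernel_def)

lemma frac_series_measurable [measurable]: "frac_series \<beta> \<delta> A \<in> borel_measurable borel"
  unfolding frac_series_def by measurable

lemma frac_series_summable:
  assumes \<beta>: "0 < \<beta>" and \<delta>: "0 \<le> \<delta>" and A: "geom_bdd A"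
  shows "summable (\<lambda>m. \<bar>A $ m\<bar> * rl_kernel (\<beta> * real m + \<delta>) x)"
    and "summable (\<lambda>m. A $ m * rl_kernel (\<beta> * real m + \<delta>) x)"
proof -
  obtain C K where A: "0 \<le> C" "1 \<le> K" "\<And>m. \<bar>A $ m\<bar> \<le> C * K ^ m" using geom_bddE[OF A] by blast
  show *: "summable (\<lambda>m. \<bar>A $ m\<bar> * rl_kernel (\<beta> * real m + \<delta>) x)"
  proof (rule summable_comparison_test')
    show "summable (\<lambda>m. C * (K ^ m * rl_kernel (\<beta> * real m + \<delta>) x))"
      using \<beta> A by (intro summable_mult rl_kernel_summable) auto
    show "norm (\<bar>A $ m\<bar> * rl_kernel (\<beta> * real m + \<delta>) x) \<le> C * (K ^ m * rl_kernel (\<beta> * real m + \<delta>) x)" for m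
      using A(3)[of m] rl_kernel_nonneg[of "\<beta> * real m + \<delta>" x] \<beta> \<delta>
      by (auto simp: abs_mult mult.assoc[symmetric] intro!: mult_right_mono)
  qed
  show "summable (\<lambda>m. A $ m * rl_kernel (\<beta> * real m + \<delta>) x)"
    by (rule summable_comparison_test'[OF *])
       (use rl_kernel_nonneg[of "\<beta> * real _ + \<delta>" x] \<beta> \<delta> in \<open>auto simp: abs_mult\<close>)
qed

lemma frac_series_diff:
  assumes "0 < \<beta>" "0 \<le> \<delta>" "geom_bdd A" "geom_bdd B"
  shows "frac_series \<beta> \<delta> (A - B) x = frac_series \<beta> \<delta> A x - frac_series \<beta> \<delta> B x"
  unfolding frac_series_def using assms
  by (subst suminf_diff) (auto intro!: frac_series_summable suminf_cong simp: left_diff_distrib mult.assoc)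

lemma frac_series_cmult:
  assumes "0 < \<beta>" "0 \<le> \<delta>" "geom_bdd A"
  shows "frac_series \<beta> \<delta> (fps_const c * A) x = c * frac_series \<beta> \<delta> A x"
  unfolding frac_series_def using assms
  by (subst suminf_mult[symmetric]) (auto intro!: frac_series_summable suminf_cong simp: left_diff_distrib mult.assoc)

lemma geom_bdd_monom: "geom_bdd (fps_const c * fps_X ^ k)"
  by (rule geom_bddI[of "\<bar>c\<bar>" 1]) auto

lemma frac_series_monom: "frac_series \<beta> \<delta> (fps_const c * fps_X ^ k) x = c * rl_kernel (\<beta> * real k + \<delta>) x"
proof -
  have "frac_series \<beta> \<delta> (fps_const c * fps_X ^ k) x
      = (\<Sum>m\<in>{k}. (fps_const c * fps_X ^ k) $ m * rl_kernel (\<beta> * real m + \<delta>) x)"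
    unfolding frac_series_def by (rule suminf_finite) auto
  then show ?thesis by simp
qed

text \<open>Kernels form a convolution semigroup, so convolving two kernel series multiplies their
  formal series. The offset \<open>\<delta>\<close> admits the tail kernel
  \<open>rl_kernel (1 - \<beta>)\<close> as second factor. The conditions on the coefficients of
  index 0 keep out Dirac terms, which \<open>rl_kernel 0\<close> does not represent.\<close>

lemma frac_series_convolution:
  fixes A B :: "real fps"
  assumes \<beta>: "0 < \<beta>" and \<delta>: "0 \<le> \<delta>" and A: "geom_bdd A" and B: "geom_bdd B"
    and A0: "A $ 0 = 0" and B0: "0 < \<delta> \<or> B $ 0 = 0"
  shows "integrable lborel (\<lambda>y. frac_series \<beta> 0 A (x - y) * frac_series \<beta> \<delta> B y)"
    and "(\<integral>y. frac_series \<beta> 0 A (x - y) * frac_series \<beta> \<delta> B y \<partial>lborel) = frac_series \<beta> \<delta> (A * B) x"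
proof -
  define R where "R i y = rl_kernel (\<beta> * real i) (x - y)" for i y
  define S where "S j y = rl_kernel (\<beta> * real j + \<delta>) y" for j y
  define T where "T m = rl_kernel (\<beta> * real m + \<delta>) x" for m
  define f where "f m y = (\<Sum>i\<le>m. (A $ i * R i y) * (B $ (m - i) * S (m - i) y))" for m y
  have [measurable]: "R i \<in> borel_measurable borel" "S i \<in> borel_measurable borel"
    "f i \<in> borel_measurable borel" for i
    unfolding f_def R_def S_def by measurable
  have RS0: "0 \<le> R i y" "0 \<le> S i y" "0 \<le> T i" for i y
    using \<beta> \<delta> by (auto simp: R_def S_def T_def rl_kernel_nonneg)
  \<comment> \<open>The premise is conditional on \<open>a \<noteq> 0\<close>: summands in which a
    kernel of index 0 occurs pass because their coefficient is 0.\<close>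
  have RS: "integrable lborel (\<lambda>y. a * (R i y * S j y))"
      "(\<integral>y. a * (R i y * S j y) \<partial>lborel) = a * T (i + j)"
    if "a \<noteq> 0 \<Longrightarrow> 0 < i \<and> (0 < \<delta> \<or> 0 < j)" for i j a
  proof -
    have "integrable lborel (\<lambda>y. a * (R i y * S j y)) \<and>
        (\<integral>y. a * (R i y * S j y) \<partial>lborel) = a * T (i + j)"
    proof (cases "a = 0")
      case False
      then have "0 < \<beta> * real i" "0 < \<beta> * real j + \<delta>"
        using that \<beta> \<delta> by (auto simp: add_pos_nonneg add_nonneg_pos)
      from rl_kernel_convolution[OF this, of x] show ?thesis
        by (simp add: R_def S_def T_def algebra_simps)
    qed simp
    then show "integrable lborel (\<lambda>y. a * (R i y * S j y))"
      "(\<integral>y. a * (R i y * S j y) \<partial>lborel) = a * T (i + j)" by auto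
  qed
  have nz: "A $ i * B $ j \<noteq> 0 \<Longrightarrow> 0 < i \<and> (0 < \<delta> \<or> 0 < j)" for i j
    using A0 B0 by (cases "i = 0"; cases "j = 0") auto
  have nz': "\<bar>A $ i\<bar> * \<bar>B $ j\<bar> \<noteq> 0 \<Longrightarrow> 0 < i \<and> (0 < \<delta> \<or> 0 < j)" for i j
    using nz[of i j] by auto
  have f_eq: "f m = (\<lambda>y. \<Sum>i\<le>m. (A $ i * B $ (m - i)) * (R i y * S (m - i) y))" for m
    by (simp add: f_def fun_eq_iff mult_ac)
  have f_int: "integrable lborel (f m)" for m
    unfolding f_eq by (intro Bochner_Integration.integrable_sum RS nz)
  have f_integral: "integral\<^sup>L lborel (f m) = (A * B) $ m * T m" for m
  proof -
    have "integral\<^sup>L lborel (f m) = (\<Sum>i\<le>m. A $ i * B $ (m - i) * T m)"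
      unfolding f_eq
      using RS[of "A $ i * B $ (m - i)" i "m - i" for i, OF nz]
      by (subst Bochner_Integration.integral_sum) (auto intro!: sum.cong simp del: integral_mult_right_zero)
    then show ?thesis by (simp add: fps_mult_nth sum_distrib_right atMost_atLeast0)
  qed
  \<comment> \<open>The series of absolute values dominate: \<open>A' * B'\<close> is again
    geometrically bounded, so the L1 norms of the Cauchy terms \<open>f m\<close> are summable and
    the integral passes through the sum.\<close>
  define A' where "A' = Abs_fps (\<lambda>m. \<bar>A $ m\<bar>)"
  define B' where "B' = Abs_fps (\<lambda>m. \<bar>B $ m\<bar>)"
  have bdd': "geom_bdd A'" "geom_bdd B'" using A B by (auto simp: A'_def B'_def geom_bdd_abs)
  have norm_bound: "(\<integral>y. norm (f m y) \<partial>lborel) \<le> (A' * B') $ m * T m" for m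
  proof -
    have "(\<integral>y. norm (f m y) \<partial>lborel)
        \<le> (\<integral>y. (\<Sum>i\<le>m. (\<bar>A $ i\<bar> * \<bar>B $ (m - i)\<bar>) * (R i y * S (m - i) y)) \<partial>lborel)"
    proof (rule integral_mono)
      show "integrable lborel (\<lambda>y. norm (f m y))" using f_int by (rule integrable_norm)
      show "integrable lborel (\<lambda>y. \<Sum>i\<le>m. (\<bar>A $ i\<bar> * \<bar>B $ (m - i)\<bar>) * (R i y * S (m - i) y))"
        by (intro Bochner_Integration.integrable_sum RS nz')
      fix y
      show "norm (f m y) \<le> (\<Sum>i\<le>m. (\<bar>A $ i\<bar> * \<bar>B $ (m - i)\<bar>) * (R i y * S (m - i) y))"
        unfolding f_eq real_norm_def
        by (rule order_trans[OF sum_abs]) (auto intro!: sum_mono simp: abs_mult RS0)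
    qed
    also have "\<dots> = (\<Sum>i\<le>m. \<bar>A $ i\<bar> * \<bar>B $ (m - i)\<bar> * T m)"
      using RS[of "\<bar>A $ i\<bar> * \<bar>B $ (m - i)\<bar>" i "m - i" for i, OF nz']
      by (subst Bochner_Integration.integral_sum) (auto intro!: sum.cong simp del: integral_mult_right_zero)
    also have "\<dots> = (A' * B') $ m * T m"
      by (simp add: fps_mult_nth sum_distrib_right atMost_atLeast0 A'_def B'_def)
    finally show ?thesis .
  qed
  have absA: "summable (\<lambda>i. norm (A $ i * R i y))" and absB: "summable (\<lambda>j. norm (B $ j * S j y))" for y
    using frac_series_summable(1)[OF \<beta> order.refl A, of "x - y"] frac_series_summable(1)[OF \<beta> \<delta> B, of y] RS0
    by (simp_all add: R_def S_def abs_mult)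
  have prod: "(\<Sum>m. f m y) = frac_series \<beta> 0 A (x - y) * frac_series \<beta> \<delta> B y" for y
    using Cauchy_product[OF absA[of y] absB[of y]]
    by (simp add: f_def frac_series_def R_def S_def)
  have summ: "summable (\<lambda>m. norm (f m y))" for y
  proof (rule summable_comparison_test')
    show "summable (\<lambda>k. \<Sum>i\<le>k. norm (A $ i * R i y) * norm (B $ (k - i) * S (k - i) y))"
      using absA[of y] absB[of y] by (intro summable_Cauchy_product) auto
    show "norm (norm (f m y)) \<le> (\<Sum>i\<le>m. norm (A $ i * R i y) * norm (B $ (m - i) * S (m - i) y))" for m
      unfolding f_def by (simp add: sum_abs abs_mult[symmetric])
  qed
  have summ2: "summable (\<lambda>m. \<integral>y. norm (f m y) \<partial>lborel)"
  proof (rule summable_comparison_test')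
    show "summable (\<lambda>m. \<bar>(A' * B') $ m\<bar> * T m)"
      unfolding T_def by (intro frac_series_summable \<beta> \<delta> geom_bdd_mult bdd')
    show "norm (\<integral>y. norm (f m y) \<partial>lborel) \<le> \<bar>(A' * B') $ m\<bar> * T m" for m
      using order_trans[OF norm_bound mult_right_mono[OF abs_ge_self RS0(3)]] by simp
  qed
  show "integrable lborel (\<lambda>y. frac_series \<beta> 0 A (x - y) * frac_series \<beta> \<delta> B y)"
    using integrable_suminf[OF f_int AE_I2[OF summ] summ2] unfolding prod .
  show "(\<integral>y. frac_series \<beta> 0 A (x - y) * frac_series \<beta> \<delta> B y \<partial>lborel) = frac_series \<beta> \<delta> (A * B) x"
    using integral_suminf[OF f_int AE_I2[OF summ] summ2] unfolding prod f_integral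
    by (simp add: frac_series_def T_def)
qed

text \<open>Factoring out \<open>x powr (\<delta> - 1)\<close> leaves an ordinary power series in
  \<open>x powr \<beta>\<close> that converges everywhere. Continuity and termwise differentiation
  are inherited from it.\<close>

lemma frac_series_conv_powser:
  assumes \<beta>: "0 < \<beta>" and \<delta>: "0 \<le> \<delta>" and A: "geom_bdd A"
  shows "summable (\<lambda>m. A $ m / Gamma (\<beta> * real m + \<delta>) * z ^ m)"
    and "0 < x \<Longrightarrow> frac_series \<beta> \<delta> A x
           = x powr (\<delta> - 1) * (\<Sum>m. A $ m / Gamma (\<beta> * real m + \<delta>) * (x powr \<beta>) ^ m)"
proof -
  have eq: "A $ m * rl_kernel (\<beta> * real m + \<delta>) x
      = x powr (\<delta> - 1) * (A $ m / Gamma (\<beta> * real m + \<delta>) * (x powr \<beta>) ^ m)"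
    if "0 < x" for x m and A :: "real fps"
  proof -
    have "x powr (\<beta> * real m + \<delta> - 1) = x powr (\<delta> - 1) * (x powr \<beta>) ^ m"
      using that by (simp add: powr_add[symmetric] powr_powr algebra_simps flip: powr_realpow)
    then show ?thesis using that by (simp add: rl_kernel_def)
  qed
  have sm: "summable (\<lambda>m. A $ m / Gamma (\<beta> * real m + \<delta>) * (x powr \<beta>) ^ m)"
    if x: "0 < x" and A: "geom_bdd A" for x and A :: "real fps"
  proof -
    have "summable (\<lambda>m. inverse (x powr (\<delta> - 1)) * (A $ m * rl_kernel (\<beta> * real m + \<delta>) x))"
      by (intro summable_mult frac_series_summable \<beta> \<delta> A)
    then show ?thesis using x by (simp add: eq[OF x] mult.assoc[symmetric])
  qed
  show "summable (\<lambda>m. A $ m / Gamma (\<beta> * real m + \<delta>) * z ^ m)"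
  proof (cases "z = 0")
    case True
    have "summable (\<lambda>m. A $ m / Gamma (\<beta> * real m + \<delta>) * 0 ^ m)"
      by (rule summable_0_powser)
    then show ?thesis using True by simp
  next
    case False
    define x where "x = \<bar>z\<bar> powr (1 / \<beta>)"
    have x: "0 < x" "x powr \<beta> = \<bar>z\<bar>" using False \<beta> by (auto simp: x_def powr_powr)
    have "summable (\<lambda>m. \<bar>A $ m\<bar> / Gamma (\<beta> * real m + \<delta>) * \<bar>z\<bar> ^ m)"
      using sm[OF x(1), of "Abs_fps (\<lambda>m. \<bar>A $ m\<bar>)"] A by (simp add: geom_bdd_abs x)
    then show ?thesis
    proof (rule summable_comparison_test')
      fix m
      have "0 \<le> Gamma (\<beta> * real m + \<delta>)"
        using \<beta> \<delta> Gamma_real_pos[of "\<beta> * real m + \<delta>"] by (cases "\<beta> * real m + \<delta> = 0") (auto simp: less_le)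
      then show "norm (A $ m / Gamma (\<beta> * real m + \<delta>) * z ^ m)
          \<le> \<bar>A $ m\<bar> / Gamma (\<beta> * real m + \<delta>) * \<bar>z\<bar> ^ m"
        by (simp add: abs_mult power_abs)
    qed
  qed
  show "frac_series \<beta> \<delta> A x
           = x powr (\<delta> - 1) * (\<Sum>m. A $ m / Gamma (\<beta> * real m + \<delta>) * (x powr \<beta>) ^ m)" if "0 < x"
    unfolding frac_series_def eq[OF that] by (rule suminf_mult[OF sm[OF that A]])
qed

lemma frac_series_continuous_on:
  assumes "0 < \<beta>" "0 \<le> \<delta>" "geom_bdd A"
  shows "continuous_on {0<..} (frac_series \<beta> \<delta> A)"
proof -
  define F where "F z = (\<Sum>m. A $ m / Gamma (\<beta> * real m + \<delta>) * z ^ m)" for z :: real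
  have F: "isCont F z" for z
    unfolding F_def by (rule isCont_powser_converges_everywhere) (rule frac_series_conv_powser[OF assms])
  have "continuous_on {0<..} (\<lambda>x. x powr (\<delta> - 1) * F (x powr \<beta>))"
  proof (intro continuous_on_mult)
    show "continuous_on {0<..} (\<lambda>x::real. x powr (\<delta> - 1))" by (intro continuous_intros) auto
    have "continuous_on {0<..} (\<lambda>x::real. x powr \<beta>)" by (intro continuous_intros) auto
    moreover have "continuous_on UNIV F" using F by (simp add: continuous_on_eq_continuous_at)
    ultimately show "continuous_on {0<..} (\<lambda>x. F (x powr \<beta>))"
      using continuous_on_compose2[of UNIV F "{0<..}" "\<lambda>x. x powr \<beta>"] by simp
  qed
  then show ?thesis
    by (rule continuous_on_eq) (simp only: frac_series_conv_powser(2)[OF assms] F_def greaterThan_iff)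
qed

text \<open>Differentiation lowers each kernel index by 1, by
  \<open>Gamma (s + 1) = s * Gamma s\<close>. The constant term moves from index 1 to index 0, where
  the convention for \<open>rl_kernel 0\<close> gives the correct derivative 0.\<close>

lemma frac_series_has_derivative:
  assumes \<beta>: "0 < \<beta>" and B: "geom_bdd B" and x: "0 < x"
  shows "(frac_series \<beta> 1 B has_real_derivative frac_series \<beta> 0 B x) (at x)"
proof -
  define c where "c m = B $ m / Gamma (\<beta> * real m + 1)" for m
  define F where "F z = (\<Sum>m. c m * z ^ m)" for z :: real
  have F: "(F has_real_derivative (\<Sum>m. diffs c m * z ^ m)) (at z)" for z
    unfolding F_def
    by (rule termdiffs_strong_converges_everywhere)
       (simp only: c_def, rule frac_series_conv_powser, use \<beta> B in auto)
  have "((\<lambda>y. F (y powr \<beta>)) has_real_derivative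
      (\<Sum>m. diffs c m * (x powr \<beta>) ^ m) * (\<beta> * x powr (\<beta> - 1))) (at x)"
    using x by (intro DERIV_chain2[OF F] has_real_derivative_powr)
  moreover have "(\<Sum>m. diffs c m * (x powr \<beta>) ^ m) * (\<beta> * x powr (\<beta> - 1)) = frac_series \<beta> 0 B x"
  proof -
    have "frac_series \<beta> 0 B x = (\<Sum>m. B $ Suc m * rl_kernel (\<beta> * real (Suc m)) x)"
      unfolding frac_series_def
      using suminf_split_head[OF frac_series_summable(2)[OF \<beta> order.refl B, of x]] by simp
    also have "\<dots> = (\<Sum>m. diffs c m * (x powr \<beta>) ^ m * (\<beta> * x powr (\<beta> - 1)))"
    proof (rule suminf_cong)
      fix m
      define s where "s = \<beta> * real (Suc m)"
      have s: "0 < s" using \<beta> by (simp add: s_def)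
      have "diffs c m * (x powr \<beta>) ^ m * (\<beta> * x powr (\<beta> - 1))
          = s * B $ Suc m / Gamma (s + 1) * ((x powr \<beta>) ^ m * x powr (\<beta> - 1))"
        by (simp add: diffs_def c_def s_def)
      also have "Gamma (s + 1) = s * Gamma s"
        using s by (intro Gamma_plus1) (auto dest: nonpos_Ints_nonpos)
      also have "(x powr \<beta>) ^ m * x powr (\<beta> - 1) = x powr (s - 1)"
        using x by (simp add: s_def powr_add[symmetric] powr_powr algebra_simps flip: powr_realpow)
      finally show "B $ Suc m * rl_kernel (\<beta> * real (Suc m)) x = diffs c m * (x powr \<beta>) ^ m * (\<beta> * x powr (\<beta> - 1))"
        using s x by (simp add: rl_kernel_def flip: s_def del: of_nat_Suc)
    qed
    also have "\<dots> = (\<Sum>m. diffs c m * (x powr \<beta>) ^ m) * (\<beta> * x powr (\<beta> - 1))"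
      by (rule suminf_mult2[symmetric], rule termdiff_converges_all)
         (simp only: c_def, rule frac_series_conv_powser, use \<beta> B in auto)
    finally show ?thesis by simp
  qed
  ultimately have "((\<lambda>y. F (y powr \<beta>)) has_real_derivative frac_series \<beta> 0 B x) (at x)" by simp
  then show ?thesis
    by (rule has_field_derivative_transform_within_open[of _ _ _ "{0<..}"])
       (use x in \<open>auto simp: frac_series_conv_powser(2)[OF \<beta> _ B] F_def c_def\<close>)
qed

lemma frac_series_shift:
  assumes \<beta>: "0 < \<beta>" and \<delta>: "0 \<le> \<delta>" and A: "geom_bdd A" and A0: "A $ 0 = 0"
  shows "frac_series \<beta> \<delta> A = frac_series \<beta> (\<beta> + \<delta>) (fps_shift 1 A)"
proof
  fix x
  have "\<beta> * real (Suc m) + \<delta> = \<beta> * real m + (\<beta> + \<delta>)" for m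
    by (simp add: distrib_left)
  then show "frac_series \<beta> \<delta> A x = frac_series \<beta> (\<beta> + \<delta>) (fps_shift 1 A) x"
    using suminf_split_head[OF frac_series_summable(2)[OF \<beta> \<delta> A, of x]] A0
    by (simp only: frac_series_def fps_shift_nth) (simp del: of_nat_Suc)
qed

text \<open>For \<open>\<beta> < 1\<close> convolution with the tail, which is
  \<open>rl_kernel (1 - \<beta>)\<close>, raises the index by \<open>1 - \<beta>\<close>, and the
  outer derivative lowers it by 1; the net loss of \<open>\<beta>\<close> is a shift of the
  coefficients. For \<open>\<beta> = 1\<close> the tail is 0 and the drift term alone has this
  effect.\<close>

lemma frac_series_caputo:
  assumes \<beta>: "0 < \<beta>" "\<beta> \<le> 1" and A: "geom_bdd A" and A0: "A $ 0 = 0" and x: "0 < x"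
  shows "caputo_differentiable (power_drift \<beta>) (power_tail \<beta>) (frac_series \<beta> 0 A) x"
    and "caputo_deriv (power_drift \<beta>) (power_tail \<beta>) (frac_series \<beta> 0 A) x = frac_series \<beta> 0 (fps_shift 1 A) x"
proof -
  have "frac_series \<beta> (1 - \<beta>) A = frac_series \<beta> 1 (fps_shift 1 A)"
    using frac_series_shift[OF \<beta>(1) _ A A0, of "1 - \<beta>"] \<beta> by simp
  then have D: "(frac_series \<beta> (1 - \<beta>) A has_real_derivative frac_series \<beta> 0 (fps_shift 1 A) x) (at x)"
    using frac_series_has_derivative[OF \<beta>(1) geom_bdd_shift[OF A] x] by simp
  then have D': "frac_series \<beta> (1 - \<beta>) A differentiable (at x)"
    by (auto simp: real_differentiable_def)
  have "caputo_differentiable (power_drift \<beta>) (power_tail \<beta>) (frac_series \<beta> 0 A) x \<and>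
     caputo_deriv (power_drift \<beta>) (power_tail \<beta>) (frac_series \<beta> 0 A) x = frac_series \<beta> 0 (fps_shift 1 A) x"
  proof (cases "\<beta> = 1")
    case True
    have "memory_integral (\<lambda>s. 0) u = (\<lambda>t. 0)" for u
      by (simp add: fun_eq_iff memory_integral_def)
    then show ?thesis using True D D'
      by (auto simp: caputo_differentiable_def caputo_deriv_def power_drift_def power_tail_def[abs_def]
          set_integrable_def intro: DERIV_imp_deriv)
  next
    case False
    then have \<beta>1: "\<beta> < 1" using \<beta> by simp
    define k where "k = rl_kernel (1 - \<beta>)"
    have k: "k = frac_series \<beta> (1 - \<beta>) 1"
      using frac_series_monom[of \<beta> "1 - \<beta>" 1 0] by (simp add: k_def fun_eq_iff)
    \<comment> \<open>This holds at the end points too: \<open>power_tail \<beta> 0\<close> is 0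
      because \<open>0 powr a = 0\<close>, and \<open>frac_series\<close> vanishes at 0, which also
      disposes of the subtracted initial value.\<close>
    have int_eq: "indicator {0..r} s *\<^sub>R ((frac_series \<beta> 0 A (r - s) - frac_series \<beta> 0 A 0) * power_tail \<beta> s)
        = frac_series \<beta> 0 A (r - s) * k s" for r s
    proof (cases "s \<in> {0..r}")
      case True
      then show ?thesis using \<beta>1 by (cases "s = 0") (auto simp: k_def rl_kernel_def power_tail_def)
    next
      case False
      then have "s < 0 \<or> r - s \<le> 0" by auto
      with False show ?thesis by (auto simp: k_def rl_kernel_def)
    qed
    have "geom_bdd (1 :: real fps)" using geom_bdd_monom[of 1 0] by simp
    note conv = frac_series_convolution[OF \<beta>(1) _ A this A0, of "1 - \<beta>", folded k]
    have si: "set_integrable lborel {0..r} (\<lambda>s. (frac_series \<beta> 0 A (r - s) - frac_series \<beta> 0 A 0) * power_tail \<beta> s)" for r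
      unfolding set_integrable_def int_eq using conv(1)[of r] \<beta>1 by simp
    have mem: "memory_integral (power_tail \<beta>) (frac_series \<beta> 0 A) = frac_series \<beta> (1 - \<beta>) A"
      unfolding memory_integral_def set_lebesgue_integral_def int_eq using conv(2) \<beta>1 by (simp add: fun_eq_iff)
    show ?thesis using False si D D'
      by (auto simp: caputo_differentiable_def caputo_deriv_def mem power_drift_def intro: DERIV_imp_deriv)
  qed
  then show "caputo_differentiable (power_drift \<beta>) (power_tail \<beta>) (frac_series \<beta> 0 A) x"
    "caputo_deriv (power_drift \<beta>) (power_tail \<beta>) (frac_series \<beta> 0 A) x = frac_series \<beta> 0 (fps_shift 1 A) x"
    by auto
qed

subsection \<open>The Mittag-Leffler density and its convolution powers\<close>

text \<open>The power series of \<open>\<eta> X / (1 + \<eta> X)\<close>; with \<open>X = s powr (- \<beta>)\<close> this is the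
  Laplace transform \<open>\<eta> / (s powr \<beta> + \<eta>)\<close>.\<close>

definition ml_fps :: "real \<Rightarrow> real fps" where
  "ml_fps \<eta> = Abs_fps (\<lambda>m. if m = 0 then 0 else - ((- \<eta>) ^ m))"

lemma ml_fps_0 [simp]: "ml_fps \<eta> $ 0 = 0"
  by (simp add: ml_fps_def)

lemma ml_fps_rec: "ml_fps \<eta> = fps_const \<eta> * fps_X - (fps_const \<eta> * fps_X) * ml_fps \<eta>"
proof (rule fps_ext)
  fix m
  have "(fps_const \<eta> * fps_X * ml_fps \<eta>) $ m = \<eta> * (if m = 0 then 0 else ml_fps \<eta> $ (m - 1))"
    by (simp add: mult.assoc)
  then show "ml_fps \<eta> $ m = (fps_const \<eta> * fps_X - (fps_const \<eta> * fps_X) * ml_fps \<eta>) $ m"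
    by (cases m) (auto simp: ml_fps_def)
qed

lemma geom_bdd_ml_fps: "0 < \<eta> \<Longrightarrow> geom_bdd (ml_fps \<eta>)"
  by (rule geom_bddI[of 1 \<eta>]) (auto simp: ml_fps_def power_abs)

text \<open>The recursion for \<open>ml_fps\<close> times \<open>ml_fps \<eta> ^ n\<close>, divided
  by \<open>fps_X\<close>. Through \<open>frac_series_caputo\<close> this formal identity becomes
  the Caputo derivative of the convolution powers.\<close>

lemma ml_fps_power_shift: "fps_shift 1 (ml_fps \<eta> ^ Suc n) = fps_const \<eta> * (ml_fps \<eta> ^ n - ml_fps \<eta> ^ Suc n)"
proof -
  have "ml_fps \<eta> ^ Suc n = (fps_const \<eta> * fps_X - (fps_const \<eta> * fps_X) * ml_fps \<eta>) * ml_fps \<eta> ^ n"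
    unfolding power_Suc using ml_fps_rec[of \<eta>] by metis
  also have "\<dots> = fps_const \<eta> * (ml_fps \<eta> ^ n - ml_fps \<eta> ^ Suc n) * fps_X"
    by (simp add: algebra_simps)
  finally have eq: "ml_fps \<eta> ^ Suc n = fps_const \<eta> * (ml_fps \<eta> ^ n - ml_fps \<eta> ^ Suc n) * fps_X" .
  show ?thesis by (subst eq) (rule fps_shift_times_fps_X')
qed

text \<open>By \<open>ml_fps_power_shift\<close> a coefficient of degree \<open>m + 1\<close> is
  \<open>\<eta>\<close> times a difference of two of degree \<open>m\<close>, so each degree costs a
  factor \<open>2 * \<eta>\<close>. That the bound covers the sum over \<open>n\<close>, uniformly
  in \<open>N\<close>, is what later permits exchanging the sum over jump counts with the kernel
  expansion.\<close>

lemma sum_abs_ml_fps_power: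
  assumes \<eta>: "0 < \<eta>"
  shows "(\<Sum>n\<le>N. \<bar>(ml_fps \<eta> ^ n) $ m\<bar>) \<le> (2 * \<eta>) ^ m"
proof (induction m arbitrary: N)
  case 0
  have "(\<Sum>n\<le>N. \<bar>(ml_fps \<eta> ^ n) $ 0\<bar>) = (\<Sum>n\<in>{0}. \<bar>(ml_fps \<eta> ^ n) $ 0\<bar>)"
    by (rule sum.mono_neutral_right) auto
  then show ?case by simp
next
  case (Suc m)
  have step: "\<bar>(ml_fps \<eta> ^ Suc n) $ Suc m\<bar> \<le> \<eta> * \<bar>(ml_fps \<eta> ^ n) $ m\<bar> + \<eta> * \<bar>(ml_fps \<eta> ^ Suc n) $ m\<bar>" for n
  proof -
    have "(ml_fps \<eta> ^ Suc n) $ Suc m = fps_shift 1 (ml_fps \<eta> ^ Suc n) $ m" by simp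
    also have "\<dots> = \<eta> * (ml_fps \<eta> ^ n) $ m - \<eta> * (ml_fps \<eta> ^ Suc n) $ m"
      unfolding ml_fps_power_shift by (simp only: fps_mult_left_const_nth fps_sub_nth right_diff_distrib)
    also have "\<bar>\<dots>\<bar> \<le> \<eta> * \<bar>(ml_fps \<eta> ^ n) $ m\<bar> + \<eta> * \<bar>(ml_fps \<eta> ^ Suc n) $ m\<bar>"
      using \<eta> by (auto intro!: order_trans[OF abs_triangle_ineq4] simp: abs_mult simp del: power_Suc)
    finally show ?thesis .
  qed
  have "(\<Sum>n\<le>N. \<bar>(ml_fps \<eta> ^ n) $ Suc m\<bar>) \<le> (\<Sum>n\<le>Suc N. \<bar>(ml_fps \<eta> ^ n) $ Suc m\<bar>)"
    by simp
  also have "\<dots> = (\<Sum>n\<le>N. \<bar>(ml_fps \<eta> ^ Suc n) $ Suc m\<bar>)"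
    by (subst sum.atMost_Suc_shift) simp
  also have "\<dots> \<le> (\<Sum>n\<le>N. \<eta> * \<bar>(ml_fps \<eta> ^ n) $ m\<bar> + \<eta> * \<bar>(ml_fps \<eta> ^ Suc n) $ m\<bar>)"
    by (intro sum_mono step)
  also have "\<dots> = \<eta> * ((\<Sum>n\<le>N. \<bar>(ml_fps \<eta> ^ n) $ m\<bar>) + (\<Sum>n\<le>N. \<bar>(ml_fps \<eta> ^ Suc n) $ m\<bar>))"
    by (simp only: sum.distrib sum_distrib_left distrib_left)
  also have "\<dots> \<le> \<eta> * ((2 * \<eta>) ^ m + (2 * \<eta>) ^ m)"
  proof -
    have "(\<Sum>n\<le>N. \<bar>(ml_fps \<eta> ^ Suc n) $ m\<bar>) \<le> (\<Sum>n\<le>Suc N. \<bar>(ml_fps \<eta> ^ n) $ m\<bar>)"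
      by (subst sum.atMost_Suc_shift) (simp del: power_Suc)
    also have "\<dots> \<le> (2 * \<eta>) ^ m" by (rule Suc.IH)
    finally show ?thesis using \<eta> by (intro mult_left_mono add_mono Suc.IH) auto
  qed
  also have "\<dots> = (2 * \<eta>) ^ Suc m" by simp
  finally show ?case .
qed

text \<open>The kernel expansion of the density starts at index \<open>\<beta>\<close>. One shift of
  \<open>ml_fps\<close> makes the offset \<open>\<beta>\<close> explicit and the powers of
  \<open>- \<eta> * x powr \<beta>\<close> visible.\<close>

lemma mittag_leffler_density_eq:
  assumes "0 < \<beta>" "0 < \<eta>"
  shows "mittag_leffler_density \<beta> \<eta> x = frac_series \<beta> 0 (ml_fps \<eta>) x"
proof (cases "0 < x")
  case True
  have shift: "fps_shift 1 (ml_fps \<eta>) $ m / G * z ^ m = \<eta> * ((- \<eta> * z) ^ m / G)" for m G z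
    using power_mult_distrib[of "- \<eta>" z m] by (simp add: ml_fps_def)
  have "frac_series \<beta> 0 (ml_fps \<eta>) x = frac_series \<beta> \<beta> (fps_shift 1 (ml_fps \<eta>)) x"
    using frac_series_shift[of \<beta> 0 "ml_fps \<eta>"] assms geom_bdd_ml_fps[OF assms(2)] by simp
  also have "\<dots> = x powr (\<beta> - 1) * (\<Sum>m. \<eta> * ((- \<eta> * x powr \<beta>) ^ m / Gamma (\<beta> * real m + \<beta>)))"
    using assms True geom_bdd_shift[OF geom_bdd_ml_fps[OF assms(2)], of 1]
    by (subst frac_series_conv_powser) (auto simp only: shift)
  also have "(\<Sum>m. \<eta> * ((- \<eta> * x powr \<beta>) ^ m / Gamma (\<beta> * real m + \<beta>)))
      = \<eta> * mittag_leffler \<beta> \<beta> (- \<eta> * x powr \<beta>)"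
    unfolding mittag_leffler_def
  proof (rule suminf_mult)
    have "geom_bdd (Abs_fps (\<lambda>m. 1))" by (rule geom_bddI[of 1 1]) auto
    from frac_series_conv_powser(1)[OF assms(1) less_imp_le[OF assms(1)] this, of "- \<eta> * x powr \<beta>"]
    show "summable (\<lambda>m. (- \<eta> * x powr \<beta>) ^ m / Gamma (\<beta> * real m + \<beta>))" by simp
  qed
  finally show ?thesis using True by (simp add: mittag_leffler_density_def)
qed (simp add: mittag_leffler_density_def)

text \<open>Fubini for a double series, with the sum over \<open>m\<close> written as an integral
  over \<open>count_space\<close>. The bound on the \<open>n\<close>-sums, uniform in
  \<open>N\<close>, supplies the absolute summability; of the weights only boundedness by 1 enters,
  so they may be probabilities.\<close>

lemma frac_series_suminf_swap:
  fixes A :: "nat \<Rightarrow> real fps" and p :: "nat \<Rightarrow> real"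
  assumes \<beta>: "0 < \<beta>" and K: "0 \<le> C" "0 < K" and A: "\<And>N m. (\<Sum>n\<le>N. \<bar>A n $ m\<bar>) \<le> C * K ^ m"
    and p: "\<And>n. \<bar>p n\<bar> \<le> 1"
  defines "B \<equiv> Abs_fps (\<lambda>m. \<Sum>n. p n * A n $ m)"
  shows "geom_bdd B"
    and "summable (\<lambda>n. \<bar>p n * frac_series \<beta> 0 (A n) x\<bar>)"
    and "frac_series \<beta> 0 B x = (\<Sum>n. p n * frac_series \<beta> 0 (A n) x)"
proof -
  define T where "T m = rl_kernel (\<beta> * real m) x" for m
  have T: "0 \<le> T m" for m using \<beta> by (simp add: T_def rl_kernel_nonneg)
  have pA: "\<bar>p n * A n $ m\<bar> \<le> \<bar>A n $ m\<bar>" for n m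
    using mult_right_mono[OF p, of "\<bar>A n $ m\<bar>" n] by (simp add: abs_mult)
  have sA: "(\<Sum>n\<le>N. \<bar>p n * A n $ m\<bar>) \<le> C * K ^ m" for N m
    using order_trans[OF sum_mono[OF pA] A] .
  have sA': "(\<Sum>n<N. \<bar>p n * A n $ m\<bar>) \<le> C * K ^ m" for N m
    by (rule order_trans[OF sum_mono2 sA[of m N]]) auto
  have summ_n: "summable (\<lambda>n. \<bar>p n * A n $ m\<bar>)" for m
    by (rule summableI_nonneg_bounded[OF _ sA']) auto
  show "geom_bdd B"
  proof (rule geom_bddI[OF K])
    fix m
    have "\<bar>B $ m\<bar> \<le> (\<Sum>n. \<bar>p n * A n $ m\<bar>)"
      unfolding B_def fps_nth_Abs_fps by (rule summable_rabs[OF summ_n])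
    also have "\<dots> \<le> C * K ^ m" by (rule suminf_le_const[OF summ_n sA'])
    finally show "\<bar>B $ m\<bar> \<le> C * K ^ m" .
  qed
  have An: "\<bar>A n $ m\<bar> \<le> C * K ^ m" for n m
    by (rule order_trans[OF member_le_sum[of n "{..n}" "\<lambda>n. \<bar>A n $ m\<bar>"] A]) auto
  have gA: "geom_bdd (A n)" for n by (rule geom_bddI[OF K An])
  have CK: "summable (\<lambda>m. C * K ^ m * T m)"
    using rl_kernel_summable[OF \<beta> K(2), of 0 x] by (simp add: T_def mult.assoc)
  define f where "f n m = p n * A n $ m * T m" for n m
  have f_abs: "norm (f n m) = \<bar>p n * A n $ m\<bar> * T m" for n m by (simp add: f_def abs_mult T)
  have f_int: "integrable (count_space UNIV) (f n)" for n
    unfolding integrable_count_space_nat_iff f_abs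
    by (rule summable_comparison_test'[OF CK]) (auto simp: abs_mult T intro!: mult_right_mono order_trans[OF pA An, unfolded abs_mult])
  have f_sum: "summable (\<lambda>n. norm (f n m))" for m
    unfolding f_abs by (intro summable_mult2 summ_n)
  have f_norm: "summable (\<lambda>n. \<integral>m. norm (f n m) \<partial>count_space UNIV)"
  proof (rule summableI_nonneg_bounded)
    fix N :: nat
    have "(\<Sum>n<N. \<integral>m. norm (f n m) \<partial>count_space UNIV) = (\<integral>m. (\<Sum>n<N. norm (f n m)) \<partial>count_space UNIV)"
      using f_int by (subst Bochner_Integration.integral_sum) auto
    also have "\<dots> \<le> (\<integral>m. C * K ^ m * T m \<partial>count_space UNIV)"
    proof (rule integral_mono)
      show "integrable (count_space UNIV) (\<lambda>m. \<Sum>n<N. norm (f n m))"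
        using f_int by (intro Bochner_Integration.integrable_sum) auto
      show "integrable (count_space UNIV) (\<lambda>m. C * K ^ m * T m)"
        using CK K T by (simp add: integrable_count_space_nat_iff abs_mult)
      show "(\<Sum>n<N. norm (f n m)) \<le> C * K ^ m * T m" for m
        unfolding f_abs sum_distrib_right[symmetric] by (rule mult_right_mono[OF sA' T])
    qed
    finally show "(\<Sum>n<N. \<integral>m. norm (f n m) \<partial>count_space UNIV) \<le> (\<integral>m. C * K ^ m * T m \<partial>count_space UNIV)" .
  qed simp
  have f_n: "(\<integral>m. f n m \<partial>count_space UNIV) = p n * frac_series \<beta> 0 (A n) x" for n
  proof -
    have "(\<integral>m. f n m \<partial>count_space UNIV) = (\<Sum>m. p n * (A n $ m * T m))"
      unfolding integral_count_space_nat[OF f_int] by (intro suminf_cong) (simp add: f_def)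
    also have "\<dots> = p n * frac_series \<beta> 0 (A n) x"
      using frac_series_summable(2)[OF \<beta> order.refl gA, of n x]
      by (simp add: frac_series_def T_def suminf_mult)
    finally show ?thesis .
  qed
  show "summable (\<lambda>n. \<bar>p n * frac_series \<beta> 0 (A n) x\<bar>)"
    unfolding f_n[symmetric]
    by (rule summable_comparison_test'[OF f_norm]) (use integral_norm_bound[of "count_space UNIV" "f _"] in simp)
  have "frac_series \<beta> 0 B x = (\<Sum>m. \<Sum>n. f n m)"
    unfolding frac_series_def B_def f_def using summ_n[THEN summable_rabs_cancel]
    by (simp add: T_def suminf_mult2)
  also have "\<dots> = (\<integral>m. (\<Sum>n. f n m) \<partial>count_space UNIV)"
    by (rule integral_count_space_nat[symmetric], rule integrable_suminf[OF f_int AE_I2[OF f_sum] f_norm])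
  also have "\<dots> = (\<Sum>n. \<integral>m. f n m \<partial>count_space UNIV)"
    by (rule integral_suminf[OF f_int AE_I2[OF f_sum] f_norm])
  finally show "frac_series \<beta> 0 B x = (\<Sum>n. p n * frac_series \<beta> 0 (A n) x)"
    unfolding f_n .
qed

section \<open>Renewal equation and positivity of the Mittag-Leffler density\<close>

lemma ml_fps_renewal:
  assumes \<beta>: "0 < \<beta>" and \<eta>: "0 < \<eta>"
  defines "g \<equiv> frac_series \<beta> 0 (ml_fps \<eta>)"
  shows "integrable lborel (\<lambda>y. \<eta> * rl_kernel \<beta> (x - y) * g y)"
    and "\<eta> * rl_kernel \<beta> x = g x + (\<integral>y. \<eta> * rl_kernel \<beta> (x - y) * g y \<partial>lborel)"
proof -
  let ?A = "fps_const \<eta> * fps_X :: real fps"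
  have A: "geom_bdd ?A" using geom_bdd_monom[of \<eta> 1] by simp
  have ml: "geom_bdd (ml_fps \<eta>)" using \<eta> by (rule geom_bdd_ml_fps)
  have fA: "frac_series \<beta> 0 ?A x = \<eta> * rl_kernel \<beta> x" for x
    using frac_series_monom[of \<beta> 0 \<eta> 1 x] by simp
  note conv = frac_series_convolution[OF \<beta> order.refl A ml, unfolded fA, of x]
  show "integrable lborel (\<lambda>y. \<eta> * rl_kernel \<beta> (x - y) * g y)"
    unfolding g_def by (rule conv(1)) auto
  \<comment> \<open>\<open>ml_fps_rec\<close> read as an identity of convolutions: the density is
    the resolvent of the kernel \<open>\<eta> * rl_kernel \<beta>\<close>.\<close>
  have "g x = frac_series \<beta> 0 (?A - ?A * ml_fps \<eta>) x"
    unfolding g_def by (subst ml_fps_rec) simp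
  also have "\<dots> = \<eta> * rl_kernel \<beta> x - frac_series \<beta> 0 (?A * ml_fps \<eta>) x"
    by (subst frac_series_diff) (simp_all add: \<beta> A ml geom_bdd_mult fA)
  also have "frac_series \<beta> 0 (?A * ml_fps \<eta>) x = (\<integral>y. \<eta> * rl_kernel \<beta> (x - y) * g y \<partial>lborel)"
    unfolding g_def by (rule conv(2)[symmetric]) auto
  finally show "\<eta> * rl_kernel \<beta> x = g x + (\<integral>y. \<eta> * rl_kernel \<beta> (x - y) * g y \<partial>lborel)"
    by simp
qed

text \<open>Near 0 the leading term \<open>A $ 1 * rl_kernel \<beta> x\<close> dominates; once the
  power of \<open>x\<close> is factored out, continuity of a power series at 0 suffices. The lemma
  keeps a first zero away from 0.\<close>

lemma frac_series_pos_near_0: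
  assumes \<beta>: "0 < \<beta>" and A: "geom_bdd A" and A0: "A $ 0 = 0" and A1: "0 < A $ 1"
  shows "\<exists>\<epsilon>>0. \<forall>x. 0 < x \<and> x < \<epsilon> \<longrightarrow> 0 < frac_series \<beta> 0 A x"
proof -
  define B where "B = fps_shift 1 A"
  have B: "geom_bdd B" unfolding B_def by (rule geom_bdd_shift[OF A])
  define F where "F z = (\<Sum>m. B $ m / Gamma (\<beta> * real m + \<beta>) * z ^ m)" for z :: real
  have eq: "frac_series \<beta> 0 A x = x powr (\<beta> - 1) * F (x powr \<beta>)" if "0 < x" for x
    using frac_series_shift[OF \<beta> order.refl A A0] frac_series_conv_powser(2)[OF \<beta> less_imp_le[OF \<beta>] B that]
    by (simp add: B_def F_def)
  have F: "isCont F z" for z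
    unfolding F_def
    by (rule isCont_powser_converges_everywhere) (rule frac_series_conv_powser(1)[OF \<beta> less_imp_le[OF \<beta>] B])
  have "F 0 = A $ 1 / Gamma \<beta>"
    unfolding F_def using powser_zero[of "\<lambda>m. B $ m / Gamma (\<beta> * real m + \<beta>)"] by (simp add: B_def)
  then have F0: "0 < F 0" using A1 \<beta> by simp
  have "((\<lambda>x. x powr \<beta>) \<longlongrightarrow> 0) (at_right 0)"
    using \<beta> by (intro tendsto_eq_intros) (auto intro: tendsto_ident_at eventually_at_rightI[of 0 1])
  then have "((\<lambda>x. F (x powr \<beta>)) \<longlongrightarrow> F 0) (at_right 0)"
    by (rule isCont_tendsto_compose[OF F])
  then have "eventually (\<lambda>x. 0 < F (x powr \<beta>)) (at_right 0)"
    using F0 by (rule order_tendstoD)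
  then obtain \<epsilon> where "0 < \<epsilon>" "\<And>x. 0 < x \<Longrightarrow> x < \<epsilon> \<Longrightarrow> 0 < F (x powr \<beta>)"
    unfolding eventually_at_right_field by auto
  then show ?thesis using eq by (intro exI[of _ \<epsilon>]) auto
qed

text \<open>The resolvent of the kernel \<open>\<eta> rl_kernel \<beta>\<close> is positive because the kernel is
  nonincreasing and log-convex: at a first zero \<open>t0\<close> compare the renewal equation at \<open>t0\<close> with the one at
  the point \<open>t\<close> shortly before \<open>t0\<close> where the resolvent is maximal.\<close>

lemma frac_series_ml_fps_pos:
  assumes \<beta>: "0 < \<beta>" "\<beta> \<le> 1" and \<eta>: "0 < \<eta>" and x: "0 < x"
  shows "0 < frac_series \<beta> 0 (ml_fps \<eta>) x"
proof (rule ccontr)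
  define g where "g = frac_series \<beta> 0 (ml_fps \<eta>)"
  define a where "a y = \<eta> * rl_kernel \<beta> y" for y
  have ml: "geom_bdd (ml_fps \<eta>)" using \<eta> by (rule geom_bdd_ml_fps)
  have cont: "continuous_on {0<..} g"
    unfolding g_def by (rule frac_series_continuous_on[OF \<beta>(1) order.refl ml])
  have ren_int: "integrable lborel (\<lambda>s. a (y - s) * g s)"
    and ren: "a y = g y + (\<integral>s. a (y - s) * g s \<partial>lborel)" for y
    unfolding a_def g_def by (rule ml_fps_renewal[OF \<beta>(1) \<eta>])+
  obtain \<epsilon> where \<epsilon>: "0 < \<epsilon>" "\<And>x. 0 < x \<Longrightarrow> x < \<epsilon> \<Longrightarrow> 0 < g x"
    using frac_series_pos_near_0[OF \<beta>(1) ml] \<eta> by (auto simp: g_def ml_fps_def)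
  assume neg: "\<not> 0 < frac_series \<beta> 0 (ml_fps \<eta>) x"
  define S where "S = {y. 0 < y \<and> g y \<le> 0}"
  define t0 where "t0 = Inf S"
  have S: "S \<noteq> {}" using neg x unfolding S_def g_def not_less by blast
  have lb: "\<epsilon> \<le> y" if "y \<in> S" for y
    using that \<epsilon>(2)[of y] by (cases "y < \<epsilon>") (auto simp: S_def)
  have bdd: "bdd_below S" using lb by (rule bdd_belowI)
  have t0: "\<epsilon> \<le> t0" unfolding t0_def using S lb by (rule cInf_greatest)
  then have t0_pos: "0 < t0" using \<epsilon> by simp
  have g_pos: "0 < g y" if "0 < y" "y < t0" for y
    using that cInf_lower[OF _ bdd, of y] by (force simp: S_def t0_def)
  have g_t0: "g t0 \<le> 0"
  proof (rule ccontr)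
    assume "\<not> g t0 \<le> 0"
    then have "0 < g t0" by simp
    moreover have "isCont g t0" using cont t0_pos by (simp add: continuous_on_eq_continuous_at)
    ultimately have "eventually (\<lambda>y. 0 < g y) (nhds t0)"
      by (intro order_tendstoD(1)[of g "g t0"]) (auto simp: isCont_def tendsto_at_iff_tendsto_nhds)
    then obtain d where d: "0 < d" "\<And>y. dist y t0 < d \<Longrightarrow> 0 < g y"
      unfolding eventually_nhds_metric by auto
    have "t0 + d \<le> y" if "y \<in> S" for y
    proof -
      have "t0 \<le> y" using cInf_lower[OF that bdd] by (simp add: t0_def)
      moreover have "\<not> dist y t0 < d" using d(2)[of y] that unfolding S_def by force
      ultimately show ?thesis by (simp add: dist_real_def)
    qed
    then have "t0 + d \<le> Inf S" by (rule cInf_greatest[OF S])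
    then have "t0 + d \<le> t0" by (simp add: t0_def)
    then show False using d by simp
  qed
  \<comment> \<open>The integral of \<open>\<eta> * rl_kernel \<beta>\<close> from 0 to
    \<open>e\<close> is \<open>\<eta> * rl_kernel (\<beta> + 1) e\<close>. It has to drop below 1/2,
    which will be a lower bound for \<open>q\<close>.\<close>
  have "((\<lambda>e. \<eta> * rl_kernel (\<beta> + 1) e) \<longlongrightarrow> 0) (at_right 0)"
  proof -
    have "((\<lambda>e. e powr \<beta>) \<longlongrightarrow> 0 powr \<beta>) (at_right (0::real))"
      using \<beta> by (intro tendsto_powr' tendsto_ident_at tendsto_const) (auto intro: eventually_at_rightI[of 0 1])
    then have "((\<lambda>e. \<eta> * (e powr \<beta> / Gamma (\<beta> + 1))) \<longlongrightarrow> \<eta> * (0 powr \<beta> / Gamma (\<beta> + 1))) (at_right 0)"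
      using \<beta> by (intro tendsto_mult tendsto_divide tendsto_const) (auto simp: Gamma_eq_zero_iff dest: nonpos_Ints_nonpos)
    then have "((\<lambda>e. \<eta> * (e powr \<beta> / Gamma (\<beta> + 1))) \<longlongrightarrow> 0) (at_right 0)" by simp
    moreover have "eventually (\<lambda>e. \<eta> * (e powr \<beta> / Gamma (\<beta> + 1)) = \<eta> * rl_kernel (\<beta> + 1) e) (at_right 0)"
      by (rule eventually_at_rightI[of 0 1]) (auto simp: rl_kernel_def)
    ultimately show ?thesis by (rule Lim_transform_eventually)
  qed
  then have "eventually (\<lambda>e. \<eta> * rl_kernel (\<beta> + 1) e < 1/2) (at_right 0)"
    by (rule order_tendstoD) simp
  then obtain e0 where e0: "0 < e0" "\<And>e. 0 < e \<Longrightarrow> e < e0 \<Longrightarrow> \<eta> * rl_kernel (\<beta> + 1) e < 1/2"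
    unfolding eventually_at_right_field by auto
  \<comment> \<open>\<open>e \<le> t0 / 2\<close> gives \<open>t \<ge> t0 / 2\<close> and hence
    \<open>q \<ge> 1 / 2\<close>; \<open>e < e0\<close> makes the kernel mass between
    \<open>t\<close> and \<open>t0\<close> less than 1/2.\<close>
  define e where "e = min (t0 / 2) (e0 / 2)"
  have e: "0 < e" "e \<le> t0 / 2" "e < e0" using e0 t0_pos by (auto simp: e_def)
  have "continuous_on {t0 - e..t0} g"
    by (rule continuous_on_subset[OF cont]) (use e t0_pos in auto)
  then obtain t where t: "t \<in> {t0 - e..t0}" "\<And>s. s \<in> {t0 - e..t0} \<Longrightarrow> g s \<le> g t"
    using continuous_attains_sup[of "{t0 - e..t0}" g] e by auto
  have "0 < g (t0 - e)" using e t0_pos by (intro g_pos) auto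
  then have gt: "0 < g t" using t(2)[of "t0 - e"] e by auto
  have t_lt: "t < t0" using gt g_t0 t(1) by (cases "t = t0") auto
  have t_pos: "0 < t" using t e t0_pos by auto
  \<comment> \<open>This is the ratio \<open>a t0 / a t\<close>.\<close>
  define q where "q = (t / t0) powr (1 - \<beta>)"
  have q_ge: "1 / 2 \<le> q"
  proof -
    have "1 / 2 \<le> t / t0" using t e t0_pos by (auto simp: field_simps)
    also have "\<dots> = (t / t0) powr 1" using t_pos t0_pos by simp
    also have "\<dots> \<le> q" unfolding q_def using t_pos t_lt t0_pos \<beta> by (intro powr_mono') auto
    finally show ?thesis .
  qed
  have powr_ratio: "(u / v) powr (1 - \<beta>) * u powr (\<beta> - 1) = v powr (\<beta> - 1)" if "0 < u" "0 < v" for u v :: real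
  proof -
    have "(u / v) powr (1 - \<beta>) * u powr (\<beta> - 1) = (u powr (1 - \<beta>) * u powr (\<beta> - 1)) / v powr (1 - \<beta>)"
      using that by (simp add: powr_divide)
    also have "u powr (1 - \<beta>) * u powr (\<beta> - 1) = v powr (1 - \<beta>) * v powr (\<beta> - 1)"
      using that by (simp add: powr_add[symmetric])
    finally show ?thesis using that by simp
  qed
  have a_t0: "a t0 = q * a t"
  proof -
    have "q * t powr (\<beta> - 1) = t0 powr (\<beta> - 1)"
      unfolding q_def using t_pos t0_pos by (rule powr_ratio)
    then show ?thesis using t_pos t0_pos by (simp add: a_def rl_kernel_def)
  qed
  have a_nonneg: "0 \<le> a y" for y using \<eta> \<beta> by (simp add: a_def rl_kernel_nonneg)
  \<comment> \<open>Log-convexity of the kernel: the ratio of its values at two points a fixed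
    distance apart does not decrease as the points move to the right.\<close>
  have ratio: "a (t0 - s) \<le> q * a (t - s)" if s: "0 \<le> s" "s < t" for s
  proof -
    have "a (t0 - s) = ((t - s) / (t0 - s)) powr (1 - \<beta>) * a (t - s)"
    proof -
      have "((t - s) / (t0 - s)) powr (1 - \<beta>) * (t - s) powr (\<beta> - 1) = (t0 - s) powr (\<beta> - 1)"
        using s t_lt by (intro powr_ratio) auto
      then show ?thesis using s t_lt by (simp add: a_def rl_kernel_def)
    qed
    also have "\<dots> \<le> q * a (t - s)"
    proof (rule mult_right_mono[OF _ a_nonneg])
      have "(t - s) / (t0 - s) \<le> t / t0" using s t_lt t_pos mult_left_mono[of t t0 s] by (simp add: field_simps)
      then show "((t - s) / (t0 - s)) powr (1 - \<beta>) \<le> q"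
        unfolding q_def using s t_lt \<beta> by (intro powr_mono2) auto
    qed
    finally show ?thesis .
  qed
  \<comment> \<open>\<open>rl_kernel 1\<close> is the indicator of the positive half-line, so
    \<open>J\<close> is the kernel \<open>a (t0 - s)\<close> cut down to \<open>s\<close> between
    \<open>t\<close> and \<open>t0\<close>.\<close>
  define J where "J s = a (t0 - s) * rl_kernel 1 (s - t)" for s
  have J: "integrable lborel J" "(\<integral>s. J s \<partial>lborel) = \<eta> * rl_kernel (\<beta> + 1) (t0 - t)"
  proof -
    have *: "J (t + 1 * y) = \<eta> * (rl_kernel \<beta> ((t0 - t) - y) * rl_kernel 1 y)" for y
      by (simp add: J_def a_def algebra_simps)
    have "integrable lborel (\<lambda>y. J (t + 1 * y))"
      unfolding * using rl_kernel_convolution(1)[of \<beta> 1 "t0 - t"] \<beta> by simp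
    then show "integrable lborel J" by (subst (asm) lborel_integrable_real_affine_iff) auto
    have "(\<integral>s. J s \<partial>lborel) = (\<integral>y. J (t + 1 * y) \<partial>lborel)"
      by (subst lborel_integral_real_affine[of 1 J t]) auto
    also have "\<dots> = \<eta> * rl_kernel (\<beta> + 1) (t0 - t)"
      unfolding * using rl_kernel_convolution(2)[of \<beta> 1 "t0 - t"] \<beta> by simp
    finally show "(\<integral>s. J s \<partial>lborel) = \<eta> * rl_kernel (\<beta> + 1) (t0 - t)" .
  qed
  have J_less: "(\<integral>s. J s \<partial>lborel) < 1 / 2"
    unfolding J using t_lt t(1) e by (intro e0) auto
  \<comment> \<open>For \<open>s < t\<close> the ratio bound applies, between \<open>t\<close> and
    \<open>t0\<close> the bound \<open>g s \<le> g t\<close>. Since \<open>q * a t = a t0\<close>,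
    the renewal equation at \<open>t\<close> cancels the kernel terms; what remains forces
    \<open>q\<close> to be at most the integral of \<open>J\<close>.\<close>
  have "a t0 \<le> (\<integral>s. a (t0 - s) * g s \<partial>lborel)"
    using ren[of t0] g_t0 by simp
  also have "\<dots> \<le> (\<integral>s. q * (a (t - s) * g s) + g t * J s \<partial>lborel)"
  proof (rule integral_mono_AE)
    show "integrable lborel (\<lambda>s. a (t0 - s) * g s)" by (rule ren_int)
    show "integrable lborel (\<lambda>s. q * (a (t - s) * g s) + g t * J s)"
      using ren_int[of t] J(1) by simp
    show "AE s in lborel. a (t0 - s) * g s \<le> q * (a (t - s) * g s) + g t * J s"
      using AE_lborel_singleton[of t]
    proof eventually_elim
      case (elim s)
      consider "s \<le> 0" | "0 < s" "s < t" | "t < s" "s < t0" | "t0 \<le> s" using elim by linarith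
      then show ?case
      proof cases
        case 1
        then show ?thesis using t_pos by (simp add: g_def J_def rl_kernel_def)
      next
        case 2
        then show ?thesis
          using mult_right_mono[OF ratio[of s], of "g s"] g_pos[of s] t_lt
          by (simp add: J_def rl_kernel_def mult.assoc)
      next
        case 3
        then show ?thesis
          using mult_left_mono[OF t(2)[of s] a_nonneg[of "t0 - s"]] t(1)
          by (simp add: J_def rl_kernel_def a_def mult_ac)
      next
        case 4
        then show ?thesis using t_lt by (simp add: a_def J_def rl_kernel_def)
      qed
    qed
  qed
  also have "\<dots> = q * (a t - g t) + g t * (\<integral>s. J s \<partial>lborel)"
    using ren_int[of t] J(1) ren[of t] by simp
  finally have "q * g t \<le> g t * (\<integral>s. J s \<partial>lborel)"
    unfolding a_t0 by (simp add: algebra_simps)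
  then have "q \<le> (\<integral>s. J s \<partial>lborel)" using gt by (simp add: mult.commute)
  then show False using q_ge J_less by simp
qed

text \<open>Positivity passes from the density to its convolution powers, which turns the identity
  for signed integrals into one for \<open>nn_integral\<close>. The power 0 is excluded from the
  second claim because its function is 0 instead of the Dirac measure.\<close>

lemma ml_fps_power_convolution:
  assumes \<beta>: "0 < \<beta>" "\<beta> \<le> 1" and \<eta>: "0 < \<eta>"
  shows "0 \<le> frac_series \<beta> 0 (ml_fps \<eta> ^ n) x"
    and "0 < n \<Longrightarrow> (\<integral>\<^sup>+y. ennreal (frac_series \<beta> 0 (ml_fps \<eta>) (x - y)) * ennreal (frac_series \<beta> 0 (ml_fps \<eta> ^ n) y) \<partial>lborel)
        = ennreal (frac_series \<beta> 0 (ml_fps \<eta> ^ Suc n) x)"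
proof -
  have ml: "geom_bdd (ml_fps \<eta>)" using \<eta> by (rule geom_bdd_ml_fps)
  have g1: "0 \<le> frac_series \<beta> 0 (ml_fps \<eta>) x" for x
    using frac_series_ml_fps_pos[OF \<beta> \<eta>, of x] by (cases "0 < x") auto
  have conv: "integrable lborel (\<lambda>y. frac_series \<beta> 0 (ml_fps \<eta>) (x - y) * frac_series \<beta> 0 (ml_fps \<eta> ^ n) y)"
    "(\<integral>y. frac_series \<beta> 0 (ml_fps \<eta>) (x - y) * frac_series \<beta> 0 (ml_fps \<eta> ^ n) y \<partial>lborel)
      = frac_series \<beta> 0 (ml_fps \<eta> ^ Suc n) x" if "0 < n" for n x
    using frac_series_convolution[OF \<beta>(1) order.refl ml geom_bdd_power[OF ml, of n] ml_fps_0, of x] that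
    by (cases n; simp)+
  have nonneg: "0 \<le> frac_series \<beta> 0 (ml_fps \<eta> ^ n) x" for n x
  proof (induction n arbitrary: x)
    case 0
    show ?case using frac_series_monom[of \<beta> 0 1 0] by simp
  next
    case (Suc n)
    show ?case
    proof (cases "n = 0")
      case False
      then show ?thesis
        using conv(2)[of n x, symmetric] g1 Suc.IH by (simp del: power_Suc)
    qed (simp add: g1)
  qed
  show "0 \<le> frac_series \<beta> 0 (ml_fps \<eta> ^ n) x" by (rule nonneg)
  show "(\<integral>\<^sup>+y. ennreal (frac_series \<beta> 0 (ml_fps \<eta>) (x - y)) * ennreal (frac_series \<beta> 0 (ml_fps \<eta> ^ n) y) \<partial>lborel)
        = ennreal (frac_series \<beta> 0 (ml_fps \<eta> ^ Suc n) x)" if "0 < n"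
    using nn_integral_eq_integral[OF conv(1)[OF that]] conv(2)[OF that] g1 nonneg
    by (simp add: ennreal_mult)
qed

text \<open>Induction over convolutions. It starts with one jump, since an empty sum has no
  density.\<close>

lemma (in prob_space) distributed_sum_mittag_leffler:
  assumes \<beta>: "0 < \<beta>" "\<beta> \<le> 1" and \<eta>: "0 < \<eta>"
    and X: "\<And>i. 1 \<le> i \<Longrightarrow> distributed M lborel (X i) (\<lambda>x. ennreal (mittag_leffler_density \<beta> \<eta> x))"
    and indep: "indep_vars (\<lambda>_. borel) X {1::nat..}"
  shows "0 < n \<Longrightarrow> distributed M lborel (\<lambda>\<omega>. \<Sum>i\<in>{1..n}. X i \<omega>) (\<lambda>x. ennreal (frac_series \<beta> 0 (ml_fps \<eta> ^ n) x))"
proof (induction n)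
  case (Suc n)
  note X = X[unfolded mittag_leffler_density_eq[OF \<beta>(1) \<eta>]]
  show ?case
  proof (cases "n = 0")
    case True
    then show ?thesis using X[of 1] by simp
  next
    case False
    have "indep_vars (\<lambda>_. borel) X (insert (Suc n) {1..n})"
      by (rule indep_vars_subset[OF indep]) auto
    then have "indep_var borel (X (Suc n)) borel (\<lambda>\<omega>. \<Sum>i\<in>{1..n}. X i \<omega>)"
      by (intro indep_vars_sum) auto
    from distributed_convolution[OF this X Suc.IH] False
    have "distributed M lborel (\<lambda>\<omega>. X (Suc n) \<omega> + (\<Sum>i\<in>{1..n}. X i \<omega>))
        (\<lambda>x. \<integral>\<^sup>+y. ennreal (frac_series \<beta> 0 (ml_fps \<eta>) (x - y)) * ennreal (frac_series \<beta> 0 (ml_fps \<eta> ^ n) y) \<partial>lborel)"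
      by simp
    then show ?thesis
      using False by (simp add: ml_fps_power_convolution[OF \<beta> \<eta>] add.commute del: power_Suc)
  qed
qed simp

subsection \<open>Laplace transforms on the half-line\<close>

definition half_conv :: "(real \<Rightarrow> real) \<Rightarrow> (real \<Rightarrow> real) \<Rightarrow> real \<Rightarrow> real" where
  "half_conv u k t = (LBINT r:{0..t}. u (t - r) * k r)"

definition laplace_at :: "(real \<Rightarrow> real) \<Rightarrow> real \<Rightarrow> bool" where
  "laplace_at u s \<longleftrightarrow> set_integrable lborel {0..} (\<lambda>t. exp (- s * t) * u t)"

definition laplace :: "(real \<Rightarrow> real) \<Rightarrow> real \<Rightarrow> real" where
  "laplace u s = (LBINT t:{0..}. exp (- s * t) * u t)"

lemma memory_integral_eq_half_conv: "memory_integral k u = half_conv (\<lambda>r. u r - u 0) k"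
  by (simp add: fun_eq_iff memory_integral_def half_conv_def)

lemma laplace_add:
  assumes "laplace_at u s" "laplace_at v s"
  shows "laplace_at (\<lambda>t. u t + v t) s" "laplace (\<lambda>t. u t + v t) s = laplace u s + laplace v s"
  using assms by (auto simp: laplace_at_def laplace_def distrib_left set_integral_add)

lemma laplace_diff:
  assumes "laplace_at u s" "laplace_at v s"
  shows "laplace_at (\<lambda>t. u t - v t) s" "laplace (\<lambda>t. u t - v t) s = laplace u s - laplace v s"
  using assms by (auto simp: laplace_at_def laplace_def right_diff_distrib set_integral_diff)

lemma laplace_cmult:
  assumes "laplace_at u s"
  shows "laplace_at (\<lambda>t. c * u t) s" "laplace (\<lambda>t. c * u t) s = c * laplace u s"
proof -
  have "(\<lambda>t. exp (- s * t) * (c * u t)) = (\<lambda>t. c * (exp (- s * t) * u t))" by (simp add: fun_eq_iff)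
  then show "laplace_at (\<lambda>t. c * u t) s" "laplace (\<lambda>t. c * u t) s = c * laplace u s"
    using assms by (simp_all only: laplace_at_def laplace_def set_integrable_mult_right set_integral_mult_right)
qed

lemma laplace_cong:
  assumes "\<And>t. 0 \<le> t \<Longrightarrow> u t = v t"
  shows "laplace_at u s = laplace_at v s" "laplace u s = laplace v s"
proof -
  show "laplace_at u s = laplace_at v s"
    unfolding laplace_at_def by (rule set_integrable_cong) (auto simp: assms)
  show "laplace u s = laplace v s"
    unfolding laplace_def by (rule set_lebesgue_integral_cong) (auto simp: assms)
qed

lemma exp_mult_exp_mult: "exp (- a * t) * (exp (- b * t) * y) = exp (- (a + b) * t) * (y::real)"
  using exp_add[of "- a * t" "- b * t"] by (simp add: algebra_simps)

lemma laplace_exp_mult: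
  "laplace_at (\<lambda>t. exp (- b * t) * u t) s = laplace_at u (s + b)"
  "laplace (\<lambda>t. exp (- b * t) * u t) s = laplace u (s + b)"
  unfolding laplace_at_def laplace_def exp_mult_exp_mult by simp_all

lemma nn_integral_exp_Ici:
  assumes "0 < (a::real)"
  shows "(\<integral>\<^sup>+t. ennreal (exp (- a * t)) * indicator {x..} t \<partial>lborel) = ennreal (exp (- a * x) / a)"
proof -
  have "((\<lambda>t. - exp (- a * t) / a) \<longlongrightarrow> 0) at_top"
    using assms by real_asymp
  then have "(\<integral>\<^sup>+t. ennreal (exp (- a * t)) * indicator {x..} t \<partial>lborel) = ennreal (0 - (- exp (- a * x) / a))"
    using assms by (intro nn_integral_FTC_atLeast) (auto intro!: derivative_eq_intros)
  then show ?thesis by simp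
qed

lemma laplace_const:
  assumes "0 < s"
  shows "laplace_at (\<lambda>t. c) s" "laplace (\<lambda>t. c) s = c / s"
proof -
  have "has_bochner_integral lborel (\<lambda>t. indicator {0..} t * exp (- s * t)) (1 / s)"
    using nn_integral_exp_Ici[OF assms, of 0] assms
    by (intro has_bochner_integral_nn_integral) (auto simp: ennreal_mult mult.commute ennreal_indicator)
  then have "integrable lborel (\<lambda>t. indicator {0..} t * exp (- s * t))"
      "(\<integral>t. indicator {0..} t * exp (- s * t) \<partial>lborel) = 1 / s"
    by (auto simp: has_bochner_integral_iff)
  then have "laplace_at (\<lambda>t. 1) s" "laplace (\<lambda>t. 1) s = 1 / s"
    by (auto simp: laplace_at_def laplace_def set_integrable_def set_lebesgue_integral_def)
  from laplace_cmult[OF this(1), of c] this(2)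
  show "laplace_at (\<lambda>t. c) s" "laplace (\<lambda>t. c) s = c / s" by simp_all
qed

lemma laplace_at_exp_bounded:
  assumes cont: "continuous_on {0..} u" and bd: "\<And>t. 0 \<le> t \<Longrightarrow> \<bar>u t\<bar> \<le> C * exp (c * t)" and s: "c < s"
  shows "laplace_at u s"
proof -
  have C: "0 \<le> C" using bd[of 0] by (simp add: order_trans[OF abs_ge_zero])
  have "set_integrable lborel {0..} (\<lambda>t. C * exp (- (s - c) * t))"
    using laplace_const(1)[of "s - c" C] s by (simp add: laplace_at_def mult.commute)
  then show ?thesis
    unfolding laplace_at_def
  proof (rule set_integrable_bound)
    have "continuous_on {0..} (\<lambda>t. exp (- s * t) * u t)"
      by (intro continuous_on_mult cont continuous_intros)
    then show "set_borel_measurable lborel {0..} (\<lambda>t. exp (- s * t) * u t)"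
      unfolding set_borel_measurable_def
      using borel_measurable_continuous_on_indicator[of "{0..}" "\<lambda>t. exp (- s * t) * u t"] by simp
    show "AE t in lborel. t \<in> {0..} \<longrightarrow> norm (exp (- s * t) * u t) \<le> norm (C * exp (- (s - c) * t))"
    proof (intro AE_I2 impI)
      fix t :: real assume "t \<in> {0..}"
      then have "exp (- s * t) * \<bar>u t\<bar> \<le> exp (- s * t) * (C * exp (c * t))"
        by (intro mult_left_mono bd) auto
      also have "\<dots> = C * exp (- (s - c) * t)"
        by (simp add: exp_add[symmetric] algebra_simps)
      finally show "norm (exp (- s * t) * u t) \<le> norm (C * exp (- (s - c) * t))"
        using C by (simp add: abs_mult)
    qed
  qed
qed

text \<open>The weight splits as \<open>exp (- s * r) * exp (- s * (t - r))\<close>, so the weighted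
  functions, extended by 0, convolve over the whole line and Fubini applies.\<close>

lemma laplace_half_conv:
  assumes u: "laplace_at u s" and k: "laplace_at k s"
  shows "laplace_at (half_conv u k) s" "laplace (half_conv u k) s = laplace u s * laplace k s"
proof -
  define u0 where "u0 = (\<lambda>t. indicator {0..} t * (exp (- s * t) * u t))"
  define k0 where "k0 = (\<lambda>t. indicator {0..} t * (exp (- s * t) * k t))"
  have u0i: "integrable lborel u0" and k0i: "integrable lborel k0"
    using u k by (auto simp: u0_def k0_def laplace_at_def set_integrable_def)
  have [measurable]: "u0 \<in> borel_measurable borel" "k0 \<in> borel_measurable borel"
    using borel_measurable_integrable[OF u0i] borel_measurable_integrable[OF k0i] by auto
  have shift: "integrable lborel (\<lambda>t. u0 (t - r))" for r
    using lborel_integrable_real_affine[OF u0i, of 1 "- r"] by simp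
  have shift_int: "(\<integral>t. f (t - r) \<partial>lborel) = (\<integral>q. f q \<partial>lborel)" for f :: "real \<Rightarrow> real" and r
    using lborel_integral_real_affine[of 1 f "- r"] by simp
  define H where "H = (\<lambda>r t. k0 r * u0 (t - r))"
  have [measurable]: "case_prod H \<in> borel_measurable (lborel \<Otimes>\<^sub>M lborel)"
    unfolding H_def by measurable
  have Hi: "integrable (lborel \<Otimes>\<^sub>M lborel) (case_prod H)"
  proof (rule lborel_pair.Fubini_integrable)
    have "(\<integral>t. norm (H r t) \<partial>lborel) = norm (k0 r) * (\<integral>t. norm (u0 t) \<partial>lborel)" for r
      using shift_int[of "\<lambda>t. norm (u0 t)" r] by (simp add: H_def abs_mult)
    then show "integrable lborel (\<lambda>r. \<integral>t. norm (case_prod H (r, t)) \<partial>lborel)"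
      using k0i by simp
    show "AE r in lborel. integrable lborel (\<lambda>t. case_prod H (r, t))"
      using shift by (auto simp: H_def)
  qed simp
  have Ht: "(\<integral>r. H r t \<partial>lborel) = indicator {0..} t * (exp (- s * t) * half_conv u k t)" for t
  proof -
    have "(\<integral>r. H r t \<partial>lborel)
        = (\<integral>r. exp (- s * t) * (indicator {0..t} r * (u (t - r) * k r)) \<partial>lborel)"
    proof (rule Bochner_Integration.integral_cong[OF refl])
      fix r
      have "exp (- s * r) * exp (- s * (t - r)) = exp (- s * t)"
        by (simp add: exp_add[symmetric] algebra_simps)
      then show "H r t = exp (- s * t) * (indicator {0..t} r * (u (t - r) * k r))"
        by (auto simp: H_def u0_def k0_def indicator_def)
    qed
    then show ?thesis by (cases "0 \<le> t") (auto simp: half_conv_def set_lebesgue_integral_def)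
  qed
  have Hr: "(\<integral>t. H r t \<partial>lborel) = k0 r * (\<integral>t. u0 t \<partial>lborel)" for r
    using shift_int[of u0 r] by (simp add: H_def)
  show "laplace_at (half_conv u k) s"
    using lborel_pair.integrable_snd[OF Hi] by (simp add: Ht laplace_at_def set_integrable_def)
  have "laplace (half_conv u k) s = (\<integral>t. (\<integral>r. H r t \<partial>lborel) \<partial>lborel)"
    by (simp add: Ht laplace_def set_lebesgue_integral_def)
  also have "\<dots> = (\<integral>r. (\<integral>t. H r t \<partial>lborel) \<partial>lborel)"
    by (rule lborel_pair.Fubini_integral[OF Hi])
  also have "\<dots> = laplace u s * laplace k s"
    by (simp add: Hr u0_def k0_def laplace_def set_lebesgue_integral_def)
  finally show "laplace (half_conv u k) s = laplace u s * laplace k s" .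
qed

section \<open>Uniqueness of Laplace transforms\<close>

lemma continuous_AE_eq_imp_eq:
  fixes f g :: "'a::euclidean_space \<Rightarrow> real"
  assumes S: "open S" and f: "continuous_on S f" and g: "continuous_on S g"
    and AE: "AE x in lborel. x \<in> S \<longrightarrow> f x = g x" and x: "x \<in> S"
  shows "f x = g x"
proof (rule ccontr)
  assume neq: "f x \<noteq> g x"
  define T where "T = S \<inter> (\<lambda>x. f x - g x) -` (- {0})"
  have T: "open T" unfolding T_def
    by (intro continuous_open_preimage continuous_on_diff f g S) auto
  have "x \<in> T" using x neq by (simp add: T_def)
  obtain N where N: "{x \<in> space lborel. \<not> (x \<in> S \<longrightarrow> f x = g x)} \<subseteq> N" "N \<in> sets lborel" "emeasure lborel N = 0"
    using AE by (rule AE_E)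
  have "T \<subseteq> N" using N(1) by (auto simp: T_def)
  moreover have "N \<in> null_sets lebesgue" using N by (auto intro: null_sets_completionI)
  ultimately have "negligible T"
    using negligible_iff_null_sets negligible_subset by blast
  then show False using open_not_negligible[OF T] \<open>x \<in> T\<close> by auto
qed

text \<open>Lerch's theorem. With \<open>y = exp (- t)\<close> the transforms at integers become
  moments of a continuous function on \<open>{0..1}\<close>; approximating this function by
  polynomials shows that the integral of its square vanishes.\<close>

lemma laplace_eq_0_imp_eq_0:
  fixes F :: "real \<Rightarrow> real"
  assumes cont: "continuous_on {0..} F" and bd: "\<And>t. 0 \<le> t \<Longrightarrow> \<bar>F t\<bar> \<le> C * exp (c * t)"
    and zero: "\<And>s. c' < s \<Longrightarrow> laplace F s = 0" and t: "0 < t"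
  shows "F t = 0"
proof -
  \<comment> \<open>Being at least \<open>c + 1\<close>, the tilt \<open>d\<close> makes
    \<open>F1\<close> decay like \<open>exp (- t)\<close>, so \<open>G\<close> extends continuously
    by 0 to \<open>y = 0\<close>; being larger than \<open>c'\<close>, it makes the transforms of
    \<open>F1\<close> at all natural numbers vanish.\<close>
  define d where "d = max c c' + 1"
  define F1 where "F1 t = exp (- d * t) * F t" for t
  have C: "0 \<le> C" using bd[of 0] by (simp add: order_trans[OF abs_ge_zero])
  have F1_bd: "\<bar>F1 t\<bar> \<le> C * exp (- t)" if "0 \<le> t" for t
  proof -
    have "\<bar>F1 t\<bar> \<le> exp (- d * t) * (C * exp (c * t))"
      unfolding F1_def using bd[OF that] by (simp add: abs_mult)
    also have "\<dots> = C * exp (- (d - c) * t)" by (simp add: exp_add[symmetric] algebra_simps)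
    also have "\<dots> \<le> C * exp (- t)"
      using mult_right_mono[of 1 "d - c" t] that C by (auto simp: d_def algebra_simps intro!: mult_left_mono)
    finally show ?thesis .
  qed
  have F1_cont: "continuous_on {0..} F1"
    unfolding F1_def by (intro continuous_on_mult cont continuous_intros)
  have F1_at: "laplace_at F1 s" if "-1 < s" for s
    by (rule laplace_at_exp_bounded[OF F1_cont, of C "-1"]) (use F1_bd that in auto)
  have F1_zero: "laplace F1 (real n) = 0" for n
  proof -
    have "laplace F1 (real n) = laplace F (real n + d)"
      unfolding F1_def by (rule laplace_exp_mult)
    then show ?thesis using zero[of "real n + d"] by (simp add: d_def)
  qed
  define G where "G y = (if 0 < y then F1 (- ln y) else 0)" for y :: real
  have G: "G (exp (- t)) = F1 t" for t by (simp add: G_def)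
  have G_cont: "continuous_on {0..1} G"
    unfolding continuous_on_eq_continuous_within
  proof
    fix y :: real assume y: "y \<in> {0..1}"
    show "continuous (at y within {0..1}) G"
    proof (cases "y = 0")
      case True
      have "(G \<longlongrightarrow> 0) (at 0 within {0..1})"
      proof (rule Lim_null_comparison)
        have "\<bar>G z\<bar> \<le> C * z" if "0 < z" "z \<le> 1" for z
          using F1_bd[of "- ln z"] that by (simp add: G_def)
        then show "eventually (\<lambda>z. norm (G z) \<le> C * z) (at 0 within {0..1})"
          by (auto simp: eventually_at_filter intro!: always_eventually)
        have "((\<lambda>z. C * z) \<longlongrightarrow> C * 0) (at 0 within {0..1})" by (intro tendsto_intros)
        then show "((\<lambda>z. C * z) \<longlongrightarrow> 0) (at 0 within {0..1})" by simp
      qed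
      then show ?thesis using True by (simp add: continuous_within G_def)
    next
      case False
      have "continuous_on {0<..1} (\<lambda>z. F1 (- ln z))"
        by (rule continuous_on_compose2[OF F1_cont]) (auto intro!: continuous_intros)
      then have "continuous_on {0<..1} G"
        by (rule continuous_on_eq) (auto simp: G_def)
      then have "continuous (at y within {0<..1}) G"
        using y False by (auto simp: continuous_on_eq_continuous_within)
      moreover have "at y within {0<..1} = at y within {0..1}"
        by (rule at_within_nhd[of _ "{0<..}"]) (use y False in auto)
      ultimately show ?thesis by simp
    qed
  qed
  define h where "h t = F1 t * F1 t" for t
  have h_cont: "continuous_on {0..} h" unfolding h_def by (intro continuous_on_mult F1_cont)
  have h_bd: "\<bar>h t\<bar> \<le> C * C * exp (0 * t)" if "0 \<le> t" for t
  proof -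
    have "C * exp (- t) \<le> C * 1" using that C by (intro mult_left_mono) auto
    then have "\<bar>F1 t\<bar> \<le> C" using F1_bd[OF that] by simp
    then have "\<bar>F1 t\<bar> * \<bar>F1 t\<bar> \<le> C * C" using C by (intro mult_mono) auto
    then show ?thesis by (simp add: h_def)
  qed
  have h_at: "laplace_at h 1" by (rule laplace_at_exp_bounded[OF h_cont h_bd]) auto
  have abs_cont: "continuous_on {0..} (\<lambda>t. \<bar>F1 t\<bar>)"
    using F1_cont by (intro continuous_intros)
  have abs_at: "laplace_at (\<lambda>t. \<bar>F1 t\<bar>) 1"
    by (rule laplace_at_exp_bounded[OF abs_cont, of C "-1"]) (use F1_bd in auto)
  have approx: "laplace h 1 \<le> e * laplace (\<lambda>t. \<bar>F1 t\<bar>) 1" if e: "0 < e" for e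
  proof -
    obtain Q where "real_polynomial_function Q" and Q: "\<And>y. y \<in> {0..1} \<Longrightarrow> \<bar>G y - Q y\<bar> < e"
      using Stone_Weierstrass_real_polynomial_function[OF compact_Icc G_cont e] by metis
    then obtain a n where Q_eq: "Q = (\<lambda>y. \<Sum>i\<le>n. a i * y ^ i)"
      unfolding real_polynomial_function_iff_sum by auto
    \<comment> \<open>A polynomial in \<open>exp (- t)\<close> times \<open>F1\<close>: its
      transform at 1 combines transforms of \<open>F1\<close> at positive integers and is therefore
      0.\<close>
    define R where "R t = (\<Sum>i\<le>n. a i * (exp (- real i * t) * F1 t))" for t
    have R_eq: "R t = Q (exp (- t)) * F1 t" for t
      by (simp add: R_def Q_eq sum_distrib_right exp_of_nat_mult[symmetric] mult.assoc)
    have tm: "laplace_at (\<lambda>t. exp (- real i * t) * F1 t) 1" "laplace (\<lambda>t. exp (- real i * t) * F1 t) 1 = 0" for i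
      using F1_at[of "1 + real i"] F1_zero[of "Suc i"] unfolding laplace_exp_mult by simp_all
    have R: "laplace_at R 1 \<and> laplace R 1 = 0"
    proof -
      have "laplace_at (\<lambda>t. \<Sum>i\<le>m. a i * (exp (- real i * t) * F1 t)) 1 \<and>
          laplace (\<lambda>t. \<Sum>i\<le>m. a i * (exp (- real i * t) * F1 t)) 1 = 0" for m
      proof (induction m)
        case 0
        show ?case using laplace_cmult[OF tm(1)[of 0], of "a 0"] tm(2)[of 0] by simp
      next
        case (Suc m)
        show ?case
          using laplace_add[OF conjunct1[OF Suc] laplace_cmult(1)[OF tm(1)[of "Suc m"], of "a (Suc m)"]]
            conjunct2[OF Suc] laplace_cmult(2)[OF tm(1)[of "Suc m"], of "a (Suc m)"] tm(2)[of "Suc m"]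
          by (simp del: of_nat_Suc)
      qed
      then show ?thesis by (simp add: R_def[abs_def])
    qed
    have "laplace h 1 = laplace (\<lambda>t. h t - R t) 1"
      using laplace_diff(2)[OF h_at conjunct1[OF R]] R by simp
    also have "\<dots> \<le> laplace (\<lambda>t. e * \<bar>F1 t\<bar>) 1"
      unfolding laplace_def
    proof (rule set_integral_mono)
      show "set_integrable lborel {0..} (\<lambda>t. exp (- 1 * t) * (h t - R t))"
        using laplace_diff(1)[OF h_at conjunct1[OF R]] by (simp add: laplace_at_def)
      show "set_integrable lborel {0..} (\<lambda>t. exp (- 1 * t) * (e * \<bar>F1 t\<bar>))"
        using laplace_cmult(1)[OF abs_at, of e] by (simp add: laplace_at_def)
      fix t :: real assume "t \<in> {0..}"
      then have "\<bar>G (exp (- t)) - Q (exp (- t))\<bar> \<le> e" by (intro less_imp_le Q) auto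
      then have "\<bar>F1 t - Q (exp (- t))\<bar> * \<bar>F1 t\<bar> \<le> e * \<bar>F1 t\<bar>"
        unfolding G by (intro mult_right_mono) auto
      then have "\<bar>h t - R t\<bar> \<le> e * \<bar>F1 t\<bar>"
        by (simp add: h_def R_eq abs_mult[symmetric] left_diff_distrib)
      then show "exp (- 1 * t) * (h t - R t) \<le> exp (- 1 * t) * (e * \<bar>F1 t\<bar>)"
        by (intro mult_left_mono) auto
    qed
    also have "\<dots> = e * laplace (\<lambda>t. \<bar>F1 t\<bar>) 1" by (rule laplace_cmult(2)[OF abs_at])
    finally show ?thesis .
  qed
  have "laplace h 1 \<le> 0"
  proof (rule field_le_epsilon)
    fix e :: real assume e: "0 < e"
    define L where "L = laplace (\<lambda>t. \<bar>F1 t\<bar>) 1"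
    have "0 \<le> L" unfolding L_def laplace_def set_lebesgue_integral_def by (rule integral_nonneg_AE) auto
    have "laplace h 1 \<le> e / (L + 1) * L" using approx[of "e / (L + 1)"] e \<open>0 \<le> L\<close> by (simp add: L_def)
    also have "\<dots> \<le> e" using e \<open>0 \<le> L\<close> by (simp add: field_simps)
    finally show "laplace h 1 \<le> 0 + e" by simp
  qed
  moreover have "0 \<le> laplace h 1"
    unfolding laplace_def set_lebesgue_integral_def h_def by (rule integral_nonneg_AE) auto
  ultimately have "laplace h 1 = 0" by simp
  then have "AE t in lborel. indicator {0..} t * (exp (- t) * h t) = 0"
    using h_at unfolding laplace_def laplace_at_def set_integrable_def set_lebesgue_integral_def
    by (subst (asm) integral_nonneg_eq_0_iff_AE) (auto simp: h_def)
  then have "AE t in lborel. t \<in> {0<..} \<longrightarrow> h t = 0"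
    by eventually_elim (auto simp: indicator_def)
  then have "h t = 0"
    by (intro continuous_AE_eq_imp_eq[of "{0<..}" h "\<lambda>t. 0"] continuous_on_subset[OF h_cont]) (use t in auto)
  then show ?thesis by (simp add: h_def F1_def)
qed

lemma half_conv_integrable:
  fixes u k :: "real \<Rightarrow> real"
  assumes u: "continuous_on {0..} u" and k: "set_integrable lborel {0..t} k"
  shows "set_integrable lborel {0..t} (\<lambda>r. u (t - r) * k r)"
proof -
  have cont: "continuous_on {0..t} (\<lambda>r. u (t - r))"
    by (rule continuous_on_compose2[OF u]) (intro continuous_intros, auto)
  then have "bounded ((\<lambda>r. u (t - r)) ` {0..t})"
    by (intro compact_imp_bounded compact_continuous_image compact_Icc)
  then obtain V where V: "\<And>r. 0 \<le> r \<Longrightarrow> r \<le> t \<Longrightarrow> \<bar>u (t - r)\<bar> \<le> V"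
    unfolding bounded_iff by (metis atLeastAtMost_iff imageI real_norm_def)
  show ?thesis
  proof (rule set_integrable_bound)
    show "set_integrable lborel {0..t} (\<lambda>r. V * k r)" using k by simp
    have "(\<lambda>r. (indicator {0..t} r *\<^sub>R u (t - r)) * (indicator {0..t} r *\<^sub>R k r)) \<in> borel_measurable lborel"
      using borel_measurable_continuous_on_indicator[OF _ cont]
        borel_measurable_integrable[OF k[unfolded set_integrable_def]]
      by (intro borel_measurable_times) auto
    also have "(\<lambda>r. (indicator {0..t} r *\<^sub>R u (t - r)) * (indicator {0..t} r *\<^sub>R k r))
        = (\<lambda>r. indicator {0..t} r *\<^sub>R (u (t - r) * k r))"
      by (auto simp: indicator_def)
    finally show "set_borel_measurable lborel {0..t} (\<lambda>r. u (t - r) * k r)"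
      by (simp add: set_borel_measurable_def)
    show "AE r in lborel. r \<in> {0..t} \<longrightarrow> norm (u (t - r) * k r) \<le> norm (V * k r)"
      using V by (auto simp: abs_mult intro!: mult_right_mono order_trans[OF V abs_ge_self])
  qed
qed

text \<open>Dominated convergence; the kernel is only locally integrable and may be unbounded at 0.
  The point \<open>s = r\<close>, at which the indicators of the moving intervals need not converge,
  is null.\<close>

lemma continuous_on_half_conv:
  assumes u: "continuous_on {0..} u" and k: "\<And>T. set_integrable lborel {0..T} k"
  shows "continuous_on {0..} (half_conv u k)"
proof (rule continuous_on_sequentiallyI)
  fix \<rho> :: "nat \<Rightarrow> real" and r assume \<rho>: "\<forall>n. \<rho> n \<in> {0..}" and r: "r \<in> {0..}"
    and lim: "\<rho> \<longlonglongrightarrow> r"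
  obtain T where T: "\<And>n. \<rho> n \<le> T"
    using convergent_imp_bounded[OF lim] unfolding bounded_iff by (auto simp: abs_le_iff)
  have rT: "r \<le> T" by (rule LIMSEQ_le_const2[OF lim]) (use T in auto)
  define w where "w x = u (max 0 x)" for x
  have w: "continuous_on UNIV w" unfolding w_def
    by (rule continuous_on_compose2[OF u]) (auto intro!: continuous_intros)
  have [measurable]: "w \<in> borel_measurable borel"
    by (rule borel_measurable_continuous_onI[OF w])
  define k0 where "k0 s = indicator {0..T} s * k s" for s
  have k0: "integrable lborel k0" using k[of T] by (simp add: k0_def[abs_def] set_integrable_def)
  then have [measurable]: "k0 \<in> borel_measurable borel" by auto
  obtain B where B: "\<And>x. x \<in> {0..T} \<Longrightarrow> \<bar>w x\<bar> \<le> B"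
  proof -
    have "bounded (w ` {0..T})"
      by (intro compact_imp_bounded compact_continuous_image continuous_on_subset[OF w]) auto
    then obtain a where "\<forall>x\<in>{0..T}. \<bar>w x\<bar> \<le> a" unfolding bounded_iff by auto
    then show thesis by (intro that[of a]) simp
  qed
  have eq: "half_conv u k x = (\<integral>s. indicator {..x} s * (w (x - s) * k0 s) \<partial>lborel)" if "0 \<le> x" "x \<le> T" for x
    unfolding half_conv_def set_lebesgue_integral_def
    by (rule Bochner_Integration.integral_cong) (use that in \<open>auto simp: indicator_def w_def k0_def\<close>)
  have "(\<lambda>n. \<integral>s. indicator {..\<rho> n} s * (w (\<rho> n - s) * k0 s) \<partial>lborel)
      \<longlonglongrightarrow> (\<integral>s. indicator {..r} s * (w (r - s) * k0 s) \<partial>lborel)"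
  proof (rule integral_dominated_convergence[where w="\<lambda>s. B * \<bar>k0 s\<bar>"])
    show "integrable lborel (\<lambda>s. B * \<bar>k0 s\<bar>)" using k0 by simp
    show "AE s in lborel. (\<lambda>n. indicator {..\<rho> n} s * (w (\<rho> n - s) * k0 s))
        \<longlonglongrightarrow> indicator {..r} s * (w (r - s) * k0 s)"
      using AE_lborel_singleton[of r]
    proof eventually_elim
      case (elim s)
      have "isCont w (r - s)" using w by (simp add: continuous_on_eq_continuous_at)
      then have "(\<lambda>n. w (\<rho> n - s)) \<longlonglongrightarrow> w (r - s)"
        by (rule isCont_tendsto_compose) (intro tendsto_intros lim)
      moreover have "eventually (\<lambda>n. indicator {..\<rho> n} s = (indicator {..r} s :: real)) sequentially"
      proof (cases "s < r")
        case True
        show ?thesis using order_tendstoD(1)[OF lim True] by eventually_elim (use True in auto)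
      next
        case False
        then have "r < s" using elim by simp
        show ?thesis using order_tendstoD(2)[OF lim \<open>r < s\<close>] by eventually_elim (use \<open>r < s\<close> in auto)
      qed
      ultimately show ?case by (intro tendsto_mult tendsto_const) (auto intro: tendsto_eventually)
    qed
    show "AE s in lborel. norm (indicator {..\<rho> n} s * (w (\<rho> n - s) * k0 s)) \<le> B * \<bar>k0 s\<bar>" for n
    proof (intro AE_I2)
      fix s
      show "norm (indicator {..\<rho> n} s * (w (\<rho> n - s) * k0 s)) \<le> B * \<bar>k0 s\<bar>"
      proof (cases "s \<in> {0..\<rho> n}")
        case True
        then show ?thesis using B[of "\<rho> n - s"] T[of n] by (simp add: abs_mult mult_right_mono)
      next
        case False
        have "0 \<le> B" using B[of 0] r rT by force
        then show ?thesis using False by (auto simp: indicator_def k0_def)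
      qed
    qed
  qed measurable
  then show "(\<lambda>n. half_conv u k (\<rho> n)) \<longlonglongrightarrow> half_conv u k r"
    using \<rho> r T rT by (simp add: eq)
qed

lemma laplace_at_imp_locally_integrable:
  assumes "laplace_at k s"
  shows "set_integrable lborel {0..T} k"
proof -
  have *: "integrable lborel (\<lambda>t. indicator {0..} t * (exp (- s * t) * k t))"
    using assms by (simp add: laplace_at_def set_integrable_def)
  have [measurable]: "(\<lambda>t. indicator {0..} t * (exp (- s * t) * k t)) \<in> borel_measurable borel"
    using borel_measurable_integrable[OF *] by simp
  have eq: "indicator {0..T} t * k t
      = (indicator {0..T} t * exp (s * t)) * (indicator {0..} t * (exp (- s * t) * k t))" for t
    by (simp add: indicator_def exp_minus)
  have "integrable lborel (\<lambda>t. (indicator {0..T} t * exp (s * t)) * (indicator {0..} t * (exp (- s * t) * k t)))"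
  proof (rule Bochner_Integration.integrable_bound)
    show "integrable lborel (\<lambda>t. exp (\<bar>s\<bar> * \<bar>T\<bar>) * (indicator {0..} t * (exp (- s * t) * k t)))"
      using * by simp
    have "s * t \<le> \<bar>s\<bar> * \<bar>T\<bar>" if "0 \<le> t" "t \<le> T" for t
    proof -
      have "s * t \<le> \<bar>s\<bar> * t" using that by (intro mult_right_mono) auto
      also have "\<dots> \<le> \<bar>s\<bar> * \<bar>T\<bar>" using that by (intro mult_left_mono) auto
      finally show ?thesis .
    qed
    then have "indicator {0..T} t * exp (s * t) \<le> exp (\<bar>s\<bar> * \<bar>T\<bar>)" for t
      by (auto simp: indicator_def)
    then show "AE t in lborel. norm ((indicator {0..T} t * exp (s * t)) * (indicator {0..} t * (exp (- s * t) * k t)))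
        \<le> norm (exp (\<bar>s\<bar> * \<bar>T\<bar>) * (indicator {0..} t * (exp (- s * t) * k t)))"
      by (intro AE_I2) (simp only: norm_mult, intro mult_right_mono, auto)
  qed measurable
  then show ?thesis by (simp only: eq set_integrable_def real_scaleR_def)
qed

text \<open>The kernel need be integrable only after damping by \<open>exp (- s * r)\<close>; on
  \<open>{0..t}\<close> the factor \<open>exp (s * t)\<close> compensates the damping. With
  \<open>s = 0\<close> this is the usual norm bound of a convolution, with \<open>s > 0\<close> it
  shows exponential growth.\<close>

lemma abs_half_conv_le:
  assumes k: "laplace_at k s" and s: "0 \<le> s" and u: "\<And>r. 0 \<le> r \<Longrightarrow> r \<le> t \<Longrightarrow> \<bar>u r\<bar> \<le> B" and t: "0 \<le> t"
  shows "\<bar>half_conv u k t\<bar> \<le> B * exp (s * t) * laplace (\<lambda>r. \<bar>k r\<bar>) s"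
proof -
  have B: "0 \<le> B" using u[of 0] t by force
  have k': "integrable lborel (\<lambda>r. indicator {0..} r * (exp (- s * r) * \<bar>k r\<bar>))"
    using integrable_abs[OF k[unfolded laplace_at_def set_integrable_def]] by (simp add: abs_mult)
  have "\<bar>half_conv u k t\<bar> \<le> (\<integral>r. norm (indicator {0..t} r * (u (t - r) * k r)) \<partial>lborel)"
    unfolding half_conv_def set_lebesgue_integral_def real_scaleR_def real_norm_def[symmetric]
    by (rule integral_norm_bound)
  also have "\<dots> \<le> (\<integral>r. B * exp (s * t) * (indicator {0..} r * (exp (- s * r) * \<bar>k r\<bar>)) \<partial>lborel)"
  proof (rule integral_mono')
    show "integrable lborel (\<lambda>r. B * exp (s * t) * (indicator {0..} r * (exp (- s * r) * \<bar>k r\<bar>)))"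
      using k' by simp
    fix r
    show "norm (indicator {0..t} r * (u (t - r) * k r)) \<le> B * exp (s * t) * (indicator {0..} r * (exp (- s * r) * \<bar>k r\<bar>))"
    proof (cases "r \<in> {0..t}")
      case True
      have "1 \<le> exp (s * t) * exp (- s * r)"
        using True s by (simp add: exp_add[symmetric] mult_left_mono)
      then have "\<bar>u (t - r)\<bar> * 1 \<le> B * (exp (s * t) * exp (- s * r))"
        using True u[of "t - r"] B by (intro mult_mono) auto
      then have "\<bar>u (t - r)\<bar> * \<bar>k r\<bar> \<le> B * (exp (s * t) * exp (- s * r)) * \<bar>k r\<bar>"
        by (intro mult_right_mono) auto
      then show ?thesis using True by (simp add: abs_mult mult.assoc)
    qed (use B in \<open>auto simp: indicator_def\<close>)
  qed (use B in auto)
  also have "\<dots> = B * exp (s * t) * laplace (\<lambda>r. \<bar>k r\<bar>) s"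
    by (simp add: laplace_def set_lebesgue_integral_def)
  finally show ?thesis .
qed

section \<open>Solution of a Volterra equation of convolution type\<close>

lemma laplace_tendsto_0:
  assumes k: "laplace_at k s0"
  shows "(\<lambda>n. laplace k (s0 + real n)) \<longlonglongrightarrow> 0"
proof -
  have *: "integrable lborel (\<lambda>t. indicator {0..} t * (exp (- s0 * t) * k t))"
    using k by (simp add: laplace_at_def set_integrable_def)
  have [measurable]: "(\<lambda>t. indicator {0..} t * (exp (- s0 * t) * k t)) \<in> borel_measurable borel"
    using borel_measurable_integrable[OF *] by simp
  have "laplace k (s0 + real n) = (\<integral>t. exp (- t) ^ n * (indicator {0..} t * (exp (- s0 * t) * k t)) \<partial>lborel)" for n
    unfolding laplace_def set_lebesgue_integral_def
  proof (rule Bochner_Integration.integral_cong[OF refl])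
    fix t
    have "exp (- t) ^ n = exp (- real n * t)" by (simp add: exp_of_nat_mult[symmetric])
    then show "indicator {0..} t *\<^sub>R (exp (- (s0 + real n) * t) * k t)
        = exp (- t) ^ n * (indicator {0..} t * (exp (- s0 * t) * k t))"
      using exp_mult_exp_mult[of "real n" t s0 "k t"] by (auto simp: indicator_def add.commute)
  qed
  moreover have "(\<lambda>n. \<integral>t. exp (- t) ^ n * (indicator {0..} t * (exp (- s0 * t) * k t)) \<partial>lborel) \<longlonglongrightarrow> (\<integral>t. 0 \<partial>(lborel :: real measure))"
  proof (rule integral_dominated_convergence)
    show "integrable lborel (\<lambda>t. \<bar>indicator {0..} t * (exp (- s0 * t) * k t)\<bar>)" using * by (rule integrable_abs)
    show "AE t in lborel. (\<lambda>n. exp (- t) ^ n * (indicator {0..} t * (exp (- s0 * t) * k t))) \<longlonglongrightarrow> 0"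
      using AE_lborel_singleton[of 0]
    proof eventually_elim
      case (elim t)
      show ?case
      proof (cases "0 < t")
        case True
        then show ?thesis by (intro tendsto_mult_left_zero LIMSEQ_power_zero) simp
      qed (use elim in \<open>simp add: indicator_def\<close>)
    qed
    show "AE t in lborel. norm (exp (- t) ^ n * (indicator {0..} t * (exp (- s0 * t) * k t)))
        \<le> \<bar>indicator {0..} t * (exp (- s0 * t) * k t)\<bar>" for n
      by (intro AE_I2) (auto simp: abs_mult indicator_def intro!: mult_left_le_one_le power_le_one)
  qed measurable
  ultimately show ?thesis by simp
qed

text \<open>Multiplying the equation by \<open>exp (- c * t)\<close> replaces \<open>k\<close> by a
  kernel whose absolute integral tends to 0 for growing \<open>c\<close>. Once it is below
  \<open>b\<close>, the equation is a fixed-point problem for a contraction of the bounded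
  continuous functions; undoing the tilt gives a solution of exponential growth.\<close>

lemma volterra_solution:
  assumes b: "0 < b" and k: "laplace_at k s0" and s0: "0 \<le> s0"
    and g: "continuous_on {0..} g" and g_bd: "\<And>t. 0 \<le> t \<Longrightarrow> \<bar>g t\<bar> \<le> B"
  obtains w C c where "continuous_on {0..} w" "\<And>t. 0 \<le> t \<Longrightarrow> \<bar>w t\<bar> \<le> C * exp (c * t)"
    "\<And>t. 0 \<le> t \<Longrightarrow> b * w t + half_conv w k t = g t"
proof -
  have k_abs: "laplace_at (\<lambda>r. \<bar>k r\<bar>) s0"
    using integrable_abs[OF k[unfolded laplace_at_def set_integrable_def]]
    by (simp add: laplace_at_def set_integrable_def abs_mult)
  have "eventually (\<lambda>n. laplace (\<lambda>r. \<bar>k r\<bar>) (s0 + real n) < b / 2) sequentially"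
    using laplace_tendsto_0[OF k_abs] b by (intro order_tendstoD) auto
  then obtain n where n: "laplace (\<lambda>r. \<bar>k r\<bar>) (s0 + real n) < b / 2"
    by (auto simp: eventually_sequentially)
  define c where "c = s0 + real n"
  define K where "K r = exp (- c * r) * k r" for r
  have K: "laplace_at K 0"
  proof -
    have "laplace_at (\<lambda>r. exp (- real n * r) * k r) s0"
      unfolding laplace_at_def
    proof (rule set_integrable_bound)
      show "set_integrable lborel {0..} (\<lambda>t. exp (- s0 * t) * k t)" using k by (simp add: laplace_at_def)
      have [measurable]: "(\<lambda>t. indicator {0..} t * (exp (- s0 * t) * k t)) \<in> borel_measurable borel"
        using borel_measurable_integrable[OF k[unfolded laplace_at_def set_integrable_def]] by simp
      have "(\<lambda>t. exp (- real n * t) * (indicator {0..} t * (exp (- s0 * t) * k t))) \<in> borel_measurable borel"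
        by measurable
      then show "set_borel_measurable lborel {0..} (\<lambda>t. exp (- s0 * t) * (exp (- real n * t) * k t))"
        by (simp add: set_borel_measurable_def mult_ac)
      show "AE t in lborel. t \<in> {0..} \<longrightarrow> norm (exp (- s0 * t) * (exp (- real n * t) * k t)) \<le> norm (exp (- s0 * t) * k t)"
        by (intro AE_I2 impI) (auto simp: abs_mult intro!: mult_left_le_one_le mult_left_mono)
    qed
    then show ?thesis unfolding K_def laplace_exp_mult c_def by simp
  qed
  have K_loc: "set_integrable lborel {0..T} K" for T by (rule laplace_at_imp_locally_integrable[OF K])
  have K_bd: "laplace (\<lambda>r. \<bar>K r\<bar>) 0 < b / 2"
    using n laplace_exp_mult(2)[of c "\<lambda>r. \<bar>k r\<bar>" 0] by (simp add: K_def abs_mult c_def)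
  define q where "q = laplace (\<lambda>r. \<bar>K r\<bar>) 0 / b"
  have q0: "0 \<le> laplace (\<lambda>r. \<bar>K r\<bar>) 0"
    unfolding laplace_def set_lebesgue_integral_def by (rule integral_nonneg_AE) auto
  have q: "0 \<le> q" "q < 1" using q0 K_bd b by (auto simp: q_def)
  have conv_bd: "\<bar>half_conv u K t\<bar> \<le> B * laplace (\<lambda>r. \<bar>K r\<bar>) 0"
    if "\<And>r. 0 \<le> r \<Longrightarrow> \<bar>u r\<bar> \<le> B" "0 \<le> t" for u B t
    using abs_half_conv_le[OF K order.refl, of t u B] that by simp
  define \<Phi> where "\<Phi> v t = (exp (- c * t) * g t - half_conv v K t) / b" for v t
  have \<Phi>_cont: "continuous_on {0..} (\<Phi> v)" if "continuous_on {0..} v" for v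
    unfolding \<Phi>_def using b
    by (intro continuous_on_divide continuous_on_diff continuous_on_mult g continuous_on_half_conv that K_loc)
       (auto intro!: continuous_intros)
  have c: "0 \<le> c" using s0 by (simp add: c_def)
  have \<Phi>_bd: "\<bar>\<Phi> v t\<bar> \<le> (B + V * laplace (\<lambda>r. \<bar>K r\<bar>) 0) / b"
    if "\<And>r. 0 \<le> r \<Longrightarrow> \<bar>v r\<bar> \<le> V" "0 \<le> t" for v V t
  proof -
    have "\<bar>exp (- c * t) * g t\<bar> \<le> B"
      using g_bd[OF that(2)] that c by (auto simp: abs_mult intro: order_trans[OF mult_left_le_one_le])
    then have "\<bar>exp (- c * t) * g t - half_conv v K t\<bar> \<le> B + V * laplace (\<lambda>r. \<bar>K r\<bar>) 0"
      using conv_bd[of v V t, OF that] by linarith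
    then show ?thesis unfolding \<Phi>_def using b by (simp add: divide_right_mono)
  qed
  \<comment> \<open>Elements of \<open>bcontfun\<close> are defined on the whole line, so negative
    times receive the value at time 0.\<close>
  define \<Psi> :: "(real \<Rightarrow>\<^sub>C real) \<Rightarrow> (real \<Rightarrow>\<^sub>C real)" where
    "\<Psi> v = Bcontfun (\<lambda>t. \<Phi> (apply_bcontfun v) (max 0 t))" for v
  have v_bd: "\<bar>apply_bcontfun v r\<bar> \<le> norm v" for v :: "real \<Rightarrow>\<^sub>C real" and r
    using norm_bounded[of v r] by simp
  have \<Psi>: "apply_bcontfun (\<Psi> v) t = \<Phi> (apply_bcontfun v) (max 0 t)" for v t
  proof -
    have "(\<lambda>t. \<Phi> (apply_bcontfun v) (max 0 t)) \<in> bcontfun"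
    proof (rule bcontfun_normI)
      show "continuous_on UNIV (\<lambda>t. \<Phi> (apply_bcontfun v) (max 0 t))"
        by (rule continuous_on_compose2[OF \<Phi>_cont]) (auto intro!: continuous_intros)
      show "norm (\<Phi> (apply_bcontfun v) (max 0 t)) \<le> (B + norm v * laplace (\<lambda>r. \<bar>K r\<bar>) 0) / b" for t
        using \<Phi>_bd[OF v_bd, of "max 0 t" v] by simp
    qed
    then show ?thesis by (simp add: \<Psi>_def Bcontfun_inverse)
  qed
  have half_conv_diff: "half_conv u K t - half_conv v K t = half_conv (\<lambda>r. u r - v r) K t"
    if u: "continuous_on {0..} u" and v: "continuous_on {0..} v" for u v t
  proof -
    have int: "set_integrable lborel {0..t} (\<lambda>r. u (t - r) * K r)" if u: "continuous_on {0..} u" for u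
      by (rule half_conv_integrable[OF u K_loc])
    show ?thesis
      unfolding half_conv_def using set_integral_diff(2)[OF int[OF u] int[OF v]]
      by (simp add: left_diff_distrib)
  qed
  have contraction: "dist (\<Psi> u) (\<Psi> v) \<le> q * dist u v" for u v
  proof (rule dist_bound)
    fix t :: real
    define t' where "t' = max 0 t"
    have "dist (apply_bcontfun (\<Psi> u) t) (apply_bcontfun (\<Psi> v) t)
        = \<bar>half_conv (apply_bcontfun v) K t' - half_conv (apply_bcontfun u) K t'\<bar> / b"
      using b by (simp add: \<Psi> dist_real_def \<Phi>_def diff_divide_distrib[symmetric] t'_def)
    also have "half_conv (apply_bcontfun v) K t' - half_conv (apply_bcontfun u) K t'
        = half_conv (\<lambda>r. apply_bcontfun v r - apply_bcontfun u r) K t'"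
      by (rule half_conv_diff) auto
    also have "\<bar>\<dots>\<bar> \<le> dist u v * laplace (\<lambda>r. \<bar>K r\<bar>) 0"
      using dist_bounded[of u _ v] by (intro conv_bd) (auto simp: t'_def dist_real_def abs_minus_commute)
    finally show "dist (apply_bcontfun (\<Psi> u) t) (apply_bcontfun (\<Psi> v) t) \<le> q * dist u v"
      using b by (simp add: q_def divide_right_mono mult.commute)
  qed
  obtain v where v: "\<Psi> v = v"
    using banach_fix_type[OF q, of \<Psi>] contraction by auto
  define w where "w t = exp (c * t) * apply_bcontfun v t" for t
  show thesis
  proof (rule that[of w "norm v" c])
    show "continuous_on {0..} w" unfolding w_def by (intro continuous_intros) auto
    show "\<bar>w t\<bar> \<le> norm v * exp (c * t)" if "0 \<le> t" for t
      using v_bd[of v t] by (simp add: w_def abs_mult)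
    fix t :: real assume t: "0 \<le> t"
    have "apply_bcontfun v t = \<Phi> (apply_bcontfun v) t"
      using \<Psi>[of v t] t unfolding v by simp
    then have "b * apply_bcontfun v t + half_conv (apply_bcontfun v) K t = exp (- c * t) * g t"
      using b by (simp add: \<Phi>_def field_simps)
    then have "exp (c * t) * (b * apply_bcontfun v t + half_conv (apply_bcontfun v) K t) = g t"
      by (simp add: exp_minus)
    moreover have "exp (c * t) * half_conv (apply_bcontfun v) K t = half_conv w k t"
      unfolding half_conv_def set_integral_mult_right[symmetric]
      by (rule set_lebesgue_integral_cong)
         (auto simp: w_def K_def exp_diff exp_minus right_diff_distrib divide_inverse)
    ultimately show "b * w t + half_conv w k t = g t" by (simp add: w_def distrib_left mult.left_commute)
  qed
qed

subsection \<open>The generalized Caputo derivative through Laplace transforms\<close>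

text \<open>Convolution with the constant 1 is integration from 0. In this form the transform of an
  antiderivative is an instance of \<open>laplace_half_conv\<close>.\<close>

lemma half_conv_one_has_derivative:
  assumes g: "continuous_on {0..} g" and t: "0 < t"
  shows "(half_conv g (\<lambda>_. 1) has_real_derivative g t) (at t)"
proof -
  have eq: "half_conv g (\<lambda>_. 1) r = integral {0..r} g" for r
  proof -
    have "half_conv g (\<lambda>_. 1) r = (\<integral>q. indicator {0..r} (r - q) * g (r - (r - q)) \<partial>lborel)"
      unfolding half_conv_def set_lebesgue_integral_def
      by (subst lborel_integral_real_affine[of "-1" _ r]) simp_all
    also have "\<dots> = (LBINT q:{0..r}. g q)"
      unfolding set_lebesgue_integral_def
      by (rule Bochner_Integration.integral_cong) (auto simp: indicator_def)
    also have "\<dots> = integral {0..r} g"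
      by (intro set_borel_integral_eq_integral borel_integrable_atLeastAtMost' continuous_on_subset[OF g]) auto
    finally show ?thesis .
  qed
  have "((\<lambda>r. integral {0..r} g) has_real_derivative g t) (at t within {0..t + 1})"
    using t by (intro integral_has_real_derivative continuous_on_subset[OF g]) auto
  then have "((\<lambda>r. integral {0..r} g) has_real_derivative g t) (at t)"
    using t by (simp add: at_within_Icc_at)
  then show ?thesis by (simp add: eq[abs_def])
qed

text \<open>Divided by \<open>s\<close>, premise \<open>L\<close> says that
  \<open>b * u + half_conv u k\<close>, with \<open>u = q - q 0\<close>, and the antiderivative of
  \<open>q1\<close> have the same transform, so they agree. For \<open>b = 0\<close> this is the
  claim in integrated form. For \<open>b > 0\<close> the derivative of \<open>q\<close> has to exist
  by itself: a candidate is obtained from a Volterra equation and then shown, again by transforms,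
  to have \<open>u\<close> as its antiderivative.\<close>

lemma caputo_deriv_by_laplace:
  assumes b: "0 \<le> b" and k: "\<And>s. 0 < s \<Longrightarrow> laplace_at k s" and k_nonneg: "\<And>r. 0 \<le> k r"
    and q: "continuous_on {0..} q" and q_bd: "\<And>t. 0 \<le> t \<Longrightarrow> \<bar>q t\<bar> \<le> B"
    and q1: "continuous_on {0..} q1" and q1_bd: "\<And>t. 0 \<le> t \<Longrightarrow> \<bar>q1 t\<bar> \<le> B1"
    and L: "\<And>s. 0 < s \<Longrightarrow> laplace q1 s = s * (b + laplace k s) * laplace (\<lambda>t. q t - q 0) s"
    and t: "0 < t"
  shows "caputo_differentiable b k q t" "caputo_deriv b k q t = q1 t"
proof -
  define u where "u t = q t - q 0" for t
  define m where "m = half_conv u k"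
  define I1 where "I1 = half_conv q1 (\<lambda>_. 1)"
  have mem: "memory_integral k q = m"
    by (simp add: memory_integral_eq_half_conv m_def u_def[abs_def])
  have k_loc: "set_integrable lborel {0..T} k" for T
    by (rule laplace_at_imp_locally_integrable[OF k[of 1]]) simp
  have one: "laplace_at (\<lambda>_. 1) s" "laplace (\<lambda>_. 1) s = 1 / s" if "0 < s" for s
    using laplace_const[OF that, of 1] by auto
  have one_loc: "set_integrable lborel {0..T} (\<lambda>_. 1::real)" for T :: real
    by (rule laplace_at_imp_locally_integrable[OF one(1)[of 1]]) simp
  have u: "continuous_on {0..} u" unfolding u_def by (intro continuous_intros q)
  have u_bd: "\<bar>u t\<bar> \<le> 2 * B" if "0 \<le> t" for t
    using q_bd[of t] q_bd[of 0] that by (auto simp: u_def)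
  have u_at: "laplace_at u s" if "0 < s" for s
    by (rule laplace_at_exp_bounded[OF u, of "2 * B" 0]) (use u_bd that in auto)
  have q1_at: "laplace_at q1 s" if "0 < s" for s
    by (rule laplace_at_exp_bounded[OF q1, of B1 0]) (use q1_bd that in auto)
  have exp_ge: "1 \<le> exp t" if "0 \<le> t" for t :: real using that by simp
  have B: "0 \<le> B" "0 \<le> B1" using q_bd[of 0] q1_bd[of 0] by auto
  have L': "laplace q1 s = s * (b + laplace k s) * laplace u s" if "0 < s" for s
    using L[OF that] by (simp add: u_def[abs_def])
  have F: "b * u t + m t - I1 t = 0" if t: "0 < t" for t
  proof (rule laplace_eq_0_imp_eq_0[where F="\<lambda>t. b * u t + m t - I1 t" and c'=0, OF _ _ _ t])
    show "continuous_on {0..} (\<lambda>t. b * u t + m t - I1 t)"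
      unfolding m_def I1_def
      by (intro continuous_on_add continuous_on_diff continuous_on_mult continuous_on_const u
          continuous_on_half_conv k_loc q1 one_loc)
    \<comment> \<open>Uniqueness tolerates any exponential growth, so damping the kernel at rate 1
      is good enough.\<close>
    define \<kappa> where "\<kappa> = laplace (\<lambda>r. \<bar>k r\<bar>) 1"
    show "\<bar>b * u t + m t - I1 t\<bar> \<le> (b * (2 * B) + 2 * B * \<kappa> + B1) * exp (1 * t)" if t: "0 \<le> t" for t
    proof -
      have "\<bar>b * u t\<bar> \<le> b * (2 * B) * exp t"
        using mult_mono[OF mult_left_mono[OF u_bd[OF t] b] exp_ge[OF t]] b B by (simp add: abs_mult)
      moreover have "\<bar>m t\<bar> \<le> 2 * B * exp (1 * t) * \<kappa>"
        unfolding m_def \<kappa>_def by (rule abs_half_conv_le) (use k u_bd t in auto)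
      moreover have "\<bar>I1 t\<bar> \<le> B1 * exp (1 * t) * laplace (\<lambda>r. \<bar>1\<bar>) 1"
        unfolding I1_def by (rule abs_half_conv_le) (use one q1_bd t in auto)
      ultimately show ?thesis using one(2)[of 1] by (simp add: algebra_simps)
    qed
    fix s :: real assume s: "0 < s"
    have "laplace (\<lambda>t. b * u t + m t - I1 t) s = b * laplace u s + laplace u s * laplace k s - laplace q1 s * (1 / s)"
      unfolding m_def I1_def using s
      by (simp add: laplace_diff laplace_add laplace_cmult laplace_half_conv u_at k q1_at one)
    also have "\<dots> = 0" using s by (simp add: L' field_simps)
    finally show "laplace (\<lambda>t. b * u t + m t - I1 t) s = 0" .
  qed
  have I1: "(I1 has_real_derivative q1 t) (at t)"
    unfolding I1_def by (rule half_conv_one_has_derivative[OF q1 t])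
  have int: "\<forall>r>0. set_integrable lborel {0..r} (\<lambda>s. (q (r - s) - q 0) * k s)"
    using half_conv_integrable[OF u k_loc] by (simp add: u_def)
  have "caputo_differentiable b k q t \<and> caputo_deriv b k q t = q1 t"
  proof (cases "b = 0")
    case True
    have "(m has_real_derivative q1 t) (at t)"
      by (rule has_field_derivative_transform_within_open[OF I1, of "{0<..}"]) (use F t True in auto)
    then show ?thesis using True int
      by (auto simp: caputo_differentiable_def caputo_deriv_def mem DERIV_imp_deriv real_differentiable_def)
  next
    case False
    then have b: "0 < b" using b by simp
    \<comment> \<open>Formally differentiating \<open>b * u + half_conv u k\<close> gives this
      equation for the derivative of \<open>u\<close>, as \<open>u\<close> starts at 0; its solution
      is the candidate.\<close>
    obtain w C c where w: "continuous_on {0..} w" "\<And>t. 0 \<le> t \<Longrightarrow> \<bar>w t\<bar> \<le> C * exp (c * t)"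
      "\<And>t. 0 \<le> t \<Longrightarrow> b * w t + half_conv w k t = q1 t"
      using volterra_solution[OF b k[of 1] _ q1 q1_bd] by auto
    define d where "d = max c 0"
    have C: "0 \<le> C" using w(2)[of 0] by (simp add: order_trans[OF abs_ge_zero])
    have w_bd: "\<bar>w r\<bar> \<le> C * exp (d * t)" if "0 \<le> r" "r \<le> t" for r t
    proof -
      have "c * r \<le> d * t"
        using that by (intro mult_mono) (auto simp: d_def)
      then have "C * exp (c * r) \<le> C * exp (d * t)" using C by (intro mult_left_mono) auto
      then show ?thesis using w(2)[of r] that by simp
    qed
    have w_at: "laplace_at w s" if "d < s" for s
      by (rule laplace_at_exp_bounded[OF w(1), of C d]) (use w_bd that in auto)
    \<comment> \<open>Here \<open>b > 0\<close> and the nonnegativity of \<open>k\<close> enter: the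
      factor \<open>b + laplace k s\<close> is positive and can be cancelled.\<close>
    have w_lap: "laplace w s = s * laplace u s" if s: "d < s" for s
    proof -
      have s0: "0 < s" using s by (simp add: d_def)
      have "0 \<le> laplace k s"
        unfolding laplace_def set_lebesgue_integral_def by (rule integral_nonneg_AE) (auto simp: k_nonneg)
      then have "0 < b + laplace k s" using b by simp
      moreover have "(b + laplace k s) * laplace w s = laplace (\<lambda>t. b * w t + half_conv w k t) s"
        using s s0 by (simp add: laplace_add laplace_cmult laplace_half_conv w_at k algebra_simps)
      moreover have "\<dots> = laplace q1 s" using w(3) by (rule laplace_cong)
      ultimately have "(b + laplace k s) * laplace w s = (b + laplace k s) * (s * laplace u s)"
        by (simp add: L'[OF s0])
      then show ?thesis using \<open>0 < b + laplace k s\<close> by simp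
    qed
    have F2: "half_conv w (\<lambda>_. 1) t - u t = 0" if t: "0 < t" for t
    proof (rule laplace_eq_0_imp_eq_0[where F="\<lambda>t. half_conv w (\<lambda>_. 1) t - u t" and c'=d, OF _ _ _ t])
      show "continuous_on {0..} (\<lambda>t. half_conv w (\<lambda>_. 1) t - u t)"
        by (intro continuous_on_diff continuous_on_half_conv w u one_loc)
      show "\<bar>half_conv w (\<lambda>_. 1) t - u t\<bar> \<le> (C + 2 * B) * exp ((d + 1) * t)" if t: "0 \<le> t" for t
      proof -
        have "\<bar>half_conv w (\<lambda>_. 1) t\<bar> \<le> C * exp (d * t) * exp (1 * t) * laplace (\<lambda>r. \<bar>1\<bar>) 1"
          by (rule abs_half_conv_le) (use one w_bd t in auto)
        also have "\<dots> = C * exp ((d + 1) * t)"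
          using one(2)[of 1] by (simp add: exp_add distrib_right)
        finally have 1: "\<bar>half_conv w (\<lambda>_. 1) t\<bar> \<le> C * exp ((d + 1) * t)" .
        have "0 \<le> (d + 1) * t" using t by (simp add: d_def)
        then have "2 * B * 1 \<le> 2 * B * exp ((d + 1) * t)" using B by (intro mult_left_mono exp_ge) auto
        then have "\<bar>u t\<bar> \<le> 2 * B * exp ((d + 1) * t)" using u_bd[OF t] by simp
        then show ?thesis using 1 by (simp add: distrib_right)
      qed
      fix s assume s: "d < s"
      then have s0: "0 < s" by (simp add: d_def)
      show "laplace (\<lambda>t. half_conv w (\<lambda>_. 1) t - u t) s = 0"
        using s s0 by (simp add: laplace_diff laplace_half_conv w_at one u_at w_lap)
    qed
    have u': "(u has_real_derivative w t) (at t)"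
      by (rule has_field_derivative_transform_within_open[OF half_conv_one_has_derivative[OF w(1) t], of "{0<..}"])
         (use F2 t in auto)
    then have "((\<lambda>t. u t + q 0) has_real_derivative w t) (at t)"
      by (auto intro!: derivative_eq_intros)
    then have q': "(q has_real_derivative w t) (at t)" by (simp add: u_def)
    \<comment> \<open>The convolution is not differentiated directly: it equals
      \<open>I1 - b * u\<close>, and both parts are differentiable by now.\<close>
    have m': "(m has_real_derivative (q1 t - b * w t)) (at t)"
    proof (rule has_field_derivative_transform_within_open[of "\<lambda>t. I1 t - b * u t" _ _ "{0<..}"])
      show "((\<lambda>t. I1 t - b * u t) has_real_derivative (q1 t - b * w t)) (at t)"
        by (intro DERIV_diff I1 DERIV_cmult u')
      show "I1 r - b * u r = m r" if "r \<in> {0<..}" for r using F[of r] that by simp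
    qed (use t in auto)
    show ?thesis using int DERIV_imp_deriv[OF q'] DERIV_imp_deriv[OF m'] q' m'
      by (auto simp: caputo_differentiable_def caputo_deriv_def mem real_differentiable_def)
  qed
  then show "caputo_differentiable b k q t" "caputo_deriv b k q t = q1 t" by auto
qed

subsection \<open>The tail of the Levy measure\<close>

context
  fixes \<nu> :: "real measure"
  assumes levy: "subordinator_levy_measure \<nu>"
begin

lemma levy_sets: "sets \<nu> = sets borel"
  using levy by (simp add: subordinator_levy_measure_def)

lemma levy_space [simp]: "space \<nu> = UNIV"
  using sets_eq_imp_space_eq[OF levy_sets] by simp

lemma levy_emeasure_tail_finite:
  assumes "0 < s"
  shows "emeasure \<nu> {s<..} < \<infinity>"
proof -
  note [measurable_cong] = levy_sets
  have "ennreal (min s 1) * emeasure \<nu> {s<..} = (\<integral>\<^sup>+x. ennreal (min s 1) * indicator {s<..} x \<partial>\<nu>)"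
    by (subst nn_integral_cmult_indicator) auto
  also have "\<dots> \<le> (\<integral>\<^sup>+x. ennreal (min x 1) \<partial>\<nu>)"
    by (intro nn_integral_mono) (auto simp: indicator_def intro!: ennreal_leI)
  also have "\<dots> < \<infinity>" using levy by (simp add: subordinator_levy_measure_def)
  finally show ?thesis
    using assms by (auto simp: ennreal_mult_less_top min_def split: if_splits)
qed

text \<open>The tails \<open>{1 / (n + 1)<..}\<close> have finite mass and \<open>{..0}\<close> is
  null. This licenses the exchange of integrals for the tail.\<close>

lemma levy_sigma_finite: "sigma_finite_measure \<nu>"
proof (rule sigma_finite_measure.intro, intro exI conjI)
  note [measurable_cong] = levy_sets
  let ?A = "insert {..0} (range (\<lambda>n. {1 / real (Suc n)<..}))"
  show "countable ?A" "?A \<subseteq> sets \<nu>" by auto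
  have "x \<in> \<Union> ?A" for x
  proof (cases "x \<le> 0")
    case False
    then obtain n where "inverse (real (Suc n)) < x" using reals_Archimedean[of x] by auto
    then show ?thesis by (auto simp: inverse_eq_divide)
  qed auto
  then show "\<Union> ?A = space \<nu>" by auto
  show "\<forall>a\<in>?A. emeasure \<nu> a \<noteq> \<infinity>"
    using levy levy_emeasure_tail_finite[of "1 / real (Suc _)"]
    by (auto simp: subordinator_levy_measure_def less_top[symmetric])
qed

lemma levy_integrable:
  assumes "0 < s"
  shows "set_integrable \<nu> {0<..} (\<lambda>x. 1 - exp (- s * x))"
proof -
  note [measurable_cong] = levy_sets
  show ?thesis
    unfolding set_integrable_def
  proof (rule integrableI_bounded)
    have "(\<integral>\<^sup>+x. ennreal (norm (indicator {0<..} x *\<^sub>R (1 - exp (- s * x)))) \<partial>\<nu>)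
        \<le> (\<integral>\<^sup>+x. ennreal (max 1 s) * ennreal (min x 1) \<partial>\<nu>)"
    proof (intro nn_integral_mono)
      fix x :: real
      have "1 - exp (- s * x) \<le> max 1 s * min x 1" if "0 < x"
      proof (cases "x \<le> 1")
        case True
        have "1 - exp (- s * x) \<le> s * x" using exp_ge_add_one_self[of "- s * x"] by simp
        also have "\<dots> \<le> max 1 s * x" using that by (intro mult_right_mono) auto
        finally show ?thesis using True by simp
      next
        case False
        have "1 - exp (- s * x) \<le> 1" by simp
        also have "1 \<le> max 1 s * min x 1" using False by simp
        finally show ?thesis .
      qed
      moreover have "0 \<le> 1 - exp (- s * x)" if "0 < x" using that assms by simp
      ultimately show "ennreal (norm (indicator {0<..} x *\<^sub>R (1 - exp (- s * x)))) \<le> ennreal (max 1 s) * ennreal (min x 1)"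
        by (auto simp: indicator_def ennreal_mult'[symmetric] intro!: ennreal_leI)
    qed
    also have "\<dots> = ennreal (max 1 s) * (\<integral>\<^sup>+x. ennreal (min x 1) \<partial>\<nu>)"
      by (rule nn_integral_cmult) measurable
    also have "\<dots> < \<infinity>"
      using levy by (simp add: subordinator_levy_measure_def ennreal_mult_less_top)
    finally show "(\<integral>\<^sup>+x. ennreal (norm (indicator {0<..} x *\<^sub>R (1 - exp (- s * x)))) \<partial>\<nu>) < \<infinity>" .
  qed measurable
qed

lemma levy_tail_nonneg: "0 \<le> levy_tail \<nu> s"
  by (simp add: levy_tail_def)

text \<open>Tonelli on the region \<open>0 < t < x\<close>: integrating \<open>exp (- s * t)\<close>
  over \<open>t\<close> first gives \<open>(1 - exp (- s * x)) / s\<close>, integrating over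
  \<open>x\<close> first produces the tail.\<close>

lemma levy_tail_laplace:
  assumes s: "0 < s"
  shows "laplace_at (levy_tail \<nu>) s" "s * (b + laplace (levy_tail \<nu>) s) = bernstein_fun b \<nu> s"
proof -
  note [measurable_cong] = levy_sets
  interpret \<nu>: sigma_finite_measure \<nu> by (rule levy_sigma_finite)
  interpret pair_sigma_finite lborel \<nu> ..
  define J where "J = (LINT x:{0<..}|\<nu>. 1 - exp (- s * x))"
  have [measurable]: "levy_tail \<nu> \<in> borel_measurable borel"
  proof -
    have "{(t, x). t < x} = {p :: real \<times> real. fst p < snd p}" by auto
    also have "\<dots> \<in> sets (borel \<Otimes>\<^sub>M \<nu>)"
      unfolding sets_pair_measure_cong[OF refl levy_sets] borel_prod
      by (intro borel_open open_Collect_less continuous_intros)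
    finally have "{(t, x). t < x} \<in> sets (borel \<Otimes>\<^sub>M \<nu>)" .
    from \<nu>.measurable_emeasure_Pair[OF this]
    have "(\<lambda>t. emeasure \<nu> (Pair t -` {(t, x). t < x})) \<in> borel_measurable borel" .
    moreover have "Pair t -` {(t, x). t < x} = {t<..}" for t :: real by auto
    ultimately have [measurable]: "(\<lambda>t. emeasure \<nu> {t<..}) \<in> borel_measurable borel" by (simp only:)
    show ?thesis unfolding levy_tail_def measure_def by measurable
  qed
  have inner: "(\<integral>\<^sup>+t. ennreal (exp (- s * t)) * (if 0 < t \<and> t < x then 1 else 0) \<partial>lborel)
      = ennreal (indicator {0<..} x * ((1 - exp (- s * x)) / s))" for x
  proof (cases "0 < x")
    case True
    have "(\<integral>\<^sup>+t. ennreal (exp (- s * t)) * (if 0 < t \<and> t < x then 1 else 0) \<partial>lborel)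
        = (\<integral>\<^sup>+t. ennreal (exp (- s * t)) * indicator {0..x} t \<partial>lborel)"
    proof (rule nn_integral_cong_AE)
      show "AE t in lborel. ennreal (exp (- s * t)) * (if 0 < t \<and> t < x then 1 else 0)
          = ennreal (exp (- s * t)) * indicator {0..x} t"
        using AE_lborel_singleton[of 0] AE_lborel_singleton[of x]
        by eventually_elim (auto simp: indicator_def)
    qed
    also have "\<dots> = ennreal (- exp (- s * x) / s - (- exp (- s * 0) / s))"
      using s True by (intro nn_integral_FTC_Icc) (auto intro!: derivative_eq_intros)
    finally show ?thesis using True s by (simp add: diff_divide_distrib)
  next
    case False
    then have *: "(if 0 < t \<and> t < x then 1 else 0) = (0 :: ennreal)" for t by auto
    show ?thesis using False unfolding * by simp
  qed
  \<comment> \<open>At \<open>t = 0\<close> the tail may have infinite mass, for which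
    \<open>measure\<close> returns 0; this single point does not affect the integral.\<close>
  have tail: "ennreal (levy_tail \<nu> t) = emeasure \<nu> {t<..}" if "0 < t" for t
    unfolding levy_tail_def using levy_emeasure_tail_finite[OF that] by (intro emeasure_eq_ennreal_measure[symmetric]) auto
  have "(\<integral>\<^sup>+t. ennreal (indicator {0..} t * (exp (- s * t) * levy_tail \<nu> t)) \<partial>lborel)
      = (\<integral>\<^sup>+t. (\<integral>\<^sup>+x. ennreal (exp (- s * t)) * (if 0 < t \<and> t < x then 1 else 0) \<partial>\<nu>) \<partial>lborel)"
  proof (rule nn_integral_cong_AE)
    show "AE t in lborel. ennreal (indicator {0..} t * (exp (- s * t) * levy_tail \<nu> t))
        = (\<integral>\<^sup>+x. ennreal (exp (- s * t)) * (if 0 < t \<and> t < x then 1 else 0) \<partial>\<nu>)"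
      using AE_lborel_singleton[of 0]
    proof eventually_elim
      case (elim t)
      show ?case
      proof (cases "0 < t")
        case True
        have "(\<integral>\<^sup>+x. ennreal (exp (- s * t)) * (if 0 < t \<and> t < x then 1 else 0) \<partial>\<nu>)
            = (\<integral>\<^sup>+x. ennreal (exp (- s * t)) * indicator {t<..} x \<partial>\<nu>)"
          using True by (intro nn_integral_cong) (auto simp: indicator_def)
        also have "\<dots> = ennreal (exp (- s * t)) * emeasure \<nu> {t<..}"
          by (rule nn_integral_cmult_indicator) simp
        finally show ?thesis using True tail[OF True] by (simp add: ennreal_mult levy_tail_nonneg)
      qed (use elim in simp)
    qed
  qed
  also have "\<dots> = (\<integral>\<^sup>+x. (\<integral>\<^sup>+t. ennreal (exp (- s * t)) * (if 0 < t \<and> t < x then 1 else 0) \<partial>lborel) \<partial>\<nu>)"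
    by (rule Fubini'[symmetric]) measurable
  also have "\<dots> = (\<integral>\<^sup>+x. ennreal (indicator {0<..} x * ((1 - exp (- s * x)) / s)) \<partial>\<nu>)"
    by (simp only: inner)
  also have "\<dots> = ennreal (\<integral>x. indicator {0<..} x * ((1 - exp (- s * x)) / s) \<partial>\<nu>)"
    using levy_integrable[OF s] s
    by (intro nn_integral_eq_integral) (auto simp: set_integrable_def indicator_def)
  also have "(\<integral>x. indicator {0<..} x * ((1 - exp (- s * x)) / s) \<partial>\<nu>) = J / s"
    by (simp add: J_def set_lebesgue_integral_def)
  finally have nn: "(\<integral>\<^sup>+t. ennreal (indicator {0..} t * (exp (- s * t) * levy_tail \<nu> t)) \<partial>lborel) = ennreal (J / s)" .
  have J0: "0 \<le> J"
    unfolding J_def set_lebesgue_integral_def using s by (intro integral_nonneg_AE) (auto simp: indicator_def)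
  have "has_bochner_integral lborel (\<lambda>t. indicator {0..} t * (exp (- s * t) * levy_tail \<nu> t)) (J / s)"
    using nn J0 s by (intro has_bochner_integral_nn_integral) (auto simp: levy_tail_nonneg)
  then show "laplace_at (levy_tail \<nu>) s" "s * (b + laplace (levy_tail \<nu>) s) = bernstein_fun b \<nu> s"
    using s by (auto simp: has_bochner_integral_iff laplace_at_def laplace_def set_integrable_def
        set_lebesgue_integral_def bernstein_fun_def J_def distrib_left)
qed

section \<open>The Bernstein function of an infinite Levy measure\<close>

context
  fixes b :: real
  assumes b: "0 \<le> b" and inf: "emeasure \<nu> {0<..} = \<infinity>"
begin

text \<open>For \<open>s \<ge> 1 / \<delta>\<close> the integrand is at least 1/2 on
  \<open>{\<delta><..}\<close>, and the mass of this set exceeds every bound as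
  \<open>\<delta>\<close> shrinks. This growth is what makes the subordinator strictly
  increasing.\<close>

lemma bernstein_fun_unbounded: "\<exists>m>0. \<forall>s\<ge>m. K \<le> bernstein_fun b \<nu> s"
proof -
  note [measurable_cong] = levy_sets
  have "(\<lambda>m. emeasure \<nu> {1 / real (Suc m)<..}) \<longlonglongrightarrow> emeasure \<nu> (\<Union>m. {1 / real (Suc m)<..})"
  proof (rule Lim_emeasure_incseq)
    have "1 / real (Suc n) \<le> 1 / real (Suc m)" if "m \<le> n" for m n
      using that by (intro divide_left_mono) auto
    then show "incseq (\<lambda>m. {1 / real (Suc m)<..})"
      unfolding incseq_def greaterThan_subset_iff by blast
  qed auto
  also have "(\<Union>m. {1 / real (Suc m)<..}) = {0<..}"
  proof (intro equalityI subsetI)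
    fix x :: real assume "x \<in> {0<..}"
    then obtain n where "inverse (real (Suc n)) < x" using reals_Archimedean[of x] by auto
    then show "x \<in> (\<Union>m. {1 / real (Suc m)<..})" by (auto simp: inverse_eq_divide)
  next
    fix x :: real assume "x \<in> (\<Union>m. {1 / real (Suc m)<..})"
    then obtain m where "1 / real (Suc m) < x" by blast
    moreover have "0 < 1 / real (Suc m)" by simp
    ultimately show "x \<in> {0<..}" unfolding greaterThan_iff by (rule order.strict_trans[rotated])
  qed
  finally have "(\<lambda>m. emeasure \<nu> {1 / real (Suc m)<..}) \<longlonglongrightarrow> \<infinity>" by (simp add: inf)
  then have "eventually (\<lambda>m. ennreal (2 * \<bar>K\<bar>) < emeasure \<nu> {1 / real (Suc m)<..}) sequentially"
    by (rule order_tendstoD) (simp add: less_top[symmetric])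
  then obtain m where m: "ennreal (2 * \<bar>K\<bar>) < emeasure \<nu> {1 / real (Suc m)<..}"
    by (auto simp: eventually_sequentially)
  define \<delta> where "\<delta> = 1 / real (Suc m)"
  have \<delta>: "0 < \<delta>" by (simp add: \<delta>_def)
  have fin: "emeasure \<nu> {\<delta><..} < \<infinity>" by (rule levy_emeasure_tail_finite[OF \<delta>])
  have mK: "2 * \<bar>K\<bar> \<le> measure \<nu> {\<delta><..}"
    using m fin unfolding \<delta>_def[symmetric] by (subst (asm) emeasure_eq_ennreal_measure) (auto simp: ennreal_less_iff)
  show ?thesis
  proof (intro exI[of _ "1 / \<delta>"] conjI allI impI)
    show "0 < 1 / \<delta>" using \<delta> by simp
    fix s assume s: "1 / \<delta> \<le> s"
    then have s0: "0 < s" using \<delta> by (meson less_le_trans zero_less_divide_1_iff)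
    have "K \<le> (1 / 2) * measure \<nu> {\<delta><..}" using mK by linarith
    also have "\<dots> = (\<integral>x. (1 / 2) * indicator {\<delta><..} x \<partial>\<nu>)" by simp
    also have "\<dots> \<le> (\<integral>x. indicator {0<..} x *\<^sub>R (1 - exp (- s * x)) \<partial>\<nu>)"
    proof (rule integral_mono)
      show "integrable \<nu> (\<lambda>x. (1 / 2) * indicator {\<delta><..} x :: real)"
        using fin by (intro integrable_mult_right) (simp add: integrable_indicator_iff)
      show "integrable \<nu> (\<lambda>x. indicator {0<..} x *\<^sub>R (1 - exp (- s * x)))"
        using levy_integrable[OF s0] by (simp add: set_integrable_def)
      fix x :: real
      have "1 / 2 \<le> 1 - exp (- s * x)" if "\<delta> < x"
      proof -
        have "1 \<le> s * \<delta>" using s \<delta> by (simp add: field_simps)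
        also have "\<dots> \<le> s * x" using s0 that by simp
        finally have "exp (- s * x) \<le> exp (- 1)" by simp
        also have "exp (- 1 :: real) \<le> 1 / 2"
          using exp_ge_add_one_self[of 1] by (simp add: exp_minus field_simps)
        finally show ?thesis by simp
      qed
      then show "(1 / 2) * indicator {\<delta><..} x \<le> indicator {0<..} x *\<^sub>R (1 - exp (- s * x))"
        using \<delta> s0 by (auto simp: indicator_def)
    qed
    also have "\<dots> \<le> bernstein_fun b \<nu> s"
      using b s0 by (simp add: bernstein_fun_def set_lebesgue_integral_def)
    finally show "K \<le> bernstein_fun b \<nu> s" .
  qed
qed

lemma bernstein_fun_pos:
  assumes s: "0 < s"
  shows "0 < bernstein_fun b \<nu> s"
proof -
  note [measurable_cong] = levy_sets
  have nn: "0 \<le> (LINT x:{0<..}|\<nu>. 1 - exp (- s * x))"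
    unfolding set_lebesgue_integral_def using s by (intro integral_nonneg_AE) (auto simp: indicator_def)
  have "(LINT x:{0<..}|\<nu>. 1 - exp (- s * x)) \<noteq> 0"
  proof
    assume "(LINT x:{0<..}|\<nu>. 1 - exp (- s * x)) = 0"
    then have "AE x in \<nu>. indicator {0<..} x *\<^sub>R (1 - exp (- s * x)) = 0"
      using levy_integrable[OF s] s unfolding set_lebesgue_integral_def set_integrable_def
      by (subst (asm) integral_nonneg_eq_0_iff_AE) (auto simp: indicator_def)
    then have "AE x in \<nu>. x \<notin> {0<..}"
      by eventually_elim (use s in \<open>auto simp: indicator_def\<close>)
    then have "emeasure \<nu> {0<..} = 0" by (subst (asm) AE_iff_measurable[of "{0<..}"]) auto
    then show False using inf by simp
  qed
  then have "0 < (LINT x:{0<..}|\<nu>. 1 - exp (- s * x))" using nn by simp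
  then show ?thesis unfolding bernstein_fun_def using b s by (intro add_nonneg_pos mult_nonneg_nonneg) auto
qed

end
end

subsection \<open>The inverse subordinator\<close>

text \<open>What is used of a single path. Strictness makes the inverse continuous, right continuity
  turns \<open>d r < t\<close> into the strict bound \<open>r < e t\<close>, and unboundedness keeps
  the set under \<open>Inf\<close> nonempty.\<close>

definition good_path :: "(real \<Rightarrow> real) \<Rightarrow> bool" where
  "good_path d \<longleftrightarrow> d 0 = 0 \<and> strict_mono_on {0..} d \<and>
     (\<forall>t\<ge>0. continuous (at_right t) d) \<and> (\<forall>K. \<exists>r\<ge>0. K < d r)"

context
  fixes d e :: "real \<Rightarrow> real"
  assumes good: "good_path d" and e_def: "\<And>t. e t = Inf {r. 0 \<le> r \<and> t < d r}"
begin

lemma path_mono: "0 \<le> r \<Longrightarrow> r < r' \<Longrightarrow> d r < d r'"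
  using good by (auto simp: good_path_def strict_mono_on_def)

lemma inverse_path_le: "0 \<le> r \<Longrightarrow> t < d r \<Longrightarrow> e t \<le> r"
  unfolding e_def by (rule cInf_lower) (auto intro: bdd_belowI[of _ 0])

lemma inverse_path_ge:
  assumes "0 \<le> r" "d r \<le> t"
  shows "r \<le> e t"
  unfolding e_def
proof (rule cInf_greatest)
  show "{r. 0 \<le> r \<and> t < d r} \<noteq> {}" using good by (auto simp: good_path_def)
  fix x assume "x \<in> {r. 0 \<le> r \<and> t < d r}"
  then show "r \<le> x" using path_mono[of x r] assms by (cases "x < r") auto
qed

lemma inverse_path_nonneg: "0 \<le> t \<Longrightarrow> 0 \<le> e t"
  using inverse_path_ge[of 0 t] good by (auto simp: good_path_def)

lemma inverse_path_0: "e 0 = 0"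
proof (rule antisym)
  have "e 0 \<le> 0 + r" if "0 < r" for r
    using inverse_path_le[of r 0] path_mono[of 0 r] that good by (auto simp: good_path_def)
  then show "e 0 \<le> 0" by (rule field_le_epsilon)
qed (rule inverse_path_nonneg, simp)

lemma inverse_path_greater:
  assumes "0 \<le> r" "d r < t"
  shows "r < e t"
proof -
  have "(d \<longlongrightarrow> d r) (at_right r)"
    using good assms(1) by (auto simp: good_path_def continuous_within)
  then have "eventually (\<lambda>x. d x < t) (at_right r)" using assms(2) by (rule order_tendstoD)
  then obtain r' where "r < r'" "\<And>y. r < y \<Longrightarrow> y < r' \<Longrightarrow> d y < t"
    unfolding eventually_at_right_field by auto
  then have "(r + r') / 2 \<le> e t"
    using assms(1) by (intro inverse_path_ge) (auto intro!: less_imp_le)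
  then show ?thesis using \<open>r < r'\<close> by simp
qed

lemma inverse_path_greaterD: "0 \<le> r \<Longrightarrow> r < e t \<Longrightarrow> d r \<le> t"
  using inverse_path_le[of r t] by (cases "t < d r") auto

text \<open>A jump of the inverse would be a flat piece of \<open>d\<close>. The values of
  \<open>d\<close> at the times \<open>e t + \<epsilon> / 2\<close> and, if nonnegative,
  \<open>e t - \<epsilon> / 2\<close> lie strictly on either side of \<open>t\<close>; their
  distances to \<open>t\<close> provide \<open>\<delta>\<close>.\<close>

lemma continuous_on_inverse_path: "continuous_on {0..} e"
  unfolding continuous_on_iff
proof (intro ballI allI impI)
  fix t \<epsilon> :: real assume t: "t \<in> {0..}" and \<epsilon>: "0 < \<epsilon>"
  have e0: "0 \<le> e t" using inverse_path_nonneg t by simp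
  define r1 where "r1 = e t + \<epsilon> / 2"
  have r1: "t < d r1" using inverse_path_ge[of r1 t] \<epsilon> e0 by (cases "d r1 \<le> t") (auto simp: r1_def)
  define r2 where "r2 = e t - \<epsilon> / 2"
  have r2: "d r2 < t" if "0 \<le> r2"
  proof -
    \<comment> \<open>The intermediate time \<open>e t - \<epsilon> / 4\<close> turns the weak
      inequality of \<open>inverse_path_greaterD\<close> into a strict one.\<close>
    have "d r2 < d (e t - \<epsilon> / 4)" using that \<epsilon> by (intro path_mono) (auto simp: r2_def)
    also have "\<dots> \<le> t" using that \<epsilon> by (intro inverse_path_greaterD) (auto simp: r2_def)
    finally show ?thesis .
  qed
  define \<delta> where "\<delta> = (if 0 \<le> r2 then min (d r1 - t) (t - d r2) else d r1 - t)"
  show "\<exists>\<delta>>0. \<forall>t'\<in>{0..}. dist t' t < \<delta> \<longrightarrow> dist (e t') (e t) < \<epsilon>"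
  proof (intro exI[of _ \<delta>] conjI ballI impI)
    show "0 < \<delta>" using r1 r2 by (auto simp: \<delta>_def)
    fix t' :: real assume t': "t' \<in> {0..}" "dist t' t < \<delta>"
    have "e t' \<le> r1"
      using t' e0 \<epsilon> by (intro inverse_path_le) (auto simp: \<delta>_def dist_real_def r1_def split: if_splits)
    moreover have "r2 \<le> e t'"
    proof (cases "0 \<le> r2")
      case True
      then show ?thesis using t' by (intro inverse_path_ge) (auto simp: \<delta>_def dist_real_def)
    next
      case False
      then show ?thesis using inverse_path_nonneg[of t'] t' by simp
    qed
    ultimately show "dist (e t') (e t) < \<epsilon>"
      using \<epsilon> by (auto simp: dist_real_def r1_def r2_def)
  qed
qed

end

section \<open>Almost sure path properties of the subordinator\<close>

context prob_space
begin

context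
  fixes f :: "real \<Rightarrow> real" and D :: "real \<Rightarrow> 'a \<Rightarrow> real"
  assumes D: "levy_subordinator M f D"
    and f_pos: "\<And>s. 0 < s \<Longrightarrow> 0 < f s"
    and f_unb: "\<And>K. \<exists>m>0. \<forall>s\<ge>m. K \<le> f s"
begin

lemma subordinator_measurable: "0 \<le> t \<Longrightarrow> D t \<in> borel_measurable M"
  using D by (simp add: levy_subordinator_def)

lemma subordinator_laplace: "0 \<le> t \<Longrightarrow> 0 < s \<Longrightarrow> expectation (\<lambda>\<omega>. exp (- s * D t \<omega>)) = exp (- t * f s)"
  using D by (simp add: levy_subordinator_def)

text \<open>A non-integrable function has expectation 0, whereas the prescribed Laplace transform is
  positive.\<close>

lemma subordinator_integrable:
  assumes "0 \<le> t" "0 < s"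
  shows "integrable M (\<lambda>\<omega>. exp (- s * D t \<omega>))"
proof (rule ccontr)
  assume "\<not> integrable M (\<lambda>\<omega>. exp (- s * D t \<omega>))"
  then have "expectation (\<lambda>\<omega>. exp (- s * D t \<omega>)) = 0" by (rule not_integrable_integral_eq)
  then show False using subordinator_laplace[OF assms] by simp
qed

text \<open>Chernoff's bound. With \<open>c = 0\<close> and large \<open>s\<close> it gives
  positivity of the values, with \<open>s = 1\<close> and large \<open>t\<close> unboundedness of
  the paths.\<close>

lemma subordinator_prob_le:
  assumes t: "0 \<le> t" and s: "0 < s"
  shows "prob {\<omega>\<in>space M. D t \<omega> \<le> c} \<le> exp (s * c - t * f s)"
proof -
  note [measurable] = subordinator_measurable[OF t]
  have "prob {\<omega>\<in>space M. D t \<omega> \<le> c} = expectation (indicator {\<omega>\<in>space M. D t \<omega> \<le> c})"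
    by simp
  also have "\<dots> \<le> expectation (\<lambda>\<omega>. exp (s * c) * exp (- s * D t \<omega>))"
  proof (rule integral_mono)
    show "integrable M (indicator {\<omega>\<in>space M. D t \<omega> \<le> c} :: _ \<Rightarrow> real)"
      by (rule integrable_const_bound[of _ 1]) (auto simp: indicator_def)
    show "integrable M (\<lambda>\<omega>. exp (s * c) * exp (- s * D t \<omega>))"
      using subordinator_integrable[OF t s] by simp
    fix \<omega>
    have "1 \<le> exp (s * c) * exp (- s * D t \<omega>)" if "D t \<omega> \<le> c"
      using that s by (simp add: exp_add[symmetric])
    then show "indicator {\<omega>\<in>space M. D t \<omega> \<le> c} \<omega> \<le> exp (s * c) * exp (- s * D t \<omega>)"
      by (auto simp: indicator_def)
  qed
  also have "\<dots> = exp (s * c - t * f s)"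
    using subordinator_laplace[OF t s] by (simp add: exp_diff exp_minus divide_inverse)
  finally show ?thesis .
qed

lemma subordinator_pos_AE:
  assumes t: "0 < t"
  shows "AE \<omega> in M. 0 < D t \<omega>"
proof -
  note [measurable] = subordinator_measurable[OF less_imp_le[OF t]]
  have "prob {\<omega>\<in>space M. D t \<omega> \<le> 0} \<le> 0"
  proof (rule ccontr)
    define p where "p = prob {\<omega>\<in>space M. D t \<omega> \<le> 0}"
    assume "\<not> prob {\<omega>\<in>space M. D t \<omega> \<le> 0} \<le> 0"
    then have p: "0 < p" by (simp add: p_def)
    \<comment> \<open>\<open>m\<close> is chosen so that the bound at \<open>m\<close> is at most
      \<open>exp (ln p - 1)\<close>, a fixed fraction of \<open>p\<close>.\<close>
    obtain m where m: "0 < m" "\<And>s. m \<le> s \<Longrightarrow> (1 - ln p) / t \<le> f s" using f_unb by blast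
    have "p \<le> exp (- t * f m)" using subordinator_prob_le[of t m 0] t m(1) by (simp add: p_def)
    also have "\<dots> \<le> exp (ln p - 1)" using m(2)[of m] t by (simp add: field_simps)
    also have "\<dots> < exp (ln p)" by simp
    also have "\<dots> = p" using p by simp
    finally show False by simp
  qed
  then have "AE \<omega> in M. \<not> D t \<omega> \<le> 0"
    by (intro AE_I'[of "{\<omega>\<in>space M. D t \<omega> \<le> 0}"])
       (auto simp: null_sets_def emeasure_eq_measure ennreal_eq_0_iff)
  then show ?thesis by eventually_elim simp
qed

lemma subordinator_unbounded_AE: "AE \<omega> in M. \<forall>K. \<exists>r\<ge>0. K < D r \<omega>"
proof -
  have "AE \<omega> in M. \<exists>n. real k < D (real n) \<omega>" for k :: nat
  proof -
    have [measurable]: "D (real n) \<in> borel_measurable M" for n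
      by (rule subordinator_measurable) simp
    define A where "A = {\<omega>\<in>space M. \<forall>n. D (real n) \<omega> \<le> real k}"
    have [measurable]: "A \<in> events" unfolding A_def by measurable
    have "prob A \<le> 0"
    proof (rule ccontr)
      assume "\<not> prob A \<le> 0"
      then have p: "0 < prob A" by simp
      obtain n :: nat where n: "(1 + real k - ln (prob A)) / f 1 < n" using reals_Archimedean2 by blast
      have "prob A \<le> prob {\<omega>\<in>space M. D (real n) \<omega> \<le> real k}"
        by (rule finite_measure_mono) (auto simp: A_def)
      also have "\<dots> \<le> exp (1 * real k - real n * f 1)" by (rule subordinator_prob_le) auto
      also have "\<dots> \<le> exp (ln (prob A) - 1)"
        using n f_pos[of 1] by (simp add: field_simps)
      also have "\<dots> < exp (ln (prob A))" by simp
      also have "\<dots> = prob A" using p by simp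
      finally show False by simp
    qed
    then have "AE \<omega> in M. \<omega> \<notin> A"
      by (intro AE_I'[of A]) (auto simp: null_sets_def emeasure_eq_measure ennreal_eq_0_iff)
    then show ?thesis using AE_space
      by eventually_elim (auto simp: A_def not_le)
  qed
  then have "AE \<omega> in M. \<forall>k::nat. \<exists>n. real k < D (real n) \<omega>" by (simp add: AE_all_countable)
  then show ?thesis
  proof eventually_elim
    case (elim \<omega>)
    show ?case
    proof
      fix K
      obtain k :: nat where "K < real k" using reals_Archimedean2 by blast
      moreover obtain n where "real k < D (real n) \<omega>" using elim by blast
      ultimately show "\<exists>r\<ge>0. K < D r \<omega>" by (intro exI[of _ "real n"]) auto
    qed
  qed
qed

text \<open>By stationarity, strict increase holds almost surely for each pair of times, hence
  simultaneously for the countably many rational pairs. Two rationals between arbitrary times,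
  together with monotonicity, carry it over to all times.\<close>

lemma subordinator_good_path_AE: "AE \<omega> in M. good_path (\<lambda>t. D t \<omega>)"
proof -
  have "AE \<omega> in M. D p \<omega> < D q \<omega>" if p: "0 \<le> p" "p < q" for p q
  proof -
    have [measurable]: "D p \<in> borel_measurable M" "D q \<in> borel_measurable M" "D (q - p) \<in> borel_measurable M"
      using p by (auto intro: subordinator_measurable)
    have "\<forall>s\<ge>0. \<forall>t\<ge>0. distr M borel (\<lambda>\<omega>. D (s + t) \<omega> - D s \<omega>) = distr M borel (D t)"
      using D unfolding levy_subordinator_def by blast
    from this[rule_format, of p "q - p"]
    have eq: "distr M borel (\<lambda>\<omega>. D q \<omega> - D p \<omega>) = distr M borel (D (q - p))"
      using p by simp
    have "AE x in distr M borel (\<lambda>\<omega>. D q \<omega> - D p \<omega>). 0 < x"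
      unfolding eq using subordinator_pos_AE[of "q - p"] p by (subst AE_distr_iff) auto
    then show ?thesis by (subst (asm) AE_distr_iff) auto
  qed
  then have "AE \<omega> in M. \<forall>p\<in>\<rat>. \<forall>q\<in>\<rat>. 0 \<le> p \<longrightarrow> p < q \<longrightarrow> D p \<omega> < D q \<omega>"
    by (intro AE_ball_countable[THEN iffD2] countable_rat ballI AE_impI)
  moreover have "AE \<omega> in M. D 0 \<omega> = 0" using D by (simp add: levy_subordinator_def)
  moreover have "AE \<omega> in M. mono_on {0..} (\<lambda>t. D t \<omega>) \<and> (\<forall>t\<ge>0. continuous (at_right t) (\<lambda>s. D s \<omega>))"
    using D by (simp add: levy_subordinator_def nondecreasing_rcont_paths_def)
  ultimately show ?thesis using subordinator_unbounded_AE
  proof eventually_elim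
    case (elim \<omega>)
    have "D t \<omega> < D t' \<omega>" if t: "0 \<le> t" "t < t'" for t t'
    proof -
      obtain p where p: "p \<in> \<rat>" "t < p" "p < t'" using Rats_dense_in_real[OF t(2)] by auto
      obtain q where q: "q \<in> \<rat>" "p < q" "q < t'" using Rats_dense_in_real[OF p(3)] by auto
      have "D t \<omega> \<le> D p \<omega>" using elim(3) t p by (auto intro!: mono_onD[of "{0..}" "\<lambda>t. D t \<omega>"])
      also have "D p \<omega> < D q \<omega>" using elim(1) p q t by auto
      also have "D q \<omega> \<le> D t' \<omega>" using elim(3) t p q by (auto intro!: mono_onD[of "{0..}" "\<lambda>t. D t \<omega>"])
      finally show ?thesis .
    qed
    then show ?case using elim by (auto simp: good_path_def strict_mono_on_def)
  qed
qed

lemma inverse_subordinator_AE: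
  "AE \<omega> in M. continuous_on {0..} (\<lambda>t. inverse_process D t \<omega>) \<and> (\<forall>t\<ge>0. 0 \<le> inverse_process D t \<omega>)
      \<and> inverse_process D 0 \<omega> = 0"
  using subordinator_good_path_AE
proof eventually_elim
  case (elim \<omega>)
  have e: "inverse_process D t \<omega> = Inf {r. 0 \<le> r \<and> t < D r \<omega>}" for t by (simp add: inverse_process_def)
  show ?case
    using continuous_on_inverse_path[OF elim e] inverse_path_nonneg[OF elim e] inverse_path_0[OF elim e] by auto
qed

section \<open>The inverse at an independent exponential time\<close>

context
  assumes E_meas: "\<And>t. 0 \<le> t \<Longrightarrow> inverse_process D t \<in> borel_measurable M"
begin

text \<open>Both sides are the expectation of \<open>\<phi>\<close> at the inverse taken at an
  independent exponential time of rate \<open>s\<close>. The event that the inverse at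
  \<open>t\<close> exceeds \<open>a\<close> contains \<open>D a < t\<close> and is contained in
  \<open>D a \<le> t\<close>. An exponential time does not distinguish the two, and averaging leaves
  the expectation of \<open>exp (- s * D a)\<close>, which is
  \<open>exp (- a * f s)\<close>.\<close>

lemma inverse_subordinator_laplace:
  assumes \<phi>: "continuous_on UNIV \<phi>" and \<phi>_bd: "\<And>r. 0 \<le> r \<Longrightarrow> \<bar>\<phi> r\<bar> \<le> B" and s: "0 < s"
  shows "s * laplace (\<lambda>t. expectation (\<lambda>\<omega>. \<phi> (inverse_process D t \<omega>))) s = f s * laplace \<phi> (f s)"
proof -
  obtain N0 where N0: "{\<omega>\<in>space M. \<not> good_path (\<lambda>t. D t \<omega>)} \<subseteq> N0" "N0 \<in> events" "emeasure M N0 = 0"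
    using subordinator_good_path_AE by (rule AE_E)
  define G where "G = space M - N0"
  have [measurable]: "G \<in> events" using N0 by (auto simp: G_def)
  have good: "good_path (\<lambda>t. D t \<omega>)" if "\<omega> \<in> G" for \<omega> using N0 that by (auto simp: G_def)
  have G_AE: "AE \<omega> in M. \<omega> \<in> G"
    using AE_not_in[of N0 M] N0 AE_space by (auto simp: G_def null_sets_def)
  have e: "inverse_process D t \<omega> = Inf {r. 0 \<le> r \<and> t < D r \<omega>}" for t \<omega> by (simp add: inverse_process_def)
  \<comment> \<open>Off the good set the process is replaced by 0, so that every path is continuous
    on \<open>{0..}\<close>. Joint measurability of \<open>X\<close> then follows by rounding time
    down to grids of mesh \<open>1 / (n + 1)\<close>.\<close>
  define E' where "E' t \<omega> = (if \<omega> \<in> G then inverse_process D t \<omega> else 0)" for t \<omega>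
  have E'_meas: "E' t \<in> borel_measurable M" if "0 \<le> t" for t
  proof -
    note [measurable] = E_meas[OF that]
    show ?thesis unfolding E'_def by measurable
  qed
  have E'_cont: "continuous_on {0..} (\<lambda>t. E' t \<omega>)" for \<omega>
    using continuous_on_inverse_path[OF good e, of \<omega>] by (cases "\<omega> \<in> G") (auto simp: E'_def)
  have E'_nonneg: "0 \<le> E' t \<omega>" if "0 \<le> t" for t \<omega>
    using inverse_path_nonneg[OF good e that, of \<omega>] by (auto simp: E'_def)
  define X where "X = (\<lambda>(t, \<omega>). E' (max 0 t) \<omega>)"
  have X_meas [measurable]: "X \<in> borel_measurable (lborel \<Otimes>\<^sub>M M)"
  proof (rule borel_measurable_LIMSEQ_real)
    define g where "g n t = nat \<lfloor>real (Suc n) * max 0 t\<rfloor>" for n and t :: real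
    have "(\<lambda>t. real (Suc n) * max 0 t) \<in> borel_measurable borel" for n
      by (intro borel_measurable_times borel_measurable_max) auto
    then have g [measurable]: "g n \<in> measurable borel (count_space UNIV)" for n
      unfolding g_def
      by (rule measurable_compose[OF measurable_compose[OF _ measurable_real_floor] measurable_count_space])
    show "(\<lambda>p. E' (real (g n (fst p)) / real (Suc n)) (snd p)) \<in> borel_measurable (lborel \<Otimes>\<^sub>M M)" for n
    proof (rule measurable_compose_countable[of "\<lambda>i p. E' (real i / real (Suc n)) (snd p)"])
      show "(\<lambda>p. E' (real i / real (Suc n)) (snd p)) \<in> borel_measurable (lborel \<Otimes>\<^sub>M M)" for i
        using measurable_compose[OF measurable_snd[of lborel M] E'_meas[of "real i / real (Suc n)"]] by simp
      show "(\<lambda>p. g n (fst p)) \<in> measurable (lborel \<Otimes>\<^sub>M M) (count_space UNIV)"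
        by (rule measurable_compose[OF measurable_fst]) simp
    qed
    fix p :: "real \<times> 'a"
    obtain t \<omega> where p: "p = (t, \<omega>)" by (cases p)
    have "(\<lambda>n. real (g n t) / real (Suc n)) \<longlonglongrightarrow> max 0 t"
    proof (rule tendsto_sandwich)
      have fl: "real (g n t) \<le> real (Suc n) * max 0 t" "real (Suc n) * max 0 t - 1 \<le> real (g n t)" for n
        unfolding g_def by (auto simp del: of_nat_Suc)
      show "eventually (\<lambda>n. real (g n t) / real (Suc n) \<le> max 0 t) sequentially"
        using fl(1) by (intro always_eventually allI) (simp add: divide_le_eq mult.commute del: of_nat_Suc)
      show "eventually (\<lambda>n. max 0 t - 1 / real (Suc n) \<le> real (g n t) / real (Suc n)) sequentially"
      proof (intro always_eventually allI)
        fix n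
        have "max 0 t - 1 / real (Suc n) = (real (Suc n) * max 0 t - 1) / real (Suc n)"
          by (simp add: diff_divide_distrib del: of_nat_Suc)
        also have "\<dots> \<le> real (g n t) / real (Suc n)" by (intro divide_right_mono fl(2)) simp
        finally show "max 0 t - 1 / real (Suc n) \<le> real (g n t) / real (Suc n)" .
      qed
      have "(\<lambda>n. max 0 t - 1 / real (Suc n)) \<longlonglongrightarrow> max 0 t - 0"
        by (intro tendsto_diff tendsto_const LIMSEQ_Suc[OF lim_1_over_n])
      then show "(\<lambda>n. max 0 t - 1 / real (Suc n)) \<longlonglongrightarrow> max 0 t" by simp
    qed auto
    then have "(\<lambda>n. E' (real (g n t) / real (Suc n)) \<omega>) \<longlonglongrightarrow> E' (max 0 t) \<omega>"
      by (intro continuous_on_tendsto_compose[OF E'_cont[of \<omega>]]) auto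
    then show "(\<lambda>n. E' (real (g n (fst p)) / real (Suc n)) (snd p)) \<longlonglongrightarrow> X p"
      by (simp add: X_def p)
  qed
  define P where "P = density lborel (exponential_density s)"
  interpret P: prob_space P unfolding P_def by (rule prob_space_exponential_density[OF s])
  have sets_P [measurable_cong]: "sets P = sets borel" by (simp add: P_def)
  have space_P: "space P = UNIV" by (simp add: P_def)
  interpret PM: pair_prob_space P M ..
  have X_P [measurable]: "X \<in> borel_measurable (P \<Otimes>\<^sub>M M)"
    using X_meas by (simp cong: measurable_cong_sets sets_pair_measure_cong add: sets_P)
  have P_tail: "emeasure P {x..} = ennreal (exp (- s * x))" "emeasure P {x<..} = ennreal (exp (- s * x))" if x: "0 \<le> x" for x
  proof -
    have "emeasure P {x..} = (\<integral>\<^sup>+t. ennreal s * (ennreal (exp (- s * t)) * indicator {x..} t) \<partial>lborel)"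
      unfolding P_def using x s
      by (subst emeasure_density)
         (auto simp: exponential_density_def indicator_def ennreal_mult mult.commute intro!: nn_integral_cong)
    also have "\<dots> = ennreal s * ennreal (exp (- s * x) / s)"
      unfolding nn_integral_exp_Ici[OF s, symmetric] by (rule nn_integral_cmult) simp
    also have "\<dots> = ennreal (exp (- s * x))" using s by (simp add: ennreal_mult'[symmetric])
    finally show 1: "emeasure P {x..} = ennreal (exp (- s * x))" .
    have "AE t in P. t \<noteq> x"
      unfolding P_def using AE_lborel_singleton[of x] by (subst AE_density) auto
    then have "emeasure P {x<..} = emeasure P {x..}"
      by (intro emeasure_eq_AE) auto
    then show "emeasure P {x<..} = ennreal (exp (- s * x))" using 1 by simp
  qed
  have dist: "distributed (P \<Otimes>\<^sub>M M) lborel X (exponential_density (f s))"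
  proof (rule exponential_distributedI)
    show "X \<in> borel_measurable (P \<Otimes>\<^sub>M M)" by measurable
    show "0 < f s" by (rule f_pos[OF s])
    fix a :: real assume a: "0 \<le> a"
    note [measurable] = subordinator_measurable[OF a]
    define A where "A = {p \<in> space (P \<Otimes>\<^sub>M M). a < X p}"
    have [measurable]: "A \<in> sets (P \<Otimes>\<^sub>M M)" unfolding A_def by measurable
    have "emeasure (P \<Otimes>\<^sub>M M) A = (\<integral>\<^sup>+\<omega>. emeasure P ((\<lambda>t. (t, \<omega>)) -` A) \<partial>M)"
      by (rule PM.emeasure_pair_measure_alt2) measurable
    also have "\<dots> = (\<integral>\<^sup>+\<omega>. ennreal (exp (- s * D a \<omega>)) \<partial>M)"
    proof (rule nn_integral_cong_AE)
      show "AE \<omega> in M. emeasure P ((\<lambda>t. (t, \<omega>)) -` A) = ennreal (exp (- s * D a \<omega>))"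
        using G_AE AE_space
      proof eventually_elim
        case (elim \<omega>)
        have A_eq: "(\<lambda>t. (t, \<omega>)) -` A = {t. a < inverse_process D (max 0 t) \<omega>}"
          using elim by (auto simp: A_def X_def E'_def space_pair_measure space_P)
        have A_sets: "(\<lambda>t. (t, \<omega>)) -` A \<in> sets P"
          by (rule sets_Pair2) measurable
        have Da: "0 \<le> D a \<omega>"
          using path_mono[OF good[OF elim(1)] e, of 0 a] a good[OF elim(1)]
          by (cases "a = 0") (auto simp: good_path_def)
        have "{D a \<omega><..} \<subseteq> (\<lambda>t. (t, \<omega>)) -` A"
          unfolding A_eq using Da inverse_path_greater[OF good[OF elim(1)] e a] by auto
        then have 1: "ennreal (exp (- s * D a \<omega>)) \<le> emeasure P ((\<lambda>t. (t, \<omega>)) -` A)"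
          using emeasure_mono[OF _ A_sets] P_tail(2)[OF Da] by metis
        have "(\<lambda>t. (t, \<omega>)) -` A \<subseteq> {D a \<omega>..}"
        proof
          fix t assume t: "t \<in> (\<lambda>t. (t, \<omega>)) -` A"
          then have "D a \<omega> \<le> max 0 t"
            unfolding A_eq using inverse_path_greaterD[OF good[OF elim(1)] e a] by auto
          moreover have "0 \<le> t"
          proof (rule ccontr)
            assume "\<not> 0 \<le> t"
            then have "a < inverse_process D 0 \<omega>" using t unfolding A_eq by (simp add: max_def)
            then show False using inverse_path_0[OF good[OF elim(1)] e] a by simp
          qed
          ultimately show "t \<in> {D a \<omega>..}" by simp
        qed
        then have 2: "emeasure P ((\<lambda>t. (t, \<omega>)) -` A) \<le> ennreal (exp (- s * D a \<omega>))"
          using emeasure_mono[of _ "{D a \<omega>..}" P] P_tail(1)[OF Da] by (metis atLeast_borel sets_P)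
        show ?case using 1 2 by (rule antisym[rotated])
      qed
    qed
    also have "\<dots> = ennreal (exp (- a * f s))"
      using subordinator_integrable[OF a s] subordinator_laplace[OF a s]
      by (subst nn_integral_eq_integral) auto
    finally have "PM.P.prob A = exp (- a * f s)"
      by (simp add: PM.P.emeasure_eq_measure)
    moreover have "{p \<in> space (P \<Otimes>\<^sub>M M). X p \<le> a} = space (P \<Otimes>\<^sub>M M) - A"
      by (auto simp: A_def not_le)
    ultimately have "PM.P.prob {p \<in> space (P \<Otimes>\<^sub>M M). X p \<le> a} = 1 - exp (- a * f s)"
      by (simp add: PM.P.prob_compl)
    then have "emeasure (P \<Otimes>\<^sub>M M) {p \<in> space (P \<Otimes>\<^sub>M M). X p \<le> a} = ennreal (1 - exp (- a * f s))"
      by (simp add: PM.P.emeasure_eq_measure)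
    also have "\<dots> = ennreal 1 - ennreal (exp (- a * f s))"
      by (rule ennreal_minus[symmetric]) simp
    finally show "emeasure (P \<Otimes>\<^sub>M M) {p \<in> space (P \<Otimes>\<^sub>M M). X p \<le> a} = 1 - ennreal (exp (- a * f s))"
      by simp
  qed
  \<comment> \<open>\<open>\<phi>\<close> is known to be bounded only on nonnegative arguments. The
    truncation is bounded everywhere and coincides with \<open>\<phi>\<close> along the
    process.\<close>
  define \<psi> where "\<psi> r = \<phi> (max 0 r)" for r
  have \<psi>_cont: "continuous_on UNIV \<psi>"
    unfolding \<psi>_def by (rule continuous_on_compose2[OF \<phi>]) (auto intro!: continuous_intros)
  have [measurable]: "\<phi> \<in> borel_measurable borel" by (rule borel_measurable_continuous_onI[OF \<phi>])
  have [measurable]: "\<psi> \<in> borel_measurable borel" by (rule borel_measurable_continuous_onI[OF \<psi>_cont])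
  have \<psi>_bd: "\<bar>\<psi> r\<bar> \<le> B" for r unfolding \<psi>_def by (rule \<phi>_bd) simp
  have "case_prod (\<lambda>t \<omega>. \<psi> (X (t, \<omega>))) \<in> borel_measurable (lborel \<Otimes>\<^sub>M M)"
    by measurable
  then have [measurable]: "(\<lambda>t. expectation (\<lambda>\<omega>. \<psi> (X (t, \<omega>)))) \<in> borel_measurable borel"
    using borel_measurable_lebesgue_integral[of "\<lambda>t \<omega>. \<psi> (X (t, \<omega>))" lborel] by simp
  have int: "integrable (P \<Otimes>\<^sub>M M) (\<lambda>p. \<psi> (X p))"
    by (rule PM.P.integrable_const_bound[of _ B]) (auto simp: \<psi>_bd)
  have "f s * laplace \<phi> (f s) = (\<integral>r. exponential_density (f s) r * \<psi> r \<partial>lborel)"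
    unfolding laplace_def set_lebesgue_integral_def
    by (subst integral_mult_right_zero[symmetric])
       (auto intro!: Bochner_Integration.integral_cong simp: exponential_density_def \<psi>_def indicator_def mult_ac)
  also have "\<dots> = (\<integral>p. \<psi> (X p) \<partial>(P \<Otimes>\<^sub>M M))"
    using f_pos[OF s] by (intro distributed_integral[OF dist]) (auto simp: exponential_density_nonneg)
  also have "\<dots> = (\<integral>t. (\<integral>\<omega>. \<psi> (X (t, \<omega>)) \<partial>M) \<partial>P)"
    by (rule PM.integral_fst'[OF int, symmetric])
  also have "\<dots> = (\<integral>t. exponential_density s t * (\<integral>\<omega>. \<psi> (X (t, \<omega>)) \<partial>M) \<partial>lborel)"
    unfolding P_def using s by (subst integral_density) (auto simp: exponential_density_nonneg)
  also have "\<dots> = (\<integral>t. s * (indicator {0..} t *\<^sub>R (exp (- s * t) * expectation (\<lambda>\<omega>. \<phi> (inverse_process D t \<omega>)))) \<partial>lborel)"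
  proof (rule Bochner_Integration.integral_cong[OF refl])
    fix t :: real
    have "(\<integral>\<omega>. \<psi> (X (t, \<omega>)) \<partial>M) = expectation (\<lambda>\<omega>. \<phi> (inverse_process D t \<omega>))" if t: "0 \<le> t"
    proof -
      have [measurable]: "E' t \<in> borel_measurable M" "inverse_process D t \<in> borel_measurable M"
        using E_meas[OF t] E'_meas[OF t] by auto
      have "AE \<omega> in M. \<psi> (X (t, \<omega>)) = \<phi> (inverse_process D t \<omega>)"
        using G_AE
      proof eventually_elim
        case (elim \<omega>)
        then show ?case using E'_nonneg[OF t, of \<omega>] t by (simp add: X_def \<psi>_def E'_def)
      qed
      moreover have "(\<lambda>\<omega>. \<psi> (X (t, \<omega>))) \<in> borel_measurable M"
        unfolding X_def using t by simp
      ultimately show ?thesis by (intro integral_cong_AE) auto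
    qed
    then show "exponential_density s t * (\<integral>\<omega>. \<psi> (X (t, \<omega>)) \<partial>M)
        = s * (indicator {0..} t *\<^sub>R (exp (- s * t) * expectation (\<lambda>\<omega>. \<phi> (inverse_process D t \<omega>))))"
      by (auto simp: exponential_density_def indicator_def mult_ac)
  qed
  also have "\<dots> = s * laplace (\<lambda>t. expectation (\<lambda>\<omega>. \<phi> (inverse_process D t \<omega>))) s"
    by (simp only: integral_mult_right_zero laplace_def set_lebesgue_integral_def)
  finally show ?thesis by simp
qed

end
end
end

subsection \<open>Poisson mixtures of the inverse subordinator\<close>

text \<open>The expectation of \<open>\<gamma>\<close> at a Poisson variable of mean
  \<open>z\<close>. Written as an exponential times a power series it makes sense, for bounded
  \<open>\<gamma>\<close>, at all real \<open>z\<close>, which spares one-sided derivatives at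
  0.\<close>

definition pois_mix :: "(nat \<Rightarrow> real) \<Rightarrow> real \<Rightarrow> real" where
  "pois_mix \<gamma> z = exp (- z) * (\<Sum>n. \<gamma> n / fact n * z ^ n)"

context
  fixes \<gamma> :: "nat \<Rightarrow> real" and C :: real
  assumes \<gamma>: "\<And>n. \<bar>\<gamma> n\<bar> \<le> C"
begin

lemma pois_mix_summable: "summable (\<lambda>n. \<bar>\<gamma> n / fact n * z ^ n\<bar>)" "summable (\<lambda>n. \<gamma> n / fact n * z ^ n)"
proof -
  have C: "0 \<le> C" using \<gamma>[of 0] by simp
  show "summable (\<lambda>n. \<bar>\<gamma> n / fact n * z ^ n\<bar>)"
  proof (rule summable_comparison_test')
    show "summable (\<lambda>n. C * (inverse (fact n) * \<bar>z\<bar> ^ n))"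
      by (intro summable_mult summable_exp)
    show "norm \<bar>\<gamma> n / fact n * z ^ n\<bar> \<le> C * (inverse (fact n) * \<bar>z\<bar> ^ n)" for n
      using mult_right_mono[OF \<gamma>[of n], of "inverse (fact n) * \<bar>z\<bar> ^ n"]
      by (simp add: abs_mult power_abs divide_inverse mult.assoc)
  qed
  then show "summable (\<lambda>n. \<gamma> n / fact n * z ^ n)" by (rule summable_rabs_cancel)
qed

lemma abs_pois_mix_le:
  assumes z: "0 \<le> z"
  shows "\<bar>pois_mix \<gamma> z\<bar> \<le> C"
proof -
  have "\<bar>\<Sum>n. \<gamma> n / fact n * z ^ n\<bar> \<le> (\<Sum>n. \<bar>\<gamma> n / fact n * z ^ n\<bar>)"
    by (rule summable_rabs[OF pois_mix_summable(1)])
  also have "\<dots> \<le> (\<Sum>n. C * (inverse (fact n) * z ^ n))"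
  proof (rule suminf_le)
    show "\<bar>\<gamma> n / fact n * z ^ n\<bar> \<le> C * (inverse (fact n) * z ^ n)" for n
      using mult_right_mono[OF \<gamma>[of n], of "inverse (fact n) * z ^ n"] z
      by (simp add: abs_mult divide_inverse mult.assoc)
    show "summable (\<lambda>n. C * (inverse (fact n) * z ^ n))" by (intro summable_mult summable_exp)
  qed (rule pois_mix_summable)
  also have "\<dots> = C * exp z"
    by (simp add: suminf_mult summable_exp exp_def scaleR_conv_of_real divide_inverse mult.commute)
  finally show ?thesis
    by (simp add: pois_mix_def abs_mult exp_minus field_simps)
qed

text \<open>The power series contributes the shifted sequence, the factor \<open>exp (- z)\<close>
  minus the sequence itself. The forward difference is the generator of the Poisson process of unit
  rate.\<close>

lemma pois_mix_has_derivative: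
  "(pois_mix \<gamma> has_real_derivative pois_mix (\<lambda>n. \<gamma> (Suc n) - \<gamma> n) z) (at z)"
proof -
  define c where "c n = \<gamma> n / fact n" for n
  have summ: "summable (\<lambda>n. c n * z ^ n)" for z unfolding c_def by (rule pois_mix_summable)
  have D: "((\<lambda>z. \<Sum>n. c n * z ^ n) has_real_derivative (\<Sum>n. diffs c n * z ^ n)) (at z)"
    by (rule termdiffs_strong_converges_everywhere[OF summ])
  have "((\<lambda>z. exp (- z) * (\<Sum>n. c n * z ^ n)) has_real_derivative
      - exp (- z) * (\<Sum>n. c n * z ^ n) + (\<Sum>n. diffs c n * z ^ n) * exp (- z)) (at z)"
    by (rule DERIV_mult[OF _ D]) (auto intro!: derivative_eq_intros)
  moreover have "- exp (- z) * (\<Sum>n. c n * z ^ n) + (\<Sum>n. diffs c n * z ^ n) * exp (- z)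
      = pois_mix (\<lambda>n. \<gamma> (Suc n) - \<gamma> n) z"
  proof -
    have "(\<Sum>n. (\<gamma> (Suc n) - \<gamma> n) / fact n * z ^ n) = (\<Sum>n. diffs c n * z ^ n - c n * z ^ n)"
      by (rule suminf_cong) (simp add: diffs_def c_def left_diff_distrib diff_divide_distrib)
    also have "\<dots> = (\<Sum>n. diffs c n * z ^ n) - (\<Sum>n. c n * z ^ n)"
      by (rule suminf_diff[symmetric]) (rule termdiff_converges_all[OF summ], rule summ)
    finally have eq: "(\<Sum>n. (\<gamma> (Suc n) - \<gamma> n) / fact n * z ^ n) = (\<Sum>n. diffs c n * z ^ n) - (\<Sum>n. c n * z ^ n)" .
    show ?thesis unfolding pois_mix_def eq by (simp add: right_diff_distrib mult.commute)
  qed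
  ultimately show ?thesis by (simp add: pois_mix_def[abs_def] c_def)
qed

end

lemma pois_mix_0 [simp]: "pois_mix \<gamma> 0 = \<gamma> 0"
  by (simp only: pois_mix_def powser_zero) simp

text \<open>In place of integration by parts on the half-line: the antiderivative of
  \<open>\<phi>'\<close> minus \<open>\<phi>\<close> is constant, and the transform of an
  antiderivative is known.\<close>

lemma laplace_derivative:
  assumes \<phi>: "\<And>r. (\<phi> has_real_derivative \<phi>' r) (at r)" and \<phi>': "continuous_on UNIV \<phi>'"
    and bd: "\<And>r. 0 \<le> r \<Longrightarrow> \<bar>\<phi> r\<bar> \<le> B" and bd': "\<And>r. 0 \<le> r \<Longrightarrow> \<bar>\<phi>' r\<bar> \<le> B'" and s: "0 < s"
  shows "laplace \<phi>' s = s * laplace \<phi> s - \<phi> 0"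
proof -
  have c': "continuous_on {0..} \<phi>'" by (rule continuous_on_subset[OF \<phi>']) simp
  have c: "continuous_on {0..} \<phi>"
    using \<phi> by (auto intro!: continuous_at_imp_continuous_on DERIV_isCont)
  have at: "laplace_at \<phi> s" "laplace_at \<phi>' s"
    by (rule laplace_at_exp_bounded[OF c, of B 0], use bd s in auto)
       (rule laplace_at_exp_bounded[OF c', of B' 0], use bd' s in auto)
  have one_loc: "set_integrable lborel {0..T} (\<lambda>_. 1::real)" for T :: real
    by (rule laplace_at_imp_locally_integrable[OF laplace_const(1)[of 1]]) simp
  define h where "h r = half_conv \<phi>' (\<lambda>_. 1) r - \<phi> r" for r
  have h_cont: "continuous_on {0..} h"
    unfolding h_def by (intro continuous_on_diff continuous_on_half_conv c c' one_loc)
  have h0: "h 0 = - \<phi> 0"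
  proof -
    have "half_conv \<phi>' (\<lambda>_. 1) 0 = 0"
      unfolding half_conv_def set_lebesgue_integral_def
      by (rule integral_eq_zero_AE) (use AE_lborel_singleton[of 0] in \<open>auto elim!: eventually_mono\<close>)
    then show ?thesis by (simp add: h_def)
  qed
  have h: "h r = - \<phi> 0" if r: "0 \<le> r" for r
  proof (cases "r = 0")
    case False
    have "h r = h 0"
    proof (rule DERIV_isconst_end[of 0 r h])
      show "0 < r" using r False by simp
      show "continuous_on {0..r} h" by (rule continuous_on_subset[OF h_cont]) auto
      show "(h has_real_derivative 0) (at x)" if "0 < x" "x < r" for x
        unfolding h_def using DERIV_diff[OF half_conv_one_has_derivative[OF c' that(1)] \<phi>[of x]] by simp
    qed
    then show ?thesis by (simp add: h0)
  qed (simp add: h0)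
  have "laplace (\<lambda>r. half_conv \<phi>' (\<lambda>_. 1) r - \<phi> r) s = laplace (\<lambda>r. - \<phi> 0) s"
    by (rule laplace_cong) (use h in \<open>simp add: h_def\<close>)
  then have "laplace \<phi>' s * (1 / s) - laplace \<phi> s = - \<phi> 0 / s"
    using s by (simp add: laplace_diff laplace_half_conv at laplace_const)
  then have "laplace \<phi>' s = s * (laplace \<phi> s - \<phi> 0 / s)" using s by (simp add: field_simps)
  then show ?thesis using s by (simp add: right_diff_distrib)
qed

text \<open>With \<open>f = bernstein_fun b \<nu> s\<close>, the exponential-time identity for
  \<open>\<phi>\<close> and for \<open>\<phi>'\<close> combines with
  \<open>laplace_derivative\<close> to
  \<open>laplace Q1 s = f * laplace (\<lambda>t. Q t - Q 0) s\<close>. Since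
  \<open>f = s * (b + laplace (levy_tail \<nu>) s)\<close>, this is the hypothesis of
  \<open>caputo_deriv_by_laplace\<close>.\<close>

lemma (in prob_space) caputo_deriv_poisson_mixture:
  fixes \<nu> :: "real measure" and \<gamma> :: "nat \<Rightarrow> real"
  assumes levy: "subordinator_levy_measure \<nu>" and b: "0 \<le> b" and inf: "emeasure \<nu> {0<..} = \<infinity>"
    and D: "levy_subordinator M (bernstein_fun b \<nu>) D"
    and E_meas: "\<And>t. 0 \<le> t \<Longrightarrow> inverse_process D t \<in> borel_measurable M"
    and lam: "0 < lam" and \<gamma>: "\<And>n. \<bar>\<gamma> n\<bar> \<le> C" and t: "0 < t"
  defines "q \<equiv> (\<lambda>\<gamma> t. expectation (\<lambda>\<omega>. pois_mix \<gamma> (lam * inverse_process D t \<omega>)))"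
  shows "caputo_differentiable b (levy_tail \<nu>) (q \<gamma>) t"
    and "caputo_deriv b (levy_tail \<nu>) (q \<gamma>) t = lam * q (\<lambda>n. \<gamma> (Suc n) - \<gamma> n) t"
proof -
  define \<gamma>' where "\<gamma>' n = \<gamma> (Suc n) - \<gamma> n" for n
  have \<gamma>': "\<bar>\<gamma>' n\<bar> \<le> 2 * C" for n using \<gamma>[of n] \<gamma>[of "Suc n"] by (auto simp: \<gamma>'_def)
  define \<phi> where "\<phi> r = pois_mix \<gamma> (lam * r)" for r
  define \<phi>' where "\<phi>' r = lam * pois_mix \<gamma>' (lam * r)" for r
  note f_pos = bernstein_fun_pos[OF levy b inf]
  note f_unb = bernstein_fun_unbounded[OF levy b inf]
  have path: "AE \<omega> in M. continuous_on {0..} (\<lambda>t. inverse_process D t \<omega>) \<and>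
      (\<forall>t\<ge>0. 0 \<le> inverse_process D t \<omega>) \<and> inverse_process D 0 \<omega> = 0"
    by (rule inverse_subordinator_AE[OF D f_pos f_unb])
  have cont_mix: "continuous_on UNIV (\<lambda>r. pois_mix g (lam * r))" if "\<And>n. \<bar>g n\<bar> \<le> K" for g K
  proof -
    have "continuous_on UNIV (pois_mix g)"
      using pois_mix_has_derivative[OF that] by (auto intro!: continuous_at_imp_continuous_on DERIV_isCont)
    then show ?thesis by (rule continuous_on_compose2) (auto intro!: continuous_intros)
  qed
  have \<phi>_cont: "continuous_on UNIV \<phi>" unfolding \<phi>_def by (rule cont_mix[OF \<gamma>])
  have \<phi>'_cont: "continuous_on UNIV \<phi>'"
    unfolding \<phi>'_def by (intro continuous_on_mult continuous_on_const cont_mix[OF \<gamma>'])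
  have \<phi>_bd: "\<bar>\<phi> r\<bar> \<le> C" if "0 \<le> r" for r
    unfolding \<phi>_def using lam that by (intro abs_pois_mix_le[OF \<gamma>]) auto
  have \<phi>'_bd: "\<bar>\<phi>' r\<bar> \<le> lam * (2 * C)" if "0 \<le> r" for r
    unfolding \<phi>'_def using lam that abs_pois_mix_le[OF \<gamma>', of "lam * r"] by (simp add: abs_mult)
  have \<phi>_deriv: "(\<phi> has_real_derivative \<phi>' r) (at r)" for r
  proof -
    have "(\<phi> has_real_derivative pois_mix \<gamma>' (lam * r) * lam) (at r)"
      unfolding \<phi>_def \<gamma>'_def
      by (rule DERIV_chain2[OF pois_mix_has_derivative[OF \<gamma>]]) (auto intro!: derivative_eq_intros)
    then show ?thesis by (simp add: \<phi>'_def mult.commute)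
  qed
  have cont: "continuous_on {0..} (\<lambda>t. expectation (\<lambda>\<omega>. g (inverse_process D t \<omega>)))"
    if g: "continuous_on UNIV g" and g_bd: "\<And>r. 0 \<le> r \<Longrightarrow> \<bar>g r\<bar> \<le> K" for g :: "real \<Rightarrow> real" and K
  proof (rule continuous_on_sequentiallyI)
    fix \<rho> :: "nat \<Rightarrow> real" and r assume \<rho>: "\<forall>n. \<rho> n \<in> {0..}" and r: "r \<in> {0..}" and lim: "\<rho> \<longlonglongrightarrow> r"
    have [measurable]: "g \<in> borel_measurable borel" by (rule borel_measurable_continuous_onI[OF g])
    have [measurable]: "inverse_process D r \<in> borel_measurable M" "inverse_process D (\<rho> n) \<in> borel_measurable M" for n
      using \<rho> r by (auto intro: E_meas)
    show "(\<lambda>n. expectation (\<lambda>\<omega>. g (inverse_process D (\<rho> n) \<omega>))) \<longlonglongrightarrow> expectation (\<lambda>\<omega>. g (inverse_process D r \<omega>))"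
    proof (rule integral_dominated_convergence[where w="\<lambda>_. K"])
      show "AE \<omega> in M. (\<lambda>n. g (inverse_process D (\<rho> n) \<omega>)) \<longlonglongrightarrow> g (inverse_process D r \<omega>)"
        using path
      proof eventually_elim
        case (elim \<omega>)
        have "(\<lambda>n. inverse_process D (\<rho> n) \<omega>) \<longlonglongrightarrow> inverse_process D r \<omega>"
          using elim \<rho> r lim by (intro continuous_on_tendsto_compose[of "{0..}" "\<lambda>t. inverse_process D t \<omega>"]) auto
        then show ?case by (intro continuous_on_tendsto_compose[OF g]) auto
      qed
      show "AE \<omega> in M. norm (g (inverse_process D (\<rho> n) \<omega>)) \<le> K" for n
        using path by eventually_elim (use \<rho> g_bd in auto)
    qed auto
  qed
  have bd: "\<bar>expectation (\<lambda>\<omega>. g (inverse_process D t \<omega>))\<bar> \<le> K"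
    if g: "continuous_on UNIV g" and g_bd: "\<And>r. 0 \<le> r \<Longrightarrow> \<bar>g r\<bar> \<le> K" and t: "0 \<le> t" for g :: "real \<Rightarrow> real" and K t
  proof -
    have [measurable]: "g \<in> borel_measurable borel" by (rule borel_measurable_continuous_onI[OF g])
    note [measurable] = E_meas[OF t]
    have AE: "AE \<omega> in M. norm (g (inverse_process D t \<omega>)) \<le> K"
      using path by eventually_elim (use t g_bd in auto)
    then have int: "integrable M (\<lambda>\<omega>. g (inverse_process D t \<omega>))"
      by (rule integrable_const_bound) simp
    have "\<bar>expectation (\<lambda>\<omega>. g (inverse_process D t \<omega>))\<bar> \<le> expectation (\<lambda>\<omega>. norm (g (inverse_process D t \<omega>)))"
      using integral_norm_bound[of M "\<lambda>\<omega>. g (inverse_process D t \<omega>)"] by simp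
    also have "\<dots> \<le> expectation (\<lambda>\<omega>. K)"
      using int AE by (intro integral_mono_AE) auto
    finally show ?thesis by (simp add: prob_space)
  qed
  define Q where "Q t = expectation (\<lambda>\<omega>. \<phi> (inverse_process D t \<omega>))" for t
  define Q1 where "Q1 t = expectation (\<lambda>\<omega>. \<phi>' (inverse_process D t \<omega>))" for t
  \<comment> \<open>The inverse starts at 0 almost surely, so the initial value in the memory
    integral is the boundary term of \<open>laplace_derivative\<close>.\<close>
  have Q0: "Q 0 = \<phi> 0"
  proof -
    have [measurable]: "\<phi> \<in> borel_measurable borel" by (rule borel_measurable_continuous_onI[OF \<phi>_cont])
    have [measurable]: "inverse_process D 0 \<in> borel_measurable M" by (rule E_meas) simp
    have "Q 0 = expectation (\<lambda>\<omega>. \<phi> 0)"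
      unfolding Q_def
    proof (rule integral_cong_AE)
      show "AE \<omega> in M. \<phi> (inverse_process D 0 \<omega>) = \<phi> 0" using path by eventually_elim simp
    qed auto
    then show ?thesis by (simp add: prob_space)
  qed
  have Q_cont: "continuous_on {0..} Q" unfolding Q_def by (rule cont[OF \<phi>_cont \<phi>_bd])
  have Q1_cont: "continuous_on {0..} Q1" unfolding Q1_def by (rule cont[OF \<phi>'_cont \<phi>'_bd])
  have Q_bd: "\<bar>Q t\<bar> \<le> C" if "0 \<le> t" for t unfolding Q_def by (rule bd[OF \<phi>_cont \<phi>_bd that])
  have Q1_bd: "\<bar>Q1 t\<bar> \<le> lam * (2 * C)" if "0 \<le> t" for t unfolding Q1_def by (rule bd[OF \<phi>'_cont \<phi>'_bd that])
  have L: "laplace Q1 s = s * (b + laplace (levy_tail \<nu>) s) * laplace (\<lambda>t. Q t - Q 0) s" if s: "0 < s" for s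
  proof -
    define f where "f = bernstein_fun b \<nu> s"
    have f: "0 < f" unfolding f_def by (rule f_pos[OF s])
    have 1: "s * laplace Q s = f * laplace \<phi> f"
      unfolding Q_def[abs_def] f_def by (rule inverse_subordinator_laplace[OF D f_pos f_unb E_meas \<phi>_cont \<phi>_bd s])
    have 2: "s * laplace Q1 s = f * laplace \<phi>' f"
      unfolding Q1_def[abs_def] f_def by (rule inverse_subordinator_laplace[OF D f_pos f_unb E_meas \<phi>'_cont \<phi>'_bd s])
    have 3: "laplace \<phi>' f = f * laplace \<phi> f - \<phi> 0"
      by (rule laplace_derivative[OF \<phi>_deriv \<phi>'_cont \<phi>_bd \<phi>'_bd f])
    have Q_at: "laplace_at Q s" by (rule laplace_at_exp_bounded[OF Q_cont, of C 0]) (use Q_bd s in auto)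
    have "laplace (\<lambda>t. Q t - Q 0) s = laplace Q s - Q 0 / s"
      using s by (simp add: laplace_diff Q_at laplace_const)
    then have "s * laplace (\<lambda>t. Q t - Q 0) s = s * laplace Q s - \<phi> 0"
      using s by (simp add: Q0 right_diff_distrib)
    then have "s * (f * laplace (\<lambda>t. Q t - Q 0) s) = f * (s * laplace Q s - \<phi> 0)"
      by (simp add: mult.left_commute[of s])
    also have "\<dots> = s * laplace Q1 s" by (simp only: 1 2 3)
    finally show ?thesis
      using s levy_tail_laplace(2)[OF levy s, of b] by (simp add: f_def)
  qed
  note res = caputo_deriv_by_laplace[OF b levy_tail_laplace(1)[OF levy] levy_tail_nonneg[OF levy] Q_cont Q_bd Q1_cont Q1_bd L t]
  have "q \<gamma> = Q" by (simp add: q_def Q_def[abs_def] \<phi>_def)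
  moreover have "Q1 t = lam * q (\<lambda>n. \<gamma> (Suc n) - \<gamma> n) t"
    by (simp add: Q1_def q_def \<phi>'_def \<gamma>'_def[abs_def])
  ultimately show "caputo_differentiable b (levy_tail \<nu>) (q \<gamma>) t"
    and "caputo_deriv b (levy_tail \<nu>) (q \<gamma>) t = lam * q (\<lambda>n. \<gamma> (Suc n) - \<gamma> n) t"
    using res by simp_all
qed

subsection \<open>The Poisson process at the inverse subordinator\<close>

definition poisson_weight :: "nat \<Rightarrow> real \<Rightarrow> real" where
  "poisson_weight n z = z ^ n / fact n * exp (- z)"

lemma poisson_weight_nonneg: "0 \<le> z \<Longrightarrow> 0 \<le> poisson_weight n z"
  by (simp add: poisson_weight_def)

lemma poisson_weight_sums: "(\<lambda>n. poisson_weight n z) sums 1"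
proof -
  have "(\<lambda>n. z ^ n / fact n * exp (- z)) sums (exp z * exp (- z))"
    using exp_converges[of z] by (intro sums_mult2) (simp add: scaleR_conv_of_real divide_inverse mult.commute)
  then show ?thesis by (simp add: poisson_weight_def[abs_def] exp_minus)
qed

lemma poisson_weight_le_1: "0 \<le> z \<Longrightarrow> poisson_weight n z \<le> 1"
  using sum_le_suminf[OF sums_summable[OF poisson_weight_sums[of z]], of "{n}"] sums_unique[OF poisson_weight_sums[of z]]
  by (simp add: poisson_weight_nonneg)

lemma continuous_on_poisson_weight: "continuous_on UNIV (poisson_weight n)"
  unfolding poisson_weight_def by (intro continuous_intros) auto

lemma poisson_weight_measurable [measurable]: "poisson_weight n \<in> borel_measurable borel"
  by (rule borel_measurable_continuous_onI[OF continuous_on_poisson_weight])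

lemma pois_mix_sums:
  assumes "\<And>n. \<bar>\<gamma> n\<bar> \<le> C"
  shows "(\<lambda>n. \<gamma> n * poisson_weight n z) sums pois_mix \<gamma> z"
proof -
  have "(\<lambda>n. exp (- z) * (\<gamma> n / fact n * z ^ n)) sums pois_mix \<gamma> z"
    unfolding pois_mix_def by (intro sums_mult summable_sums pois_mix_summable(2)[OF assms])
  then show ?thesis by (simp add: poisson_weight_def mult_ac)
qed

context prob_space
begin

context
  fixes N :: "real \<Rightarrow> 'a \<Rightarrow> nat" and lam :: real
  assumes N: "poisson_process M lam N" and lam: "0 < lam"
begin

lemma poisson_process_measurable: "0 \<le> t \<Longrightarrow> N t \<in> measurable M (count_space UNIV)"
  using N by (simp add: poisson_process_def)

text \<open>The law is prescribed for increments over positive durations; as \<open>N 0 = 0\<close>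
  almost surely, the increment from 0 is the value itself.\<close>

lemma poisson_process_prob:
  assumes t: "0 < t"
  shows "prob {\<omega>\<in>space M. N t \<omega> = n} = poisson_weight n (lam * t)"
proof -
  have [measurable]: "N t \<in> measurable M (count_space UNIV)" "N 0 \<in> measurable M (count_space UNIV)"
    using t by (auto intro: poisson_process_measurable)
  have [measurable]: "(\<lambda>\<omega>. real (N s \<omega>)) \<in> borel_measurable M" if "0 \<le> s" for s
    by (rule measurable_compose[OF poisson_process_measurable[OF that]]) simp
  have [measurable]: "(\<lambda>\<omega>. real (N t \<omega>) - real (N 0 \<omega>)) \<in> borel_measurable M"
    using t by (intro borel_measurable_diff) auto
  have "\<forall>s\<ge>0. \<forall>t>0. distr M borel (\<lambda>\<omega>. real (N (s + t) \<omega>) - real (N s \<omega>)) =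
      distr (measure_pmf (poisson_pmf (lam * t))) borel real"
    using N unfolding poisson_process_def by blast
  from this[rule_format, of 0 t] t
  have eq: "distr M borel (\<lambda>\<omega>. real (N t \<omega>) - real (N 0 \<omega>)) = distr (measure_pmf (poisson_pmf (lam * t))) borel real"
    by simp
  have N0: "AE \<omega> in M. N 0 \<omega> = 0" using N by (simp add: poisson_process_def)
  have "prob {\<omega>\<in>space M. N t \<omega> = n} = prob {\<omega>\<in>space M. real (N t \<omega>) - real (N 0 \<omega>) = real n}"
    by (rule finite_measure_eq_AE) (use N0 in \<open>auto elim!: eventually_mono\<close>)
  also have "\<dots> = measure (distr M borel (\<lambda>\<omega>. real (N t \<omega>) - real (N 0 \<omega>))) {real n}"
    by (subst measure_distr) (auto intro!: arg_cong[where f=prob])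
  also have "\<dots> = measure (measure_pmf (poisson_pmf (lam * t))) {n}"
    unfolding eq by (subst measure_distr) (auto intro!: arg_cong[where f="measure _"])
  also have "\<dots> = poisson_weight n (lam * t)"
    using lam t by (simp add: measure_pmf_single poisson_weight_def)
  finally show ?thesis .
qed

context
  fixes E :: "real \<Rightarrow> 'a \<Rightarrow> real" and X :: "nat \<Rightarrow> 'a \<Rightarrow> real"
  assumes indep_N_E: "indep_rv M (path_space (count_space UNIV)) (path_of N) (path_space borel) (path_of E)"
    and indep_X: "indep_rv M (PiM {1..} (\<lambda>_. borel)) (\<lambda>\<omega>. restrict (\<lambda>i. X i \<omega>) {1..})
           (path_space (count_space UNIV) \<Otimes>\<^sub>M path_space borel) (\<lambda>\<omega>. (path_of N \<omega>, path_of E \<omega>))"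
    and E_nonneg: "\<And>t. 0 \<le> t \<Longrightarrow> AE \<omega> in M. 0 \<le> E t \<omega>"
begin

lemma path_measurable: "path_of N \<in> measurable M (path_space (count_space UNIV))"
    "path_of E \<in> measurable M (path_space borel)"
    "(\<lambda>\<omega>. restrict (\<lambda>i. X i \<omega>) {1..}) \<in> measurable M (PiM {1..} (\<lambda>_. borel))"
  using indep_N_E indep_X by (auto simp: indep_rv_def)

lemma time_change_measurable:
  assumes "0 \<le> t"
  shows "E t \<in> borel_measurable M"
proof -
  have "(\<lambda>\<omega>. path_of E \<omega> t) \<in> borel_measurable M"
    using measurable_compose[OF path_measurable(2)[unfolded path_space_def] measurable_component_singleton[of t]] assms by simp
  then show ?thesis using assms by (simp add: path_of_def)
qed

text \<open>The hypotheses split mutual independence in two: \<open>N\<close> from \<open>E\<close>,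
  and the jumps from the pair of both. A rectangle of path sets for \<open>N\<close> and
  \<open>E\<close> links them.\<close>

lemma indep_product:
  assumes \<tau>: "0 \<le> \<tau>" and t: "0 \<le> t" and U: "U \<in> sets borel" and B: "B \<in> sets (PiM {1..} (\<lambda>_. borel))"
  shows "prob {\<omega>\<in>space M. N \<tau> \<omega> = n \<and> E t \<omega> \<in> U \<and> restrict (\<lambda>i. X i \<omega>) {1..} \<in> B}
      = prob {\<omega>\<in>space M. N \<tau> \<omega> = n} * prob {\<omega>\<in>space M. E t \<omega> \<in> U} * prob {\<omega>\<in>space M. restrict (\<lambda>i. X i \<omega>) {1..} \<in> B}"
proof -
  define SN :: "(real \<Rightarrow> nat) measure" where "SN = path_space (count_space UNIV)"
  define SE :: "(real \<Rightarrow> real) measure" where "SE = path_space borel"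
  define CN where "CN = {p \<in> space SN. p \<tau> = n}"
  define CE where "CE = {p \<in> space SE. p t \<in> U}"
  have CN: "CN \<in> sets SN"
  proof -
    have [measurable]: "(\<lambda>p. p \<tau>) \<in> measurable SN (count_space UNIV)"
      unfolding SN_def path_space_def using \<tau> by (intro measurable_component_singleton) auto
    show ?thesis unfolding CN_def by measurable
  qed
  have CE: "CE \<in> sets SE"
  proof -
    have [measurable]: "(\<lambda>p. p t) \<in> borel_measurable SE"
      unfolding SE_def path_space_def using t by (intro measurable_component_singleton) auto
    show ?thesis unfolding CE_def using U by measurable
  qed
  note m = path_measurable[folded SN_def SE_def]
  let ?A = "{\<omega>\<in>space M. N \<tau> \<omega> = n}" and ?B = "{\<omega>\<in>space M. E t \<omega> \<in> U}"
    and ?C = "{\<omega>\<in>space M. restrict (\<lambda>i. X i \<omega>) {1..} \<in> B}"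
  have A: "?A = path_of N -` CN \<inter> space M"
    using \<tau> measurable_space[OF m(1)] by (auto simp: CN_def path_of_def)
  have B': "?B = path_of E -` CE \<inter> space M"
    using t measurable_space[OF m(2)] by (auto simp: CE_def path_of_def)
  have C: "?C = (\<lambda>\<omega>. restrict (\<lambda>i. X i \<omega>) {1..}) -` B \<inter> space M" by auto
  have AB: "prob (?A \<inter> ?B) = prob ?A * prob ?B"
    unfolding A B' using indep_N_E[folded SN_def SE_def] CN CE
    by (intro indep_setD[of "sets (vimage_algebra (space M) (path_of N) SN)" "sets (vimage_algebra (space M) (path_of E) SE)"])
       (auto simp: indep_rv_def intro: in_vimage_algebra)
  have AB_eq: "?A \<inter> ?B = (\<lambda>\<omega>. (path_of N \<omega>, path_of E \<omega>)) -` (CN \<times> CE) \<inter> space M"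
    unfolding A B' by auto
  have "prob (?C \<inter> (?A \<inter> ?B)) = prob ?C * prob (?A \<inter> ?B)"
    unfolding AB_eq unfolding C using indep_X[folded SN_def SE_def] CN CE B
    by (intro indep_setD[of "sets (vimage_algebra (space M) (\<lambda>\<omega>. restrict (\<lambda>i. X i \<omega>) {1..}) (PiM {1..} (\<lambda>_. borel)))"
          "sets (vimage_algebra (space M) (\<lambda>\<omega>. (path_of N \<omega>, path_of E \<omega>)) (SN \<Otimes>\<^sub>M SE))"])
       (auto simp: indep_rv_def intro: in_vimage_algebra)
  moreover have "?C \<inter> (?A \<inter> ?B) = {\<omega>\<in>space M. N \<tau> \<omega> = n \<and> E t \<omega> \<in> U \<and> restrict (\<lambda>i. X i \<omega>) {1..} \<in> B}" by auto
  ultimately show ?thesis using AB by simp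
qed

text \<open>The process \<open>N\<close> at the random time \<open>E t\<close> is approximated from the right by \<open>N\<close> at times with values
  in a countable grid.\<close>

lemma poisson_time_change_prob:
  assumes t: "0 \<le> t" and Nf: "(\<lambda>\<omega>. N (E t \<omega>) \<omega>) \<in> measurable M (count_space UNIV)"
    and B: "B \<in> sets (PiM {1..} (\<lambda>_. borel))"
  shows "prob {\<omega>\<in>space M. N (E t \<omega>) \<omega> = n \<and> restrict (\<lambda>i. X i \<omega>) {1..} \<in> B}
      = expectation (\<lambda>\<omega>. poisson_weight n (lam * E t \<omega>)) * prob {\<omega>\<in>space M. restrict (\<lambda>i. X i \<omega>) {1..} \<in> B}"
proof -
  note [measurable] = Nf time_change_measurable[OF t] path_measurable(3) B
  let ?C = "{\<omega>\<in>space M. restrict (\<lambda>i. X i \<omega>) {1..} \<in> B}"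
  \<comment> \<open>\<open>Suc\<close> places the grid time strictly to the right of
    \<open>E t\<close>, as right continuity demands, and makes it positive, as
    \<open>poisson_process_prob\<close> demands.\<close>
  define J where "J k \<omega> = Suc (nat \<lfloor>real (Suc k) * E t \<omega>\<rfloor>)" for k \<omega>
  define e where "e k j = real j / real (Suc k)" for k j :: nat
  have e_nonneg: "0 \<le> e k j" for k j by (simp add: e_def)
  have J_meas [measurable]: "J k \<in> measurable M (count_space UNIV)" for k
    unfolding J_def
    by (rule measurable_compose[OF measurable_compose[OF _ measurable_real_floor] measurable_count_space]) measurable
  have [measurable]: "N (e k j) \<in> measurable M (count_space UNIV)" for k j
    by (rule poisson_process_measurable[OF e_nonneg])
  have NJ [measurable]: "(\<lambda>\<omega>. N (e k (J k \<omega>)) \<omega>) \<in> measurable M (count_space UNIV)" for k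
    by (rule measurable_compose_countable[of "\<lambda>j \<omega>. N (e k j) \<omega>"]) measurable
  have eJ [measurable]: "(\<lambda>\<omega>. e k (J k \<omega>)) \<in> borel_measurable M" for k
    by (rule measurable_compose[OF J_meas]) simp
  define a where "a k = prob {\<omega>\<in>space M. N (e k (J k \<omega>)) \<omega> = n \<and> \<omega> \<in> ?C}" for k
  define c where "c k = expectation (\<lambda>\<omega>. poisson_weight n (lam * e k (J k \<omega>)))" for k
  have w01: "0 \<le> poisson_weight n (lam * e k j)" "poisson_weight n (lam * e k j) \<le> 1" for k j
    using lam e_nonneg by (auto intro!: poisson_weight_nonneg poisson_weight_le_1)
  \<comment> \<open>The event splits over the countably many values of \<open>J k\<close>, a
    function of \<open>E t\<close>. On each piece the Poisson process is evaluated at a fixed time,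
    so \<open>indep_product\<close> applies.\<close>
  have discrete: "a k = c k * prob ?C" for k
  proof -
    define A where "A j = {\<omega>\<in>space M. J k \<omega> = j \<and> N (e k j) \<omega> = n \<and> \<omega> \<in> ?C}" for j
    have [measurable]: "A j \<in> events" for j unfolding A_def by measurable
    have term_eq: "emeasure M (A j) = ennreal (poisson_weight n (lam * e k j)) * emeasure M {\<omega>\<in>space M. J k \<omega> = j} * emeasure M ?C" for j
    proof (cases "j = 0")
      case True
      then have *: "A j = {}" "{\<omega>\<in>space M. J k \<omega> = j} = {}" by (auto simp: A_def J_def)
      show ?thesis unfolding * by simp
    next
      case False
      then have e_pos: "0 < e k j" by (simp add: e_def)
      define U where "U = {x :: real. Suc (nat \<lfloor>real (Suc k) * x\<rfloor>) = j}"
      have U: "U \<in> sets borel"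
      proof -
        have "(\<lambda>x::real. Suc (nat \<lfloor>real (Suc k) * x\<rfloor>)) \<in> measurable borel (count_space UNIV)"
          by (rule measurable_compose[OF measurable_compose[OF _ measurable_real_floor] measurable_count_space]) measurable
        then have "(\<lambda>x::real. Suc (nat \<lfloor>real (Suc k) * x\<rfloor>)) -` {j} \<inter> space borel \<in> sets borel"
          by (rule measurable_sets) simp
        then show ?thesis by (simp add: U_def vimage_def)
      qed
      have "A j = {\<omega>\<in>space M. N (e k j) \<omega> = n \<and> E t \<omega> \<in> U \<and> restrict (\<lambda>i. X i \<omega>) {1..} \<in> B}"
        by (auto simp: A_def J_def U_def)
      moreover have "{\<omega>\<in>space M. J k \<omega> = j} = {\<omega>\<in>space M. E t \<omega> \<in> U}"
        by (auto simp: J_def U_def)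
      ultimately have "prob (A j) = poisson_weight n (lam * e k j) * prob {\<omega>\<in>space M. J k \<omega> = j} * prob ?C"
        using indep_product[OF e_nonneg t U B, of k j n] poisson_process_prob[OF e_pos, of n] by simp
      then show ?thesis using w01(1)[of k j] by (simp add: emeasure_eq_measure ennreal_mult)
    qed
    have "ennreal (a k) = emeasure M (\<Union>j. A j)"
    proof -
      have "(\<Union>j. A j) = {\<omega>\<in>space M. N (e k (J k \<omega>)) \<omega> = n \<and> \<omega> \<in> ?C}" by (auto simp: A_def)
      then show ?thesis by (simp only: a_def emeasure_eq_measure)
    qed
    also have "\<dots> = (\<Sum>j. emeasure M (A j))"
    proof (rule suminf_emeasure[symmetric])
      show "range A \<subseteq> events" by auto
      show "disjoint_family A" by (auto simp: disjoint_family_on_def A_def)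
    qed
    also have "\<dots> = (\<Sum>j. ennreal (poisson_weight n (lam * e k j)) * emeasure M {\<omega>\<in>space M. J k \<omega> = j}) * emeasure M ?C"
      unfolding term_eq by (rule ennreal_suminf_multc)
    also have "(\<Sum>j. ennreal (poisson_weight n (lam * e k j)) * emeasure M {\<omega>\<in>space M. J k \<omega> = j})
        = (\<Sum>j. \<integral>\<^sup>+\<omega>. ennreal (poisson_weight n (lam * e k j)) * indicator {\<omega>\<in>space M. J k \<omega> = j} \<omega> \<partial>M)"
      by (intro suminf_cong nn_integral_cmult_indicator[symmetric]) measurable
    also have "\<dots> = (\<integral>\<^sup>+\<omega>. (\<Sum>j. ennreal (poisson_weight n (lam * e k j)) * indicator {\<omega>\<in>space M. J k \<omega> = j} \<omega>) \<partial>M)"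
      by (rule nn_integral_suminf[symmetric]) measurable
    also have "\<dots> = (\<integral>\<^sup>+\<omega>. ennreal (poisson_weight n (lam * e k (J k \<omega>))) \<partial>M)"
    proof (rule nn_integral_cong)
      fix \<omega> assume \<omega>: "\<omega> \<in> space M"
      have "(\<Sum>j. ennreal (poisson_weight n (lam * e k j)) * indicator {\<omega>\<in>space M. J k \<omega> = j} \<omega>)
          = (\<Sum>j\<in>{J k \<omega>}. ennreal (poisson_weight n (lam * e k j)) * indicator {\<omega>\<in>space M. J k \<omega> = j} \<omega>)"
        by (rule suminf_finite) (auto simp: indicator_def)
      then show "(\<Sum>j. ennreal (poisson_weight n (lam * e k j)) * indicator {\<omega>\<in>space M. J k \<omega> = j} \<omega>)
          = ennreal (poisson_weight n (lam * e k (J k \<omega>)))" using \<omega> by simp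
    qed
    also have "\<dots> = ennreal (c k)"
      unfolding c_def using w01
      by (intro nn_integral_eq_integral integrable_const_bound[of _ 1]) auto
    finally have eq: "ennreal (a k) = ennreal (c k) * emeasure M ?C" .
    have c0: "0 \<le> c k" unfolding c_def using w01 by (intro integral_nonneg_AE) auto
    have "ennreal (a k) = ennreal (c k * prob ?C)"
      unfolding eq emeasure_eq_measure by (rule ennreal_mult[symmetric, OF c0 measure_nonneg])
    moreover have "0 \<le> a k" "0 \<le> c k * prob ?C"
      unfolding a_def by (intro measure_nonneg mult_nonneg_nonneg c0)+
    ultimately show ?thesis by (simp only: ennreal_inj)
  qed
  have J_lim: "(\<lambda>k. e k (J k \<omega>)) \<longlonglongrightarrow> E t \<omega>" "E t \<omega> < e k (J k \<omega>)" if E: "0 \<le> E t \<omega>" for \<omega> k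
  proof -
    have fl: "real (Suc k) * E t \<omega> < real (J k \<omega>)" "real (J k \<omega>) \<le> real (Suc k) * E t \<omega> + 1" for k
    proof -
      have "0 \<le> real (Suc k) * E t \<omega>" using E by simp
      then have "real (J k \<omega>) = of_int \<lfloor>real (Suc k) * E t \<omega>\<rfloor> + 1"
        unfolding J_def by (simp del: of_nat_Suc add: of_nat_Suc[of "nat _"])
      then show "real (Suc k) * E t \<omega> < real (J k \<omega>)" "real (J k \<omega>) \<le> real (Suc k) * E t \<omega> + 1"
        by linarith+
    qed
    have lower: "E t \<omega> < e k (J k \<omega>)" for k
      unfolding e_def using fl(1)[of k] by (simp add: pos_less_divide_eq mult.commute del: of_nat_Suc)
    show "E t \<omega> < e k (J k \<omega>)" by (rule lower)
    show "(\<lambda>k. e k (J k \<omega>)) \<longlonglongrightarrow> E t \<omega>"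
    proof (rule tendsto_sandwich)
      show "eventually (\<lambda>k. E t \<omega> \<le> e k (J k \<omega>)) sequentially"
        using lower by (intro always_eventually allI less_imp_le)
      show "eventually (\<lambda>k. e k (J k \<omega>) \<le> E t \<omega> + 1 / real (Suc k)) sequentially"
      proof (intro always_eventually allI)
        fix k
        have "e k (J k \<omega>) \<le> (real (Suc k) * E t \<omega> + 1) / real (Suc k)"
          unfolding e_def by (intro divide_right_mono fl) simp
        also have "\<dots> = E t \<omega> + 1 / real (Suc k)" by (simp add: add_divide_distrib del: of_nat_Suc)
        finally show "e k (J k \<omega>) \<le> E t \<omega> + 1 / real (Suc k)" .
      qed
      have "(\<lambda>k. E t \<omega> + 1 / real (Suc k)) \<longlonglongrightarrow> E t \<omega> + 0"
        by (intro tendsto_add tendsto_const LIMSEQ_Suc[OF lim_1_over_n])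
      then show "(\<lambda>k. E t \<omega> + 1 / real (Suc k)) \<longlonglongrightarrow> E t \<omega>" by simp
    qed auto
  qed
  have c_lim: "c \<longlonglongrightarrow> expectation (\<lambda>\<omega>. poisson_weight n (lam * E t \<omega>))"
    unfolding c_def
  proof (rule integral_dominated_convergence[where w="\<lambda>_. 1"])
    show "AE \<omega> in M. (\<lambda>k. poisson_weight n (lam * e k (J k \<omega>))) \<longlonglongrightarrow> poisson_weight n (lam * E t \<omega>)"
      using E_nonneg[OF t]
    proof eventually_elim
      case (elim \<omega>)
      have "(\<lambda>k. lam * e k (J k \<omega>)) \<longlonglongrightarrow> lam * E t \<omega>"
        by (intro tendsto_mult tendsto_const J_lim elim)
      then show ?case by (intro continuous_on_tendsto_compose[OF continuous_on_poisson_weight]) auto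
    qed
    show "AE \<omega> in M. norm (poisson_weight n (lam * e k (J k \<omega>))) \<le> 1" for k
      using w01 by (intro AE_I2) auto
  qed auto
  have rcont: "AE \<omega> in M. \<forall>t\<ge>0. continuous (at_right t) (\<lambda>s. real (N s \<omega>))"
    using N by (auto simp: poisson_process_def nondecreasing_rcont_paths_def elim!: eventually_mono)
  have a_lim: "a \<longlonglongrightarrow> prob {\<omega>\<in>space M. N (E t \<omega>) \<omega> = n \<and> \<omega> \<in> ?C}"
  proof -
    have ev0: "{\<omega>\<in>space M. f \<omega> = n \<and> \<omega> \<in> ?C} \<in> events"
      if f: "f \<in> measurable M (count_space UNIV)" for f :: "'a \<Rightarrow> nat"
    proof -
      have "{\<omega>\<in>space M. f \<omega> = n \<and> \<omega> \<in> ?C} = (f -` {n} \<inter> space M) \<inter> ?C" by auto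
      also have "?C \<in> events" by measurable
      then have "(f -` {n} \<inter> space M) \<inter> ?C \<in> events" by (intro sets.Int measurable_sets[OF f]) auto
      finally show ?thesis .
    qed
    note ev = ev0[OF Nf] ev0[OF NJ]
    have "(\<lambda>k. expectation (indicator {\<omega>\<in>space M. N (e k (J k \<omega>)) \<omega> = n \<and> \<omega> \<in> ?C} :: _ \<Rightarrow> real))
        \<longlonglongrightarrow> expectation (indicator {\<omega>\<in>space M. N (E t \<omega>) \<omega> = n \<and> \<omega> \<in> ?C})"
    proof (rule integral_dominated_convergence[where w="\<lambda>_. 1"])
      show "AE \<omega> in M. (\<lambda>k. indicator {\<omega>\<in>space M. N (e k (J k \<omega>)) \<omega> = n \<and> \<omega> \<in> ?C} \<omega> :: real)
          \<longlonglongrightarrow> indicator {\<omega>\<in>space M. N (E t \<omega>) \<omega> = n \<and> \<omega> \<in> ?C} \<omega>"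
        using E_nonneg[OF t] rcont
      proof eventually_elim
        case (elim \<omega>)
        have "filterlim (\<lambda>k. e k (J k \<omega>)) (at_right (E t \<omega>)) sequentially"
          unfolding filterlim_at using J_lim[OF elim(1)] by (auto intro!: always_eventually less_imp_neq[symmetric])
        moreover have "((\<lambda>s. real (N s \<omega>)) \<longlongrightarrow> real (N (E t \<omega>) \<omega>)) (at_right (E t \<omega>))"
          using elim by (auto simp: continuous_within)
        ultimately have "(\<lambda>k. real (N (e k (J k \<omega>)) \<omega>)) \<longlonglongrightarrow> real (N (E t \<omega>) \<omega>)"
          by (rule filterlim_compose[rotated])
        \<comment> \<open>The values are integers, so a convergent sequence is eventually constant
          and the indicators converge.\<close>
        then have "eventually (\<lambda>k. dist (real (N (e k (J k \<omega>)) \<omega>)) (real (N (E t \<omega>) \<omega>)) < 1) sequentially"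
          by (rule tendstoD) simp
        then have "eventually (\<lambda>k. N (e k (J k \<omega>)) \<omega> = N (E t \<omega>) \<omega>) sequentially"
          by eventually_elim (auto simp: dist_real_def)
        then have "eventually (\<lambda>k. indicator {\<omega>\<in>space M. N (e k (J k \<omega>)) \<omega> = n \<and> \<omega> \<in> ?C} \<omega>
            = (indicator {\<omega>\<in>space M. N (E t \<omega>) \<omega> = n \<and> \<omega> \<in> ?C} \<omega> :: real)) sequentially"
          by eventually_elim (simp add: indicator_def)
        then show ?case by (rule tendsto_eventually)
      qed
      show "AE \<omega> in M. norm (indicator {\<omega>\<in>space M. N (e k (J k \<omega>)) \<omega> = n \<and> \<omega> \<in> ?C} \<omega> :: real) \<le> 1" for k
        by (intro AE_I2) (auto simp: indicator_def)
    qed (rule borel_measurable_indicator[OF ev(1)] borel_measurable_indicator[OF ev(2)] integrable_const)+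
    moreover have exp_ind: "expectation (indicator F) = prob F" if "F \<in> events" for F
      using that by simp
    ultimately show ?thesis unfolding a_def by (simp only: exp_ind[OF ev(1)] exp_ind[OF ev(2)])
  qed
  have "a \<longlonglongrightarrow> expectation (\<lambda>\<omega>. poisson_weight n (lam * E t \<omega>)) * prob ?C"
    unfolding discrete[abs_def] by (intro tendsto_mult c_lim tendsto_const)
  moreover have "{\<omega>\<in>space M. N (E t \<omega>) \<omega> = n \<and> \<omega> \<in> ?C}
      = {\<omega>\<in>space M. N (E t \<omega>) \<omega> = n \<and> restrict (\<lambda>i. X i \<omega>) {1..} \<in> B}" by auto
  ultimately show ?thesis using LIMSEQ_unique[OF a_lim] by (simp only:)
qed

end
end
end

subsection \<open>The compound process\<close>

text \<open>A density is constrained only for times \<open>t \<ge> 0\<close>, and the derivatives at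
  positive times use no others. This carries results from an explicit expectation over to any
  density.\<close>

lemma caputo_cong:
  assumes eq: "\<And>r. 0 \<le> r \<Longrightarrow> u r = v r" and t: "0 < t"
  shows "caputo_differentiable b k u t \<Longrightarrow> caputo_differentiable b k v t"
    and "caputo_deriv b k u t = caputo_deriv b k v t"
proof -
  have mem: "memory_integral k u = memory_integral k v"
    unfolding memory_integral_def[abs_def]
    by (intro ext set_lebesgue_integral_cong) (auto simp: eq)
  have "eventually (\<lambda>r. u r = v r) (nhds t)"
    using eventually_nhds_in_open[of "{0<..}" t] t by (auto simp: eq elim!: eventually_mono)
  then have d: "deriv u t = deriv v t" by (rule deriv_cong_ev) simp
  have si: "set_integrable lborel {0..r} (\<lambda>s. (u (r - s) - u 0) * k s)
      = set_integrable lborel {0..r} (\<lambda>s. (v (r - s) - v 0) * k s)" for r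
    by (rule set_integrable_cong) (auto simp: eq)
  have diff: "u differentiable at t \<Longrightarrow> v differentiable at t"
    unfolding real_differentiable_def
    using has_field_derivative_transform_within_open[of u _ t "{0<..}" v] t by (auto simp: eq)
  show "caputo_differentiable b k u t \<Longrightarrow> caputo_differentiable b k v t"
    using diff by (auto simp: caputo_differentiable_def mem si)
  show "caputo_deriv b k u t = caputo_deriv b k v t"
    by (simp add: caputo_deriv_def mem d)
qed

section \<open>Mixtures over the number of jumps\<close>

context prob_space
begin

text \<open>For \<open>Z = lam * E t\<close> the numbers \<open>p n\<close> will be the
  probabilities of \<open>n\<close> jumps. The terms of the series are dominated by \<open>C\<close>
  times Poisson weights, whose expectations are summable, so the expectation passes through the
  sum.\<close>

lemma expectation_poisson_weight:
  assumes Z [measurable]: "Z \<in> borel_measurable M" and Z0: "AE \<omega> in M. 0 \<le> Z \<omega>"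
  defines "p \<equiv> (\<lambda>n. expectation (\<lambda>\<omega>. poisson_weight n (Z \<omega>)))"
  shows "0 \<le> p n" "p n \<le> 1" "summable p"
    and "(\<And>n. \<bar>\<gamma> n\<bar> \<le> C) \<Longrightarrow> (\<lambda>n. p n * \<gamma> n) sums expectation (\<lambda>\<omega>. pois_mix \<gamma> (Z \<omega>))"
proof -
  have w: "AE \<omega> in M. norm (poisson_weight n (Z \<omega>)) \<le> 1" for n
    using Z0 by eventually_elim (simp add: poisson_weight_nonneg poisson_weight_le_1)
  have w_int: "integrable M (\<lambda>\<omega>. poisson_weight n (Z \<omega>))" for n
    using w by (rule integrable_const_bound) measurable
  show p0: "0 \<le> p n" for n
    unfolding p_def by (rule integral_nonneg_AE) (use Z0 in eventually_elim, simp add: poisson_weight_nonneg)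
  have "p n \<le> expectation (\<lambda>\<omega>. 1)" for n
    unfolding p_def using w[of n] w_int[of n] by (intro integral_mono_AE) (auto elim!: eventually_mono)
  then show "p n \<le> 1" for n by (simp add: prob_space)
  show p_summ: "summable p"
  proof (rule summableI_nonneg_bounded[OF p0])
    fix k
    have "(\<Sum>n<k. p n) = expectation (\<lambda>\<omega>. \<Sum>n<k. poisson_weight n (Z \<omega>))"
      unfolding p_def using w_int by (subst Bochner_Integration.integral_sum) auto
    also have "\<dots> \<le> expectation (\<lambda>\<omega>. 1)"
    proof (rule integral_mono_AE)
      show "AE \<omega> in M. (\<Sum>n<k. poisson_weight n (Z \<omega>)) \<le> 1"
        using Z0
      proof eventually_elim
        case (elim \<omega>)
        then show ?case
          using sum_le_suminf[OF sums_summable[OF poisson_weight_sums[of "Z \<omega>"]], of "{..<k}"]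
            sums_unique[OF poisson_weight_sums[of "Z \<omega>"]] by (simp add: poisson_weight_nonneg)
      qed
    qed (use w_int in auto)
    finally show "(\<Sum>n<k. p n) \<le> 1" by (simp add: prob_space)
  qed
  show "(\<lambda>n. p n * \<gamma> n) sums expectation (\<lambda>\<omega>. pois_mix \<gamma> (Z \<omega>))" if \<gamma>: "\<And>n. \<bar>\<gamma> n\<bar> \<le> C"
  proof -
    define f where "f n \<omega> = \<gamma> n * poisson_weight n (Z \<omega>)" for n \<omega>
    have f_int: "integrable M (f n)" for n unfolding f_def using w_int by simp
    have f_norm: "AE \<omega> in M. norm (f n \<omega>) \<le> C * poisson_weight n (Z \<omega>)" for n
      using Z0 by eventually_elim (use \<gamma> in \<open>simp add: f_def abs_mult poisson_weight_nonneg mult_right_mono\<close>)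
    have 1: "AE \<omega> in M. summable (\<lambda>n. norm (f n \<omega>))"
      using Z0
    proof eventually_elim
      case (elim \<omega>)
      show ?case
      proof (rule summable_comparison_test')
        show "summable (\<lambda>n. C * poisson_weight n (Z \<omega>))"
          by (intro summable_mult sums_summable[OF poisson_weight_sums])
        show "norm (norm (f n \<omega>)) \<le> C * poisson_weight n (Z \<omega>)" for n
          using elim \<gamma> by (simp add: f_def abs_mult poisson_weight_nonneg mult_right_mono)
      qed
    qed
    have 2: "summable (\<lambda>n. \<integral>\<omega>. norm (f n \<omega>) \<partial>M)"
    proof (rule summable_comparison_test')
      show "summable (\<lambda>n. C * p n)" by (intro summable_mult p_summ)
      show "norm (\<integral>\<omega>. norm (f n \<omega>) \<partial>M) \<le> C * p n" for n
      proof -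
        have "(\<integral>\<omega>. norm (f n \<omega>) \<partial>M) \<le> (\<integral>\<omega>. C * poisson_weight n (Z \<omega>) \<partial>M)"
          using f_int f_norm w_int by (intro integral_mono_AE) auto
        then show ?thesis by (simp add: p_def)
      qed
    qed
    have "expectation (\<lambda>\<omega>. \<Sum>n. f n \<omega>) = (\<Sum>n. expectation (f n))"
      by (rule integral_suminf[OF f_int 1 2])
    moreover have "(\<Sum>n. f n \<omega>) = pois_mix \<gamma> (Z \<omega>)" for \<omega>
      unfolding f_def by (rule sums_unique[OF pois_mix_sums[OF \<gamma>], symmetric])
    moreover have "summable (\<lambda>n. expectation (f n))"
      by (rule summable_comparison_test'[OF 2]) (use integral_norm_bound[of M "f _"] in simp)
    moreover have "expectation (f n) = p n * \<gamma> n" for n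
      by (simp add: f_def[abs_def] p_def mult.commute)
    ultimately show ?thesis by (simp add: sums_iff)
  qed
qed

end

text \<open>This supplies, for fixed \<open>x\<close>, the bound independent of \<open>n\<close>
  that the lemmas on \<open>pois_mix\<close> require. The sum is finite by
  \<open>frac_series_suminf_swap\<close> with all weights equal to 1.\<close>

lemma frac_series_ml_fps_bounded:
  assumes "0 < \<beta>" "0 < \<eta>"
  shows "\<bar>frac_series \<beta> 0 (ml_fps \<eta> ^ n) x\<bar> \<le> (\<Sum>n. \<bar>frac_series \<beta> 0 (ml_fps \<eta> ^ n) x\<bar>)"
proof -
  have "summable (\<lambda>n. \<bar>frac_series \<beta> 0 (ml_fps \<eta> ^ n) x\<bar>)"
    using frac_series_suminf_swap(2)[OF assms(1), of 1 "2 * \<eta>" "\<lambda>n. ml_fps \<eta> ^ n" "\<lambda>_. 1" x]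
      sum_abs_ml_fps_power[OF assms(2)] assms(2) by simp
  from sum_le_suminf[OF this, of "{n}"] show ?thesis by simp
qed

lemma frac_series_one [simp]: "frac_series \<beta> 0 1 x = 0"
  using frac_series_monom[of \<beta> 0 1 0 x] by simp

text \<open>The form of \<open>d\<close> reflects the identity \<open>s powr \<beta> * \<phi> = \<eta> * (1 - \<phi>)\<close> for the
  Laplace transform \<open>\<phi>\<close> of the jumps.\<close>

lemma caputo_deriv_ml_mixture:
  assumes \<beta>: "0 < \<beta>" "\<beta> \<le> 1" and \<eta>: "0 < \<eta>" and p: "\<And>n. \<bar>p n\<bar> \<le> 1"
  defines "g \<equiv> (\<lambda>n x. frac_series \<beta> 0 (ml_fps \<eta> ^ n) x)"
  defines "d \<equiv> (\<lambda>n x. case n of 0 \<Rightarrow> 0 | Suc m \<Rightarrow> \<eta> * (g m x - g (Suc m) x))"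
  defines "u \<equiv> (\<lambda>x. \<Sum>n. p n * g n x)"
  shows "continuous_on {0<..} u"
    and "0 < x \<Longrightarrow> caputo_differentiable (power_drift \<beta>) (power_tail \<beta>) u x"
    and "0 < x \<Longrightarrow> caputo_deriv (power_drift \<beta>) (power_tail \<beta>) u x = (\<Sum>n. p n * d n x)"
proof -
  \<comment> \<open>The power with exponent 0 is the Dirac measure; it is dropped so that the coefficient of index 0 vanishes.\<close>
  define A where "A n = (if n = 0 then 0 else ml_fps \<eta> ^ n)" for n
  define A' where "A' n = fps_shift 1 (A n)" for n
  have A_le: "\<bar>A n $ m\<bar> \<le> \<bar>(ml_fps \<eta> ^ n) $ m\<bar>" for n m by (simp add: A_def)
  have A_sum: "(\<Sum>n\<le>N. \<bar>A n $ m\<bar>) \<le> (2 * \<eta>) ^ m" for N m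
    by (rule order_trans[OF sum_mono[OF A_le] sum_abs_ml_fps_power[OF \<eta>]])
  have A_sum1: "(\<Sum>n\<le>N. \<bar>A n $ m\<bar>) \<le> 1 * (2 * \<eta>) ^ m" for N m using A_sum by simp
  have A'_sum: "(\<Sum>n\<le>N. \<bar>A' n $ m\<bar>) \<le> (2 * \<eta>) * (2 * \<eta>) ^ m" for N m
    using A_sum[of "Suc m" N] by (simp add: A'_def)
  have ml: "geom_bdd (ml_fps \<eta> ^ n)" for n by (intro geom_bdd_power geom_bdd_ml_fps \<eta>)
  have zero: "frac_series \<beta> 0 0 x = 0" for x by (simp add: frac_series_def)
  have gA: "frac_series \<beta> 0 (A n) x = g n x" for n x
    by (cases "n = 0") (auto simp: A_def g_def zero)
  have dA': "frac_series \<beta> 0 (A' n) x = d n x" for n x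
  proof (cases n)
    case 0
    then show ?thesis by (simp add: A'_def A_def d_def zero)
  next
    case (Suc m)
    have "frac_series \<beta> 0 (A' n) x = frac_series \<beta> 0 (fps_const \<eta> * (ml_fps \<eta> ^ m - ml_fps \<eta> ^ Suc m)) x"
      using ml_fps_power_shift[of \<eta> m] by (simp add: Suc A'_def A_def)
    also have "\<dots> = \<eta> * (g m x - g (Suc m) x)"
    proof -
      have "geom_bdd (ml_fps \<eta> ^ m - ml_fps \<eta> ^ Suc m)"
      proof -
        have "fps_shift 1 (ml_fps \<eta> ^ Suc m) = fps_const \<eta> * (ml_fps \<eta> ^ m - ml_fps \<eta> ^ Suc m)"
          by (rule ml_fps_power_shift)
        then have "ml_fps \<eta> ^ m - ml_fps \<eta> ^ Suc m = fps_const (1 / \<eta>) * fps_shift 1 (ml_fps \<eta> ^ Suc m)"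
          using \<eta> by (simp add: mult.assoc[symmetric] del: power_Suc)
        moreover have "geom_bdd (fps_const (1 / \<eta>) * fps_shift 1 (ml_fps \<eta> ^ Suc m))"
          using geom_bdd_monom[of "1 / \<eta>" 0] by (intro geom_bdd_mult geom_bdd_shift ml) simp
        ultimately show ?thesis by simp
      qed
      then show ?thesis
        by (subst frac_series_cmult[OF \<beta>(1) order.refl]) (simp_all add: frac_series_diff \<beta> ml g_def del: power_Suc)
    qed
    finally show ?thesis by (simp add: d_def Suc)
  qed
  \<comment> \<open>The mixture is collected into a single formal series. Since the shift acts
    coefficientwise, its Caputo derivative involves no differentiation under the sum over
    \<open>n\<close>.\<close>
  define B where "B = Abs_fps (\<lambda>m. \<Sum>n. p n * A n $ m)"
  have K: "0 \<le> (1 :: real)" "0 < 2 * \<eta>" "0 \<le> 2 * \<eta>" using \<eta> by auto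
  have swap: "geom_bdd B" "frac_series \<beta> 0 B x = (\<Sum>n. p n * g n x)" for x
    using frac_series_suminf_swap(1)[OF \<beta>(1) K(1,2) A_sum1 p]
      frac_series_suminf_swap(3)[OF \<beta>(1) K(1,2) A_sum1 p, where x=x]
    unfolding B_def gA by simp_all
  have u: "u = frac_series \<beta> 0 B"
    unfolding u_def by (simp add: fun_eq_iff swap(2))
  have "A n $ 0 = 0" for n by (cases n) (auto simp: A_def)
  then have B0: "B $ 0 = 0" by (simp add: B_def)
  have B_shift: "fps_shift 1 B = Abs_fps (\<lambda>m. \<Sum>n. p n * A' n $ m)"
    by (rule fps_ext) (simp add: B_def A'_def)
  show "continuous_on {0<..} u"
    unfolding u by (rule frac_series_continuous_on[OF \<beta>(1) order.refl swap(1)])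
  assume x: "0 < x"
  show "caputo_differentiable (power_drift \<beta>) (power_tail \<beta>) u x"
    unfolding u by (rule frac_series_caputo(1)[OF \<beta> swap(1) B0 x])
  have "caputo_deriv (power_drift \<beta>) (power_tail \<beta>) u x = frac_series \<beta> 0 (fps_shift 1 B) x"
    unfolding u by (rule frac_series_caputo(2)[OF \<beta> swap(1) B0 x])
  also have "\<dots> = (\<Sum>n. p n * d n x)"
    unfolding B_shift by (rule frac_series_suminf_swap(3)[OF \<beta>(1) K(3,2) A'_sum p, unfolded dA'])
  finally show "caputo_deriv (power_drift \<beta>) (power_tail \<beta>) u x = (\<Sum>n. p n * d n x)" .
qed

text \<open>Decomposition by the value \<open>n\<close> of \<open>N (E t)\<close>, which is
  independent of the jumps. For \<open>n = 0\<close> the sum is 0 and thus outside \<open>A\<close>,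
  in agreement with the value 0 of the zeroth function in the mixture.\<close>

lemma (in prob_space) compound_process_emeasure:
  fixes N :: "real \<Rightarrow> 'a \<Rightarrow> nat" and E :: "real \<Rightarrow> 'a \<Rightarrow> real" and X :: "nat \<Rightarrow> 'a \<Rightarrow> real"
  assumes N: "poisson_process M lam N" and lam: "0 < lam"
    and indep_N_E: "indep_rv M (path_space (count_space UNIV)) (path_of N) (path_space borel) (path_of E)"
    and indep_X: "indep_rv M (PiM {1..} (\<lambda>_. borel)) (\<lambda>\<omega>. restrict (\<lambda>i. X i \<omega>) {1..})
           (path_space (count_space UNIV) \<Otimes>\<^sub>M path_space borel) (\<lambda>\<omega>. (path_of N \<omega>, path_of E \<omega>))"
    and E_nonneg: "\<And>t. 0 \<le> t \<Longrightarrow> AE \<omega> in M. 0 \<le> E t \<omega>"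
    and t: "0 \<le> t" and Nf: "(\<lambda>\<omega>. N (E t \<omega>) \<omega>) \<in> measurable M (count_space UNIV)"
    and \<beta>: "0 < \<beta>" "\<beta> \<le> 1" and \<eta>: "0 < \<eta>"
    and X: "\<And>i. 1 \<le> i \<Longrightarrow> distributed M lborel (X i) (\<lambda>x. ennreal (mittag_leffler_density \<beta> \<eta> x))"
    and X_indep: "indep_vars (\<lambda>_. borel) X {1::nat..}"
    and A: "A \<in> sets borel" "A \<subseteq> {0<..}"
  shows "emeasure M {\<omega>\<in>space M. compound_process (\<lambda>t \<omega>. N (E t \<omega>) \<omega>) X t \<omega> \<in> A}
    = (\<integral>\<^sup>+x. ennreal (expectation (\<lambda>\<omega>. pois_mix (\<lambda>n. frac_series \<beta> 0 (ml_fps \<eta> ^ n) x) (lam * E t \<omega>))) * indicator A x \<partial>lborel)"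
proof -
  define g where "g n x = frac_series \<beta> 0 (ml_fps \<eta> ^ n) x" for n x
  have [measurable]: "g n \<in> borel_measurable borel" for n unfolding g_def by measurable
  have g0: "0 \<le> g n x" for n x unfolding g_def by (rule ml_fps_power_convolution(1)[OF \<beta> \<eta>])
  note E_meas = time_change_measurable[OF N lam indep_N_E indep_X E_nonneg t]
  note [measurable] = E_meas Nf path_measurable(3)[OF N lam indep_N_E indep_X E_nonneg] A(1)
  define p where "p n = expectation (\<lambda>\<omega>. poisson_weight n (lam * E t \<omega>))" for n
  have Z: "(\<lambda>\<omega>. lam * E t \<omega>) \<in> borel_measurable M" "AE \<omega> in M. 0 \<le> lam * E t \<omega>"
    using E_nonneg[OF t] lam by (auto elim!: eventually_mono)
  note p = expectation_poisson_weight[OF Z, folded p_def]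
  define S where "S n = {f \<in> space (PiM {1..} (\<lambda>_. borel)). (\<Sum>i\<in>{1..n}. f i) \<in> A}" for n :: nat
  have S [measurable]: "S n \<in> sets (PiM {1..} (\<lambda>_. borel))" for n
  proof -
    have "(\<lambda>f. \<Sum>i\<in>{1..n}. f i) \<in> borel_measurable (PiM {1..} (\<lambda>_. borel :: real measure))"
      by (intro borel_measurable_sum measurable_component_singleton) auto
    then show ?thesis unfolding S_def using A(1) by measurable
  qed
  have RS: "restrict (\<lambda>i. X i \<omega>) {1..} \<in> S n \<longleftrightarrow> (\<Sum>i\<in>{1..n}. X i \<omega>) \<in> A" for \<omega> n
    by (simp add: S_def space_PiM)
  define T where "T n = {\<omega>\<in>space M. N (E t \<omega>) \<omega> = n \<and> restrict (\<lambda>i. X i \<omega>) {1..} \<in> S n}" for n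
  have [measurable]: "T n \<in> events" for n unfolding T_def by measurable
  have XS: "emeasure M {\<omega>\<in>space M. restrict (\<lambda>i. X i \<omega>) {1..} \<in> S n} = (\<integral>\<^sup>+x. ennreal (g n x) * indicator A x \<partial>lborel)" for n
  proof (cases "n = 0")
    case True
    then have *: "{\<omega>\<in>space M. restrict (\<lambda>i. X i \<omega>) {1..} \<in> S n} = {}" unfolding RS using A by auto
    show ?thesis unfolding * using True by (simp add: g_def)
  next
    case False
    have "{\<omega>\<in>space M. restrict (\<lambda>i. X i \<omega>) {1..} \<in> S n} = (\<lambda>\<omega>. \<Sum>i\<in>{1..n}. X i \<omega>) -` A \<inter> space M"
      unfolding RS by auto
    also have "emeasure M \<dots> = (\<integral>\<^sup>+x. ennreal (g n x) * indicator A x \<partial>lborel)"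
      unfolding g_def using False A
      by (intro distributed_emeasure distributed_sum_mittag_leffler[OF \<beta> \<eta> X X_indep]) auto
    finally show ?thesis .
  qed
  have T: "emeasure M (T n) = (\<integral>\<^sup>+x. ennreal (p n * g n x) * indicator A x \<partial>lborel)" for n
  proof -
    have "emeasure M (T n) = ennreal (p n) * emeasure M {\<omega>\<in>space M. restrict (\<lambda>i. X i \<omega>) {1..} \<in> S n}"
      using poisson_time_change_prob[OF N lam indep_N_E indep_X E_nonneg t Nf S, of n n] p(1)[of n]
      by (simp add: T_def emeasure_eq_measure p_def[symmetric] ennreal_mult)
    also have "\<dots> = (\<integral>\<^sup>+x. ennreal (p n) * (ennreal (g n x) * indicator A x) \<partial>lborel)"
      unfolding XS by (rule nn_integral_cmult[symmetric]) measurable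
    finally show ?thesis using p(1) g0 by (simp add: ennreal_mult mult.assoc)
  qed
  have "{\<omega>\<in>space M. compound_process (\<lambda>t \<omega>. N (E t \<omega>) \<omega>) X t \<omega> \<in> A} = (\<Union>n. T n)"
    unfolding T_def RS compound_process_def by auto
  also have "emeasure M \<dots> = (\<Sum>n. emeasure M (T n))"
  proof (rule suminf_emeasure[symmetric])
    show "range T \<subseteq> events" by auto
    show "disjoint_family T" by (auto simp: disjoint_family_on_def T_def)
  qed
  also have "\<dots> = (\<integral>\<^sup>+x. (\<Sum>n. ennreal (p n * g n x) * indicator A x) \<partial>lborel)"
    unfolding T by (rule nn_integral_suminf[symmetric]) measurable
  also have "\<dots> = (\<integral>\<^sup>+x. ennreal (expectation (\<lambda>\<omega>. pois_mix (\<lambda>n. g n x) (lam * E t \<omega>))) * indicator A x \<partial>lborel)"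
  proof (rule nn_integral_cong)
    fix x
    have sums: "(\<lambda>n. p n * g n x) sums expectation (\<lambda>\<omega>. pois_mix (\<lambda>n. g n x) (lam * E t \<omega>))"
      unfolding g_def by (rule p(4)[OF frac_series_ml_fps_bounded[OF \<beta>(1) \<eta>]])
    have "(\<Sum>n. ennreal (p n * g n x)) = ennreal (\<Sum>n. p n * g n x)"
      using p(1) g0 by (intro suminf_ennreal2 sums_summable[OF sums]) auto
    then show "(\<Sum>n. ennreal (p n * g n x) * indicator A x)
        = ennreal (expectation (\<lambda>\<omega>. pois_mix (\<lambda>n. g n x) (lam * E t \<omega>))) * indicator A x"
      by (simp add: ennreal_suminf_multc sums_unique[OF sums, symmetric])
  qed
  finally show ?thesis by (simp add: g_def)
qed

text \<open>Existence is claimed separately so that the statement about all densities is not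
  vacuous. Continuity on \<open>{0<..}\<close> makes the density unique at nonnegative times, hence
  an explicit one decides everything.\<close>

theorem theorem4p3:
  fixes M :: "'a measure"
    and b lam \<beta> \<eta> :: real
    and \<nu> :: "real measure"
    and D E :: "real \<Rightarrow> 'a \<Rightarrow> real"
    and N Nf :: "real \<Rightarrow> 'a \<Rightarrow> nat"
    and X :: "nat \<Rightarrow> 'a \<Rightarrow> real"
    and Y :: "real \<Rightarrow> 'a \<Rightarrow> real"
  defines "E \<equiv> inverse_process D"
    and "Nf \<equiv> (\<lambda>t \<omega>. N (E t \<omega>) \<omega>)"
    and "Y \<equiv> compound_process Nf X"
  assumes "prob_space M"
    and "0 \<le> b"
    and "subordinator_levy_measure \<nu>"
    and "emeasure \<nu> {0<..} = \<infinity>"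
    and "levy_subordinator M (bernstein_fun b \<nu>) D"
    and "0 < lam"
    and "poisson_process M lam N"
    and "\<And>t. 0 \<le> t \<Longrightarrow> Nf t \<in> measurable M (count_space UNIV)"
    and "0 < \<beta>" "\<beta> \<le> 1" "0 < \<eta>"
    and "\<And>i. 1 \<le> i \<Longrightarrow> distributed M lborel (X i) (\<lambda>x. ennreal (mittag_leffler_density \<beta> \<eta> x))"
    and "prob_space.indep_vars M (\<lambda>_. borel) X {1..}"
    and "indep_rv M (path_space (count_space UNIV)) (path_of N)
           (path_space borel) (path_of E)"
    and "indep_rv M (PiM {1..} (\<lambda>_. borel)) (\<lambda>\<omega>. restrict (\<lambda>i. X i \<omega>) {1..})
           (path_space (count_space UNIV) \<Otimes>\<^sub>M path_space borel) (\<lambda>\<omega>. (path_of N \<omega>, path_of E \<omega>))"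
  shows "(\<exists>P. density_on_pos M Y P) \<and>
    (\<forall>P. density_on_pos M Y P \<longrightarrow>
      (let Dt = caputo_deriv b (levy_tail \<nu>);
           Dx = caputo_deriv (power_drift \<beta>) (power_tail \<beta>);
           DxP = (\<lambda>x t. Dx (\<lambda>y. P y t) x)
       in (\<forall>x>0. \<forall>t>0.
             caputo_differentiable (power_drift \<beta>) (power_tail \<beta>) (\<lambda>y. P y t) x \<and>
             caputo_differentiable b (levy_tail \<nu>) (\<lambda>r. P x r) t \<and>
             caputo_differentiable b (levy_tail \<nu>) (\<lambda>r. DxP x r) t \<and>
             \<eta> * Dt (\<lambda>r. P x r) t = - (lam * DxP x t + Dt (\<lambda>r. DxP x r) t)) \<and>
          (\<forall>x>0. P x 0 = 0))) \<and>
    (\<forall>t\<ge>0. prob_space.prob M {\<omega> \<in> space M. Y t \<omega> > 0} =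
             1 - prob_space.expectation M (\<lambda>\<omega>. exp (- lam * E t \<omega>)))"
proof -
  interpret prob_space M by fact
  note b = \<open>0 \<le> b\<close> and levy = \<open>subordinator_levy_measure \<nu>\<close> and inf = \<open>emeasure \<nu> {0<..} = \<infinity>\<close>
    and D = \<open>levy_subordinator M (bernstein_fun b \<nu>) D\<close> and lam = \<open>0 < lam\<close> and N = \<open>poisson_process M lam N\<close>
    and \<beta> = \<open>0 < \<beta>\<close> \<open>\<beta> \<le> 1\<close> and \<eta> = \<open>0 < \<eta>\<close>
  note Nf_meas = assms(11)
  note X = assms(15) and X_indep = assms(16) and indep_N_E = assms(17) and indep_X = assms(18)
  have path: "AE \<omega> in M. continuous_on {0..} (\<lambda>t. E t \<omega>) \<and> (\<forall>t\<ge>0. 0 \<le> E t \<omega>) \<and> E 0 \<omega> = 0"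
    unfolding E_def
    by (rule inverse_subordinator_AE[OF D bernstein_fun_pos[OF levy b inf] bernstein_fun_unbounded[OF levy b inf]])
  have E_nonneg: "AE \<omega> in M. 0 \<le> E t \<omega>" if "0 \<le> t" for t
    using path by eventually_elim (use that in auto)
  have Nf: "(\<lambda>\<omega>. N (E t \<omega>) \<omega>) \<in> measurable M (count_space UNIV)" if "0 \<le> t" for t
    using Nf_meas[OF that] by (simp add: Nf_def)
  have E_meas: "E t \<in> borel_measurable M" if "0 \<le> t" for t
    by (rule time_change_measurable[OF N lam indep_N_E indep_X E_nonneg that])
  have Y_eq: "Y t = compound_process (\<lambda>t \<omega>. N (E t \<omega>) \<omega>) X t" for t by (simp add: Y_def Nf_def)
  have X_meas: "X i \<in> borel_measurable M" if "1 \<le> i" for i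
    using distributed_measurable[OF X[OF that]] by simp
  have Y_meas: "Y t \<in> borel_measurable M" if t: "0 \<le> t" for t
    unfolding Y_eq compound_process_def
    by (rule measurable_compose_countable[of "\<lambda>n \<omega>. \<Sum>i\<in>{1..n}. X i \<omega>", OF _ Nf[OF t]])
       (intro borel_measurable_sum X_meas, simp)

  \<comment> \<open>The explicit density and its derivative in space\<close>
  define p where "p t n = expectation (\<lambda>\<omega>. poisson_weight n (lam * E t \<omega>))" for t n
  define q where "q \<gamma> t = expectation (\<lambda>\<omega>. pois_mix \<gamma> (lam * E t \<omega>))" for \<gamma> t
  define g where "g n x = frac_series \<beta> 0 (ml_fps \<eta> ^ n) x" for n x
  define d where "d n x = (case n of 0 \<Rightarrow> 0 | Suc m \<Rightarrow> \<eta> * (g m x - g (Suc m) x))" for n x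
  define C where "C x = (\<Sum>n. \<bar>g n x\<bar>)" for x
  have gC: "\<bar>g n x\<bar> \<le> C x" for n x
    unfolding g_def C_def by (rule frac_series_ml_fps_bounded[OF \<beta>(1) \<eta>])
  have C0: "0 \<le> C x" for x using gC[of 0 x] by simp
  have dC: "\<bar>d n x\<bar> \<le> \<eta> * (2 * C x)" for n x
  proof (cases n)
    case 0
    then show ?thesis using C0 \<eta> by (simp add: d_def)
  next
    case (Suc m)
    have "\<bar>g m x - g (Suc m) x\<bar> \<le> 2 * C x" using gC[of m x] gC[of "Suc m" x] by linarith
    then show ?thesis using \<eta> by (simp add: d_def Suc abs_mult)
  qed
  have Z: "(\<lambda>\<omega>. lam * E t \<omega>) \<in> borel_measurable M" "AE \<omega> in M. 0 \<le> lam * E t \<omega>" if "0 \<le> t" for t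
    using E_nonneg[OF that] E_meas[OF that] lam by (auto elim!: eventually_mono)
  have p0: "0 \<le> p t n" and p1: "\<bar>p t n\<bar> \<le> 1" if "0 \<le> t" for t n
    using expectation_poisson_weight(1,2)[OF Z[OF that], of n] by (auto simp: p_def)
  have q_sums: "(\<lambda>n. p t n * \<gamma> n) sums q \<gamma> t" if "0 \<le> t" "\<And>n. \<bar>\<gamma> n\<bar> \<le> K" for t \<gamma> K
    unfolding p_def q_def by (rule expectation_poisson_weight(4)[OF Z[OF that(1)] that(2)])
  have q_caputo: "caputo_differentiable b (levy_tail \<nu>) (q \<gamma>) t"
    "caputo_deriv b (levy_tail \<nu>) (q \<gamma>) t = lam * q (\<lambda>n. \<gamma> (Suc n) - \<gamma> n) t"
    if "\<And>n. \<bar>\<gamma> n\<bar> \<le> K" "0 < t" for \<gamma> K t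
    using caputo_deriv_poisson_mixture[OF levy b inf D E_meas[unfolded E_def] lam that]
    by (simp_all add: q_def[abs_def] E_def)

  \<comment> \<open>As an expectation of a Poisson mixture this is open to the time derivative;
    \<open>P0_sum\<close> provides the series needed for the space derivative.\<close>
  define P0 where "P0 x t = q (\<lambda>n. g n x) t" for x t
  have P0_sum: "P0 x t = (\<Sum>n. p t n * g n x)" if "0 \<le> t" for x t
    unfolding P0_def by (rule sums_unique[OF q_sums[OF that gC]])
  have mixture: "continuous_on {0<..} (\<lambda>y. P0 y t)"
      "0 < x \<Longrightarrow> caputo_differentiable (power_drift \<beta>) (power_tail \<beta>) (\<lambda>y. P0 y t) x"
      "0 < x \<Longrightarrow> caputo_deriv (power_drift \<beta>) (power_tail \<beta>) (\<lambda>y. P0 y t) x = q (\<lambda>n. d n x) t"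
    if t: "0 \<le> t" for x t
  proof -
    note mix = caputo_deriv_ml_mixture[OF \<beta> \<eta> p1[OF t], folded g_def, folded d_def]
    show "continuous_on {0<..} (\<lambda>y. P0 y t)"
      unfolding P0_sum[OF t] by (rule mix(1))
    assume x: "0 < x"
    show "caputo_differentiable (power_drift \<beta>) (power_tail \<beta>) (\<lambda>y. P0 y t) x"
      unfolding P0_sum[OF t] by (rule mix(2)[OF x])
    have "q (\<lambda>n. d n x) t = (\<Sum>n. p t n * d n x)" by (rule sums_unique[OF q_sums[OF t dC]])
    then show "caputo_deriv (power_drift \<beta>) (power_tail \<beta>) (\<lambda>y. P0 y t) x = q (\<lambda>n. d n x) t"
      unfolding P0_sum[OF t] using mix(3)[OF x] by simp
  qed
  have g_nonneg: "0 \<le> g n x" for n x unfolding g_def by (rule ml_fps_power_convolution(1)[OF \<beta> \<eta>])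
  have P0_nonneg: "0 \<le> P0 x t" if "0 \<le> t" for x t
    unfolding P0_sum[OF that]
    by (rule suminf_nonneg[OF sums_summable[OF q_sums[OF that gC]]]) (intro mult_nonneg_nonneg p0 that g_nonneg)
  have P0_nonpos: "P0 x t = 0" if "x \<le> 0" for x t
    using that by (simp add: P0_def q_def g_def pois_mix_def)
  have meas: "(\<lambda>x. F x) \<in> borel_measurable borel"
    if "continuous_on {0<..} F" "\<And>x. x \<le> 0 \<Longrightarrow> F x = 0" for F :: "real \<Rightarrow> real"
  proof -
    have "(\<lambda>x. indicator {0<..} x *\<^sub>R F x) \<in> borel_measurable borel"
      by (intro borel_measurable_continuous_on_indicator that) simp
    moreover have "(\<lambda>x. indicator {0<..} x *\<^sub>R F x) = F"
      using that(2) by (auto simp: fun_eq_iff indicator_def not_less)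
    ultimately show ?thesis by simp
  qed
  have density: "density (distr M borel (Y t)) (indicator {0<..}) = density lborel (\<lambda>x. ennreal (P0 x t))"
    if t: "0 \<le> t" for t
  proof (rule measure_eqI)
    note [measurable] = Y_meas[OF t] meas[OF mixture(1)[OF t] P0_nonpos]
    fix A assume "A \<in> sets (density (distr M borel (Y t)) (indicator {0<..}))"
    then have A [measurable]: "A \<in> sets borel" by simp
    have "emeasure (density (distr M borel (Y t)) (indicator {0<..})) A
        = (\<integral>\<^sup>+x. indicator {0<..} x * indicator A x \<partial>distr M borel (Y t))"
      by (rule emeasure_density) auto
    also have "\<dots> = (\<integral>\<^sup>+x. indicator (A \<inter> {0<..}) x \<partial>distr M borel (Y t))"
      by (rule nn_integral_cong) (auto simp: indicator_def)
    also have "\<dots> = emeasure (distr M borel (Y t)) (A \<inter> {0<..})"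
      by (rule nn_integral_indicator) simp
    also have "\<dots> = emeasure M {\<omega>\<in>space M. Y t \<omega> \<in> A \<inter> {0<..}}"
    proof -
      have "Y t -` (A \<inter> {0<..}) \<inter> space M = {\<omega>\<in>space M. Y t \<omega> \<in> A \<inter> {0<..}}" by auto
      then show ?thesis by (subst emeasure_distr) simp_all
    qed
    also have "\<dots> = (\<integral>\<^sup>+x. ennreal (P0 x t) * indicator (A \<inter> {0<..}) x \<partial>lborel)"
      unfolding Y_eq P0_def q_def g_def
      by (rule compound_process_emeasure[OF N lam indep_N_E indep_X E_nonneg t Nf[OF t] \<beta> \<eta> X X_indep]) auto
    also have "\<dots> = emeasure (density lborel (\<lambda>x. ennreal (P0 x t))) A"
      by (subst emeasure_density) (auto intro!: nn_integral_cong simp: indicator_def P0_nonpos)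
    finally show "emeasure (density (distr M borel (Y t)) (indicator {0<..})) A
        = emeasure (density lborel (\<lambda>x. ennreal (P0 x t))) A" .
  qed simp
  have "density_on_pos M Y P0"
    unfolding density_on_pos_def using P0_nonneg P0_nonpos mixture(1) density by blast
  moreover
  \<comment> \<open>Two densities agree almost everywhere; continuity extends this to all of
    \<open>{0<..}\<close>, and on the rest both are 0.\<close>
  have unique: "P x t = P0 x t" if P: "density_on_pos M Y P" and t: "0 \<le> t" for P x t
  proof (cases "0 < x")
    case True
    have P_props: "\<And>x. 0 \<le> P x t" "\<And>x. x \<le> 0 \<Longrightarrow> P x t = 0" "continuous_on {0<..} (\<lambda>x. P x t)"
      "density (distr M borel (Y t)) (indicator {0<..}) = density lborel (\<lambda>x. ennreal (P x t))"
      using P t by (auto simp: density_on_pos_def)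
    note [measurable] = meas[OF P_props(3,2)] meas[OF mixture(1)[OF t] P0_nonpos]
    have "AE x in lborel. ennreal (P x t) = ennreal (P0 x t)"
      using P_props(4) density[OF t] by (intro sigma_finite_measure.density_unique[OF sigma_finite_lborel]) auto
    then have "AE x in lborel. x \<in> {0<..} \<longrightarrow> P x t = P0 x t"
      by eventually_elim (use P_props(1) P0_nonneg[OF t] in auto)
    then show ?thesis
      using continuous_AE_eq_imp_eq[OF open_greaterThan P_props(3) mixture(1)[OF t], of x] True by simp
  next
    case False
    then show ?thesis using P t P0_nonpos[of x t] by (auto simp: density_on_pos_def)
  qed

  \<comment> \<open>The differential equation and the initial value\<close>
  have "(let Dt = caputo_deriv b (levy_tail \<nu>);
           Dx = caputo_deriv (power_drift \<beta>) (power_tail \<beta>);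
           DxP = (\<lambda>x t. Dx (\<lambda>y. P y t) x)
       in (\<forall>x>0. \<forall>t>0.
             caputo_differentiable (power_drift \<beta>) (power_tail \<beta>) (\<lambda>y. P y t) x \<and>
             caputo_differentiable b (levy_tail \<nu>) (\<lambda>r. P x r) t \<and>
             caputo_differentiable b (levy_tail \<nu>) (\<lambda>r. DxP x r) t \<and>
             \<eta> * Dt (\<lambda>r. P x r) t = - (lam * DxP x t + Dt (\<lambda>r. DxP x r) t)) \<and>
          (\<forall>x>0. P x 0 = 0))" if P: "density_on_pos M Y P" for P
    unfolding Let_def
  proof (intro conjI allI impI)
    fix x :: real assume x: "0 < x"
    have "P x 0 = P0 x 0" by (rule unique[OF P]) simp
    \<comment> \<open>At time 0 the Poisson mean is 0, so only the function of index 0 survives, and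
      that one is 0.\<close>
    also have "\<dots> = expectation (\<lambda>\<omega>. g 0 x)"
    proof -
      have "continuous_on UNIV (pois_mix (\<lambda>n. g n x))"
        using pois_mix_has_derivative[OF gC] by (auto intro!: continuous_at_imp_continuous_on DERIV_isCont)
      then have [measurable]: "pois_mix (\<lambda>n. g n x) \<in> borel_measurable borel"
        by (rule borel_measurable_continuous_onI)
      note [measurable] = Z(1)[OF order.refl]
      have "AE \<omega> in M. pois_mix (\<lambda>n. g n x) (lam * E 0 \<omega>) = g 0 x"
        using path by eventually_elim simp
      then show ?thesis unfolding P0_def q_def by (intro integral_cong_AE) auto
    qed
    also have "\<dots> = 0" by (simp add: g_def)
    finally show "P x 0 = 0" .
    fix t :: real assume t: "0 < t"
    then have t0: "0 \<le> t" by simp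
    have Pt: "(\<lambda>y. P y r) = (\<lambda>y. P0 y r)" if "0 \<le> r" for r using unique[OF P that] by auto
    show "caputo_differentiable (power_drift \<beta>) (power_tail \<beta>) (\<lambda>y. P y t) x"
      unfolding Pt[OF t0] by (rule mixture(2)[OF t0 x])
    have Pq: "q (\<lambda>n. g n x) r = P x r" if "0 \<le> r" for r using unique[OF P that, of x] by (simp add: P0_def)
    show "caputo_differentiable b (levy_tail \<nu>) (\<lambda>r. P x r) t"
      by (rule caputo_cong(1)[OF Pq t q_caputo(1)[OF gC t]])
    define DxP where "DxP r = caputo_deriv (power_drift \<beta>) (power_tail \<beta>) (\<lambda>y. P y r) x" for r
    have Dq: "q (\<lambda>n. d n x) r = DxP r" if "0 \<le> r" for r
      unfolding DxP_def Pt[OF that] by (rule mixture(3)[OF that x, symmetric])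
    show "caputo_differentiable b (levy_tail \<nu>) (\<lambda>r. caputo_deriv (power_drift \<beta>) (power_tail \<beta>) (\<lambda>y. P y r) x) t"
      unfolding DxP_def[symmetric] by (rule caputo_cong(1)[OF Dq t q_caputo(1)[OF dC t]])
    have 1: "caputo_deriv b (levy_tail \<nu>) (\<lambda>r. P x r) t = lam * q (\<lambda>n. g (Suc n) x - g n x) t"
      using caputo_cong(2)[of "q (\<lambda>n. g n x)" "P x", OF Pq t] q_caputo(2)[of "\<lambda>n. g n x", OF gC t] by simp
    have 2: "caputo_deriv b (levy_tail \<nu>) DxP t = lam * q (\<lambda>n. d (Suc n) x - d n x) t"
      using caputo_cong(2)[of "q (\<lambda>n. d n x)" DxP, OF Dq t] q_caputo(2)[of "\<lambda>n. d n x", OF dC t] by simp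
    have dC': "\<bar>d (Suc n) x - d n x\<bar> \<le> 2 * (\<eta> * (2 * C x))" for n
      using dC[of n x] dC[of "Suc n" x] by linarith
    have gC': "\<bar>g (Suc n) x - g n x\<bar> \<le> 2 * C x" for n
      using gC[of n x] gC[of "Suc n" x] by linarith
    \<comment> \<open>Adding the sequence \<open>d\<close> to its forward difference leaves
      \<open>d (Suc n)\<close>, which is \<open>\<eta> * (g n x - g (Suc n) x)\<close> by
      definition. Only successor indices remain, so \<open>n = 0\<close> is no special case.\<close>
    have "(\<lambda>n. p t n * d n x + p t n * (d (Suc n) x - d n x)) sums (q (\<lambda>n. d n x) t + q (\<lambda>n. d (Suc n) x - d n x) t)"
      by (intro sums_add q_sums[OF t0 dC] q_sums[OF t0 dC'])
    moreover have "(\<lambda>n. - \<eta> * (p t n * (g (Suc n) x - g n x))) sums (- \<eta> * q (\<lambda>n. g (Suc n) x - g n x) t)"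
      by (intro sums_mult q_sums[OF t0 gC'])
    moreover have "p t n * d n x + p t n * (d (Suc n) x - d n x) = - \<eta> * (p t n * (g (Suc n) x - g n x))" for n
      by (simp add: d_def[of "Suc n"] algebra_simps)
    ultimately have 3: "q (\<lambda>n. d n x) t + q (\<lambda>n. d (Suc n) x - d n x) t = - \<eta> * q (\<lambda>n. g (Suc n) x - g n x) t"
      using sums_unique2 by simp
    have "lam * DxP t + caputo_deriv b (levy_tail \<nu>) DxP t
        = lam * (q (\<lambda>n. d n x) t + q (\<lambda>n. d (Suc n) x - d n x) t)"
      unfolding 2 Dq[OF t0, symmetric] by (simp add: distrib_left)
    then have "\<eta> * caputo_deriv b (levy_tail \<nu>) (\<lambda>r. P x r) t = - (lam * DxP t + caputo_deriv b (levy_tail \<nu>) DxP t)"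
      unfolding 1 3 by simp
    then show "\<eta> * caputo_deriv b (levy_tail \<nu>) (\<lambda>r. P x r) t
        = - (lam * caputo_deriv (power_drift \<beta>) (power_tail \<beta>) (\<lambda>y. P y t) x
            + caputo_deriv b (levy_tail \<nu>) (\<lambda>r. caputo_deriv (power_drift \<beta>) (power_tail \<beta>) (\<lambda>y. P y r) x) t)"
      by (simp add: DxP_def[abs_def])
  qed
  moreover

  \<comment> \<open>The mass of the positive half-line\<close>
  have "prob {\<omega>\<in>space M. Y t \<omega> > 0} = 1 - expectation (\<lambda>\<omega>. exp (- lam * E t \<omega>))" if t: "0 \<le> t" for t
  proof -
    note [measurable] = Y_meas[OF t] Nf[OF t]
    \<comment> \<open>Strict positivity of the jumps makes \<open>Y t > 0\<close> equivalent, almost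
      surely, to the occurrence of at least one jump.\<close>
    have "AE \<omega> in M. 0 < X i \<omega>" if i: "1 \<le> i" for i
    proof -
      have "emeasure M (X i -` {..0} \<inter> space M) = (\<integral>\<^sup>+x. ennreal (mittag_leffler_density \<beta> \<eta> x) * indicator {..0} x \<partial>lborel)"
        by (rule distributed_emeasure[OF X[OF i]]) simp
      also have "\<dots> = (\<integral>\<^sup>+(x::real). 0 \<partial>lborel)"
        by (rule nn_integral_cong) (auto simp: mittag_leffler_density_def indicator_def)
      finally have "emeasure M (X i -` {..0} \<inter> space M) = 0" by simp
      then show ?thesis
        using X_meas[OF i] by (intro AE_I[of _ _ "X i -` {..0} \<inter> space M"]) (auto simp: not_less)
    qed
    then have "AE \<omega> in M. \<forall>i\<in>{1..}. 0 < X i \<omega>" by (subst AE_ball_countable) auto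
    then have "prob {\<omega>\<in>space M. Y t \<omega> > 0} = prob {\<omega>\<in>space M. N (E t \<omega>) \<omega> \<noteq> 0}"
    proof (intro finite_measure_eq_AE, eventually_elim)
      case (elim \<omega>)
      have "0 < Y t \<omega> \<longleftrightarrow> N (E t \<omega>) \<omega> \<noteq> 0"
      proof (cases "N (E t \<omega>) \<omega> = 0")
        case False
        then have "0 < (\<Sum>i\<in>{1..N (E t \<omega>) \<omega>}. X i \<omega>)"
          using elim by (intro sum_pos) auto
        then show ?thesis using False by (simp add: Y_eq compound_process_def)
      qed (simp add: Y_eq compound_process_def)
      then show ?case by auto
    qed auto
    also have "\<dots> = 1 - prob {\<omega>\<in>space M. N (E t \<omega>) \<omega> = 0}"
      by (subst prob_compl[symmetric]) (auto intro!: arg_cong[where f=prob])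
    also have "prob {\<omega>\<in>space M. N (E t \<omega>) \<omega> = 0} = expectation (\<lambda>\<omega>. exp (- lam * E t \<omega>))"
    proof -
      \<comment> \<open>With the trivial event for the jumps and \<open>n = 0\<close>, the
        time-changed Poisson weight reduces to the exponential.\<close>
      let ?S = "space (PiM {1..} (\<lambda>_. borel)) :: (nat \<Rightarrow> real) set"
      have "restrict (\<lambda>i. X i \<omega>) {1..} \<in> ?S" for \<omega> by (simp add: space_PiM)
      then show ?thesis
        using poisson_time_change_prob[OF N lam indep_N_E indep_X E_nonneg t Nf[OF t], of ?S 0]
        by (simp add: poisson_weight_def prob_space)
    qed
    finally show ?thesis .
  qed
  ultimately show ?thesis by blast
qed

end
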